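(* Let $(M,d)$ be a complete metric space with base point $0$ satisfying the following condition: every $\mu\in\mathcal{M}(\beta\widetilde{M})$ such that $\Phi^*\mu\in\mathcal{F}(M)$ satisfies $\Phi^*\mu=\Phi^*(\mu|_{\widetilde{M}})$. Then $\mathcal{F}(M)$ is L-embedded (in its bidual $\mathcal{F}(M)^{**}=\mathrm{Lip}_0(M)^*$). The L-projection $P:\mathrm{Lip}_0(M)^*\to\mathcal{F}(M)$ is given by $$P(\phi)=\Phi^*(\mu|_{\widetilde{M}})\quad\text{where}\quad\phi=\Phi^*\mu\in\mathrm{Lip}_0(M)^*,$$ $\mu\in\mathcal{M}(\beta\widetilde{M})$ being any measure with $\Phi^*\mu=\phi$.
   Context: $(M,d)$ is a complete metric space with base point $0\in M$. $\mathrm{Lip}_0(M)$ is the Banach space of real-valued Lipschitz functions $f$ on $M$ with $f(0)=0$, normed by the optimal Lipschitz constant. For $x\in M$, $\delta(x)\in\mathrm{Lip}_0(M)^*$ is evaluation at $x$, and the Lipschitz-free space is $\mathcal{F}(M)=\overline{\mathrm{span}}\,\delta(M)\subset\mathrm{Lip}_0(M)^*$, which is an isometric predual of $\mathrm{Lip}_0(M)$. $\widetilde{M}=\{(x,y)\in M\times M: x\neq y\}$ and $\beta\widetilde{M}$ is its Stone-Čech compactification. $\mathcal{M}(\beta\widetilde{M})$ is the Banach space (total variation norm) of signed (finite) Radon measures on $\beta\widetilde{M}$. $\Phi:\mathrm{Lip}_0(M)\to C(\beta\widetilde{M})$ is the isometric embedding given by $(\Phi f)(x,y)=\frac{f(x)-f(y)}{d(x,y)}$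 on $\widetilde{M}$, extended continuously to $\beta\widetilde{M}$; its adjoint $\Phi^*:\mathcal{M}(\beta\widetilde{M})\to\mathrm{Lip}_0(M)^*$ is surjective. $\mu|_{\widetilde{M}}$ is the restriction of $\mu$ to the Borel set $\widetilde{M}$. A projection $P:X\to Y\subset X$ of a Banach space $X$ onto a subspace $Y$ is an L-projection if $\|x\|=\|Px\|+\|x-Px\|$ for all $x\in X$. A Banach space $X$ is L-embedded if it is the range of an L-projection from $X^{**}$. *)

theory Defs
  imports "HOL-Analysis.Analysis"
begin

section \<open>The Stone-Cech compactification\<close>

text \<open>
  The space is realised as the closure of the canonical image of \<open>X\<close> in the cube
  \<open>[0,1]\<^bsup>C(X,[0,1])\<^esup>\<close>.
\<close>

definition cube_coords :: "'b topology \<Rightarrow> ('b \<Rightarrow> real) set" where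
  "cube_coords X = {f \<in> extensional (topspace X). continuous_map X (top_of_set {0..1}) f}"

definition stone_cech_embed :: "'b topology \<Rightarrow> 'b \<Rightarrow> ('b \<Rightarrow> real) \<Rightarrow> real" where
  "stone_cech_embed X x = (\<lambda>f\<in>cube_coords X. f x)"

definition stone_cech :: "'b topology \<Rightarrow> (('b \<Rightarrow> real) \<Rightarrow> real) topology" where
  "stone_cech X =
     (let Q = product_topology (\<lambda>_. top_of_set {0..1::real}) (cube_coords X)
      in subtopology Q (Q closure_of (stone_cech_embed X ` topspace X)))"

text \<open>
  The continuous extension of a bounded continuous function; existence and uniqueness (on the
  carrier) are \<open>stone_cech_ext\<close> and \<open>stone_cech_ext_unique\<close> below. Values outside
  \<open>topspace (stone_cech X)\<close> are unspecified.
\<close>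

definition stone_cech_ext :: "'b topology \<Rightarrow> ('b \<Rightarrow> real) \<Rightarrow> (('b \<Rightarrow> real) \<Rightarrow> real) \<Rightarrow> real" where
  "stone_cech_ext X f = (SOME g. continuous_map (stone_cech X) euclideanreal g \<and>
      (\<forall>x\<in>topspace X. g (stone_cech_embed X x) = f x))"

lemma stone_cech_embed_in_cube:
  "x \<in> topspace X \<Longrightarrow>
    stone_cech_embed X x \<in> topspace (product_topology (\<lambda>_. top_of_set {0..1::real}) (cube_coords X))"
  by (auto simp: stone_cech_embed_def cube_coords_def continuous_map_def Pi_iff)

lemma topspace_stone_cech:
  "topspace (stone_cech X) = product_topology (\<lambda>_. top_of_set {0..1::real}) (cube_coords X)
      closure_of (stone_cech_embed X ` topspace X)"
  unfolding stone_cech_def Let_def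
  by (simp only: topspace_subtopology Int_absorb1[OF closure_of_subset_topspace])

lemma compact_space_stone_cech: "compact_space (stone_cech X)"
  unfolding stone_cech_def Let_def
  by (intro compact_space_subtopology closedin_compact_space closedin_closure_of)
     (simp add: compact_space_product_topology compact_space_subtopology)

lemma Hausdorff_space_stone_cech: "Hausdorff_space (stone_cech X)"
  unfolding stone_cech_def Let_def
  by (intro Hausdorff_space_subtopology)
     (simp add: Hausdorff_space_product_topology Hausdorff_space_subtopology)

lemma stone_cech_embed_in:
  assumes "x \<in> topspace X"
  shows "stone_cech_embed X x \<in> topspace (stone_cech X)"
proof -
  have "stone_cech_embed X ` topspace X \<subseteq>
      topspace (product_topology (\<lambda>_. top_of_set {0..1::real}) (cube_coords X))"
    by (rule image_subsetI) (rule stone_cech_embed_in_cube)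
  from subsetD[OF closure_of_subset[OF this] imageI[OF assms]] show ?thesis
    unfolding topspace_stone_cech .
qed

lemma stone_cech_embed_dense:
  "stone_cech X closure_of (stone_cech_embed X ` topspace X) = topspace (stone_cech X)"
proof -
  let ?e = "stone_cech_embed X ` topspace X"
  have *: "topspace (stone_cech X) \<inter> ?e = ?e"
    using stone_cech_embed_in[of _ X] by blast
  then show ?thesis
    unfolding topspace_stone_cech
    unfolding stone_cech_def Let_def closure_of_subtopology by (simp only: Int_absorb)
qed

lemma stone_cech_embedding:
  assumes "completely_regular_space X" "Hausdorff_space X"
  shows "embedding_map X (stone_cech X) (stone_cech_embed X)"
proof -
  have "mspace (submetric (cfunspace X euclidean_metric) {f. f \<in> topspace X \<rightarrow> {0..1}}) =
      cube_coords X"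
    by (auto simp: cube_coords_def continuous_map_in_subtopology Pi_iff image_subset_iff
        intro!: bounded_subset[OF bounded_closed_interval[of 0 1]])
  then have "embedding_map X (product_topology (\<lambda>_. top_of_set {0..1::real}) (cube_coords X))
      (stone_cech_embed X)"
    using completely_regular_space_cube_embedding_explicit[OF assms]
    by (simp add: stone_cech_embed_def[abs_def])
  then show ?thesis
    unfolding stone_cech_def Let_def embedding_map_in_subtopology
    using stone_cech_embed_in[of _ X] by (auto simp: topspace_stone_cech)
qed

lemma stone_cech_ext:
  assumes f: "continuous_map X euclideanreal f" and b: "bounded (f ` topspace X)"
  shows "continuous_map (stone_cech X) euclideanreal (stone_cech_ext X f)"
    and "\<And>x. x \<in> topspace X \<Longrightarrow> stone_cech_ext X f (stone_cech_embed X x) = f x"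
proof -
  obtain B where B: "B > 0" "\<And>x. x \<in> topspace X \<Longrightarrow> \<bar>f x\<bar> \<le> B"
    using b unfolding bounded_pos by auto
  define h where "h = (\<lambda>x\<in>topspace X. (f x + B) / (2 * B))"
  have h: "h \<in> cube_coords X"
  proof -
    have "continuous_map X euclideanreal (\<lambda>x. (f x + B) / (2 * B))"
      unfolding divide_inverse
      by (intro continuous_map_real_mult_right continuous_map_add f)
         (simp add: continuous_map_const)
    then have "continuous_map X euclideanreal h"
      by (rule continuous_map_eq) (simp add: h_def)
    moreover have "h x \<in> {0..1}" if "x \<in> topspace X" for x
    proof -
      have "- B \<le> f x" "f x \<le> B" using B(2)[OF that] by linarith+
      then show ?thesis using B(1) that by (simp add: h_def divide_le_eq)
    qed
    ultimately show ?thesis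
      by (auto simp: cube_coords_def h_def continuous_map_in_subtopology)
  qed
  define g where "g = (\<lambda>p :: ('a \<Rightarrow> real) \<Rightarrow> real. 2 * B * p h - B)"
  have "continuous_map (stone_cech X) (top_of_set {0..1}) (\<lambda>p. p h)"
    unfolding stone_cech_def Let_def
    using continuous_map_product_projection[OF h, of "\<lambda>_. top_of_set {0..1::real}"]
    by (rule continuous_map_from_subtopology)
  then have "continuous_map (stone_cech X) euclideanreal g"
    unfolding g_def
    by (intro continuous_map_diff continuous_map_real_mult_left)
       (auto simp: continuous_map_in_subtopology)
  moreover have "\<forall>x\<in>topspace X. g (stone_cech_embed X x) = f x"
    using h B(1) by (simp add: g_def stone_cech_embed_def) (simp add: h_def)
  ultimately have "\<exists>g. continuous_map (stone_cech X) euclideanreal g \<and>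
      (\<forall>x\<in>topspace X. g (stone_cech_embed X x) = f x)" by blast
  from someI_ex[OF this]
  show "continuous_map (stone_cech X) euclideanreal (stone_cech_ext X f)"
    and "\<And>x. x \<in> topspace X \<Longrightarrow> stone_cech_ext X f (stone_cech_embed X x) = f x"
    unfolding stone_cech_ext_def by auto
qed

lemma stone_cech_ext_unique:
  assumes "continuous_map (stone_cech X) euclideanreal g" "continuous_map (stone_cech X) euclideanreal h"
    and "\<And>x. x \<in> topspace X \<Longrightarrow> g (stone_cech_embed X x) = h (stone_cech_embed X x)"
    and "p \<in> topspace (stone_cech X)"
  shows "g p = h p"
  by (rule forall_in_closure_of_eq[of p "stone_cech X" "stone_cech_embed X ` topspace X" euclideanreal])
     (use assms stone_cech_embed_dense in auto)

section \<open>Signed Radon measures\<close>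

definition borel_of :: "'b topology \<Rightarrow> 'b measure" where
  "borel_of X = sigma (topspace X) {U. openin X U}"

definition radon_measure :: "'b topology \<Rightarrow> 'b measure \<Rightarrow> bool" where
  "radon_measure X m \<longleftrightarrow> sets m = sets (borel_of X) \<and> finite_measure m \<and>
     (\<forall>A\<in>sets m. emeasure m A = (SUP K\<in>{K. compactin X K \<and> K \<subseteq> A}. emeasure m K))"

text \<open>
  A signed Borel measure is a real-valued set function; only its values on Borel sets matter.
\<close>

definition signed_borel_measure :: "'b topology \<Rightarrow> ('b set \<Rightarrow> real) \<Rightarrow> bool" where
  "signed_borel_measure X \<nu> \<longleftrightarrow> \<nu> {} = 0 \<and>
     (\<forall>A. range A \<subseteq> sets (borel_of X) \<longrightarrow> disjoint_family A \<longrightarrow>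
        (\<lambda>n::nat. \<nu> (A n)) sums \<nu> (\<Union>n. A n))"

text \<open>
  The positive variation \<open>\<nu>\<^sup>+(A) = sup {\<nu>(B) | B \<subseteq> A Borel}\<close> of the Jordan decomposition. Truncation
  by \<open>ennreal\<close> is harmless since \<open>B = {}\<close> contributes \<open>0\<close>. That \<open>measure_of\<close> has these values is
  \<open>emeasure_pos_variation\<close> below.
\<close>

definition pos_variation :: "'b topology \<Rightarrow> ('b set \<Rightarrow> real) \<Rightarrow> 'b measure" where
  "pos_variation X \<nu> = measure_of (topspace X) (sets (borel_of X))
     (\<lambda>A. SUP B\<in>{B \<in> sets (borel_of X). B \<subseteq> A}. ennreal (\<nu> B))"

definition neg_variation :: "'b topology \<Rightarrow> ('b set \<Rightarrow> real) \<Rightarrow> 'b measure" where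
  "neg_variation X \<nu> = pos_variation X (\<lambda>A. - \<nu> A)"

definition signed_radon_measure :: "'b topology \<Rightarrow> ('b set \<Rightarrow> real) \<Rightarrow> bool" where
  "signed_radon_measure X \<nu> \<longleftrightarrow> signed_borel_measure X \<nu> \<and>
     radon_measure X (pos_variation X \<nu>) \<and> radon_measure X (neg_variation X \<nu>)"

definition signed_integral :: "'b topology \<Rightarrow> ('b set \<Rightarrow> real) \<Rightarrow> ('b \<Rightarrow> real) \<Rightarrow> real" where
  "signed_integral X \<nu> f = integral\<^sup>L (pos_variation X \<nu>) f - integral\<^sup>L (neg_variation X \<nu>) f"

definition restrict_signed :: "('b set \<Rightarrow> real) \<Rightarrow> 'b set \<Rightarrow> 'b set \<Rightarrow> real" where
  "restrict_signed \<nu> S A = \<nu> (A \<inter> S)"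

lemma space_borel_of [simp]: "space (borel_of X) = topspace X"
  by (simp add: borel_of_def space_measure_of_conv)

lemma sets_pos_variation [simp]: "sets (pos_variation X \<nu>) = sets (borel_of X)"
  unfolding pos_variation_def
  using sets.sets_measure_of_eq[of "borel_of X"] by simp

lemma emeasure_pos_variation:
  assumes \<nu>: "signed_borel_measure X \<nu>" and A: "A \<in> sets (borel_of X)"
  shows "emeasure (pos_variation X \<nu>) A = (SUP B\<in>{B \<in> sets (borel_of X). B \<subseteq> A}. ennreal (\<nu> B))"
proof -
  let ?S = "sets (borel_of X)"
  define p where "p A = (SUP B\<in>{B \<in> ?S. B \<subseteq> A}. ennreal (\<nu> B))" for A
  have \<nu>0: "\<nu> {} = 0" and \<nu>s: "\<And>A. range A \<subseteq> ?S \<Longrightarrow> disjoint_family A \<Longrightarrow>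
      (\<lambda>n::nat. \<nu> (A n)) sums \<nu> (\<Union>n. A n)"
    using \<nu> unfolding signed_borel_measure_def by blast+
  have up: "ennreal (\<nu> B) \<le> p A" if "B \<in> ?S" "B \<subseteq> A" for A B
    unfolding p_def using that by (auto intro: SUP_upper)
  have add: "\<nu> (B \<union> C) = \<nu> B + \<nu> C" if "B \<in> ?S" "C \<in> ?S" "B \<inter> C = {}" for B C
  proof -
    have "(\<lambda>n. \<nu> (binaryset B C n)) sums \<nu> (\<Union>n. binaryset B C n)"
      using that by (intro \<nu>s) (auto simp: binaryset_def disjoint_family_on_def)
    moreover have "(\<lambda>n. \<nu> (binaryset B C n)) sums (\<nu> B + \<nu> C)"
      using \<nu>0 by (rule binaryset_sums)
    ultimately show ?thesis
      by (simp add: UN_binaryset_eq sums_iff)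
  qed
  have padd: "p B + p C \<le> p (B \<union> C)" if "B \<inter> C = {}" for B C
  proof -
    have "ennreal (\<nu> D) + ennreal (\<nu> E) \<le> p (B \<union> C)"
      if D: "D \<in> ?S" "D \<subseteq> B" and E: "E \<in> ?S" "E \<subseteq> C" for D E
    proof -
      have "\<nu> (D \<union> E) = \<nu> D + \<nu> E"
        using D E \<open>B \<inter> C = {}\<close> by (intro add) auto
      then have "ennreal (\<nu> D + \<nu> E) \<le> p (B \<union> C)"
        using up[of "D \<union> E" "B \<union> C"] D E by auto
      moreover have "ennreal (\<nu> D) \<le> p (B \<union> C)" "ennreal (\<nu> E) \<le> p (B \<union> C)"
        using up[of D "B \<union> C"] up[of E "B \<union> C"] D E by auto
      ultimately show ?thesis
        by (cases "\<nu> D \<ge> 0"; cases "\<nu> E \<ge> 0") (auto simp: ennreal_neg ennreal_plus)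
    qed
    then have "ennreal (\<nu> D) + p C \<le> p (B \<union> C)" if "D \<in> ?S" "D \<subseteq> B" for D
      unfolding p_def[of C] using that
      by (subst ennreal_SUP_add_right) (auto intro!: SUP_least)
    then show ?thesis
      unfolding p_def[of B]
      by (subst ennreal_SUP_add_left[symmetric]) (auto intro!: SUP_least)
  qed
  have "countably_additive ?S p"
  proof (rule countably_additiveI)
    fix A :: "nat \<Rightarrow> 'a set"
    assume A: "range A \<subseteq> ?S" "disjoint_family A" "(\<Union>i. A i) \<in> ?S"
    show "(\<Sum>i. p (A i)) = p (\<Union>i. A i)"
    proof (rule antisym)
      have "(\<Sum>i<n. p (A i)) \<le> p (\<Union>i<n. A i)" for n
      proof (induction n)
        case (Suc n)
        have "A i \<inter> A n = {}" if "i < n" for i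
          using disjoint_family_onD[OF A(2), of i n] that by simp
        then have "(\<Union>i<n. A i) \<inter> A n = {}"
          by blast
        have "(\<Sum>i<Suc n. p (A i)) = (\<Sum>i<n. p (A i)) + p (A n)"
          by simp
        also have "\<dots> \<le> p (\<Union>i<n. A i) + p (A n)"
          by (intro add_right_mono Suc)
        also have "\<dots> \<le> p ((\<Union>i<n. A i) \<union> A n)"
          by (rule padd) fact
        also have "(\<Union>i<n. A i) \<union> A n = (\<Union>i<Suc n. A i)"
          by (auto simp: lessThan_Suc)
        finally show ?case .
      qed simp
      moreover have "p (\<Union>i<n. A i) \<le> p (\<Union>i. A i)" for n
        unfolding p_def by (intro SUP_subset_mono) auto
      ultimately have "(\<Sum>i<n. p (A i)) \<le> p (\<Union>i. A i)" for n
        by (rule order_trans)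
      then show "(\<Sum>i. p (A i)) \<le> p (\<Union>i. A i)"
        by (intro suminf_le_const) auto
      show "p (\<Union>i. A i) \<le> (\<Sum>i. p (A i))"
        unfolding p_def[of "\<Union>i. A i"]
      proof (intro SUP_least)
        fix B assume "B \<in> {B \<in> ?S. B \<subseteq> (\<Union>i. A i)}"
        then have B: "B \<in> ?S" "B = (\<Union>i. B \<inter> A i)" by auto
        have "(\<lambda>n. \<nu> (B \<inter> A n)) sums \<nu> (\<Union>n. B \<inter> A n)"
          using A B(1) by (intro \<nu>s) (auto simp: disjoint_family_on_def)
        then have "(\<lambda>n. \<nu> (B \<inter> A n)) sums \<nu> B"
          using B(2) by simp
        then have "(\<lambda>n. ennreal (\<Sum>i<n. \<nu> (B \<inter> A i))) \<longlonglongrightarrow> ennreal (\<nu> B)"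
          unfolding sums_def by (rule tendsto_ennrealI)
        moreover have "ennreal (\<Sum>i<n. \<nu> (B \<inter> A i)) \<le> (\<Sum>i. p (A i))" for n
        proof -
          have "ennreal (\<Sum>i<n. \<nu> (B \<inter> A i)) \<le> ennreal (\<Sum>i<n. max 0 (\<nu> (B \<inter> A i)))"
            by (intro ennreal_leI sum_mono) auto
          also have "\<dots> = (\<Sum>i<n. ennreal (max 0 (\<nu> (B \<inter> A i))))"
            by simp
          also have "\<dots> \<le> (\<Sum>i<n. p (A i))"
            using A B(1) by (intro sum_mono) (auto simp: max_def ennreal_neg intro!: up)
          also have "\<dots> \<le> (\<Sum>i. p (A i))"
            by (rule sum_le_suminf) auto
          finally show ?thesis .
        qed
        ultimately show "ennreal (\<nu> B) \<le> (\<Sum>i. p (A i))"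
          by (intro LIMSEQ_le_const2) auto
      qed
    qed
  qed
  moreover have "positive ?S p"
    unfolding positive_def p_def using \<nu>0 by (simp add: SUP_eq_const cong: conj_cong)
  moreover have "sigma_algebra (topspace X) ?S"
    using sets.sigma_algebra_axioms[of "borel_of X"] by simp
  ultimately show ?thesis
    using A unfolding pos_variation_def p_def[symmetric]
    by (intro emeasure_measure_of_sigma)
qed

section \<open>The spaces of Lipschitz functions vanishing at the base point\<close>

text \<open>
  The base point of \<open>M\<close> is an arbitrary element, provided by the syntactic class \<open>zero\<close>.
\<close>

typedef (overloaded) 'a lip0 =
  "{f :: 'a::{metric_space,zero} \<Rightarrow> real. f 0 = 0 \<and> (\<exists>L. L-lipschitz_on UNIV f)}"
  morphisms lip0_apply Abs_lip0
  by (rule exI[of _ "\<lambda>_. 0"]) (auto intro: lipschitz_on_constant)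

setup_lifting type_definition_lip0

lemma lip0_zero [simp]: "lip0_apply f 0 = 0"
  using lip0_apply[of f] by auto

lemma lip0_eqI: "(\<And>x. lip0_apply f x = lip0_apply g x) \<Longrightarrow> f = g"
  by (metis ext lip0_apply_inject)

instantiation lip0 :: ("{metric_space,zero}") real_normed_vector
begin

lift_definition zero_lip0 :: "'a lip0" is "\<lambda>_. 0"
  by (auto intro: lipschitz_on_constant)

lift_definition plus_lip0 :: "'a lip0 \<Rightarrow> 'a lip0 \<Rightarrow> 'a lip0" is "\<lambda>f g x. f x + g x"
  by (auto intro: lipschitz_on_add)

lift_definition uminus_lip0 :: "'a lip0 \<Rightarrow> 'a lip0" is "\<lambda>f x. - f x"
  by (auto intro: lipschitz_on_minus)

lift_definition minus_lip0 :: "'a lip0 \<Rightarrow> 'a lip0 \<Rightarrow> 'a lip0" is "\<lambda>f g x. f x - g x"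
  by (auto intro: lipschitz_on_diff)

lift_definition scaleR_lip0 :: "real \<Rightarrow> 'a lip0 \<Rightarrow> 'a lip0" is "\<lambda>c f x. c * f x"
  by (auto intro: lipschitz_on_cmult_real)

definition norm_lip0 :: "'a lip0 \<Rightarrow> real" where
  "norm_lip0 f = Inf {L. L-lipschitz_on UNIV (lip0_apply f)}"

definition dist_lip0 :: "'a lip0 \<Rightarrow> 'a lip0 \<Rightarrow> real" where
  "dist_lip0 f g = norm (f - g)"

definition sgn_lip0 :: "'a lip0 \<Rightarrow> 'a lip0" where
  "sgn_lip0 f = scaleR (inverse (norm f)) f"

definition uniformity_lip0 :: "('a lip0 \<times> 'a lip0) filter" where
  "uniformity_lip0 = (INF e\<in>{0 <..}. principal {(x, y). dist x y < e})"

definition open_lip0 :: "'a lip0 set \<Rightarrow> bool" where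
  "open_lip0 S = (\<forall>x\<in>S. \<forall>\<^sub>F (x', y) in uniformity. x' = x \<longrightarrow> y \<in> S)"

lemma norm_lip0_le: "L-lipschitz_on UNIV (lip0_apply f) \<Longrightarrow> norm f \<le> L"
  unfolding norm_lip0_def
  by (intro cInf_lower bdd_belowI[of _ 0]) (auto dest: lipschitz_on_nonneg)

lemma lipschitz_on_norm_lip0: "(norm f)-lipschitz_on UNIV (lip0_apply f)"
proof -
  let ?S = "{L. L-lipschitz_on UNIV (lip0_apply f)}"
  have ne: "?S \<noteq> {}"
    using lip0_apply[of f] by auto
  have n0: "norm f \<ge> 0"
    unfolding norm_lip0_def using ne by (intro cInf_greatest) (auto dest: lipschitz_on_nonneg)
  show ?thesis
  proof (rule lipschitz_onI[OF _ n0])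
    fix x y :: 'a
    show "dist (lip0_apply f x) (lip0_apply f y) \<le> norm f * dist x y"
    proof (cases "x = y")
      case False
      have "dist (lip0_apply f x) (lip0_apply f y) / dist x y \<le> norm f"
        unfolding norm_lip0_def using ne False
        by (intro cInf_greatest) (auto simp: divide_le_eq dest!: lipschitz_onD)
      then show ?thesis using False by (simp add: divide_le_eq)
    qed simp
  qed
qed

instance
proof
  fix f g h :: "'a lip0" and a b :: real
  show "f + g + h = f + (g + h)" "f + g = g + f" "0 + f = f" "- f + f = 0" "f - g = f + - g"
    "a *\<^sub>R (f + g) = a *\<^sub>R f + a *\<^sub>R g" "(a + b) *\<^sub>R f = a *\<^sub>R f + b *\<^sub>R f"
    "a *\<^sub>R b *\<^sub>R f = (a * b) *\<^sub>R f" "1 *\<^sub>R f = f"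
    by (transfer; auto simp: algebra_simps)+
  show "dist f g = norm (f - g)" "sgn f = scaleR (inverse (norm f)) f"
    by (simp_all add: dist_lip0_def sgn_lip0_def)
  show "uniformity = (INF e\<in>{0 <..}. principal {(x, y :: 'a lip0). dist x y < e})"
    by (rule uniformity_lip0_def)
  show "open U = (\<forall>x\<in>U. \<forall>\<^sub>F (x', y) in uniformity. x' = x \<longrightarrow> y \<in> U)" for U :: "'a lip0 set"
    by (rule open_lip0_def)
  show "norm (f + g) \<le> norm f + norm g"
    using lipschitz_on_add[OF lipschitz_on_norm_lip0 lipschitz_on_norm_lip0]
    by (intro norm_lip0_le) (simp add: plus_lip0.rep_eq)
  have le: "norm (c *\<^sub>R k) \<le> \<bar>c\<bar> * norm k" for c and k :: "'a lip0"
    using lipschitz_on_cmult_real[OF lipschitz_on_norm_lip0, of c k]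
    by (intro norm_lip0_le) (simp add: scaleR_lip0.rep_eq)
  show "norm (a *\<^sub>R f) = \<bar>a\<bar> * norm f"
  proof (cases "a = 0")
    case False
    have "f = inverse a *\<^sub>R a *\<^sub>R f"
      using False by transfer (auto simp: field_simps)
    then have "norm f \<le> \<bar>inverse a\<bar> * norm (a *\<^sub>R f)"
      using le by metis
    then have "\<bar>a\<bar> * norm f \<le> norm (a *\<^sub>R f)"
      using False by (simp add: field_simps abs_mult)
    with le[of a f] show ?thesis by simp
  next
    case True
    then show ?thesis
      using le[of a f] lipschitz_on_nonneg[OF lipschitz_on_norm_lip0[of "a *\<^sub>R f"]] by simp
  qed
  show "norm f = 0 \<longleftrightarrow> f = 0"
  proof
    assume "norm f = 0"
    then have "lip0_apply f x = lip0_apply f 0" for x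
      using lipschitz_onD[OF lipschitz_on_norm_lip0[of f], of x 0] by simp
    then show "f = 0"
      by (intro lip0_eqI) (simp add: zero_lip0.rep_eq)
  next
    assume "f = 0"
    then show "norm f = 0"
      using lipschitz_on_nonneg[OF lipschitz_on_norm_lip0[of f]] norm_lip0_le[of 0 f]
      by (simp add: zero_lip0.rep_eq lipschitz_on_constant)
  qed
qed

end

section \<open>The Lipschitz-free space\<close>

type_synonym 'a lip0_dual = "'a lip0 \<Rightarrow>\<^sub>L real"

lift_definition lip_eval :: "'a::{metric_space,zero} \<Rightarrow> 'a lip0_dual" is "\<lambda>x f. lip0_apply f x"
proof (rule bounded_linear_intro)
  fix x :: 'a and f g :: "'a lip0" and r :: real
  show "lip0_apply (f + g) x = lip0_apply f x + lip0_apply g x"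
    by (simp add: plus_lip0.rep_eq)
  show "lip0_apply (r *\<^sub>R f) x = r *\<^sub>R lip0_apply f x"
    by (simp add: scaleR_lip0.rep_eq)
  show "norm (lip0_apply f x) \<le> norm f * dist x 0"
    using lipschitz_onD[OF lipschitz_on_norm_lip0[of f], of x 0] by simp
qed

definition free_space :: "'a::{metric_space,zero} lip0_dual set" where
  "free_space = closure (span (range lip_eval))"

lemma subspace_free_space: "subspace (free_space :: 'a::{metric_space,zero} lip0_dual set)"
proof -
  have S: "subspace (span (range lip_eval) :: 'a lip0_dual set)"
    by (rule subspace_span)
  show ?thesis
    unfolding free_space_def
  proof (rule subspaceI)
    show "0 \<in> closure (span (range lip_eval) :: 'a lip0_dual set)"
      using closure_subset subspace_0[OF S] by blast
  next
    fix x y :: "'a lip0_dual"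
    assume "x \<in> closure (span (range lip_eval))" "y \<in> closure (span (range lip_eval))"
    then obtain u v where "\<And>n. u n \<in> span (range lip_eval)" "u \<longlonglongrightarrow> x"
        "\<And>n. v n \<in> span (range lip_eval)" "v \<longlonglongrightarrow> y"
      unfolding closure_sequential by blast
    then show "x + y \<in> closure (span (range lip_eval))"
      unfolding closure_sequential
      by (intro exI[of _ "\<lambda>n. u n + v n"]) (auto intro: span_add tendsto_add)
  next
    fix c and x :: "'a lip0_dual"
    assume "x \<in> closure (span (range lip_eval))"
    then obtain u where "\<And>n. u n \<in> span (range lip_eval)" "u \<longlonglongrightarrow> x"
      unfolding closure_sequential by blast
    then show "c *\<^sub>R x \<in> closure (span (range lip_eval))"
      unfolding closure_sequential
      by (intro exI[of _ "\<lambda>n. c *\<^sub>R u n"]) (auto intro: span_scale tendsto_scaleR)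
  qed
qed

text \<open>The same space as a type of its own, so that its dual and bidual can be formed.\<close>

typedef (overloaded) 'a lipfree = "free_space :: 'a::{metric_space,zero} lip0_dual set"
  morphisms lipfree_incl Abs_lipfree
  using subspace_0[OF subspace_free_space] by blast

setup_lifting type_definition_lipfree

instantiation lipfree :: ("{metric_space,zero}") real_normed_vector
begin

lift_definition zero_lipfree :: "'a lipfree" is 0
  by (rule subspace_0[OF subspace_free_space])

lift_definition plus_lipfree :: "'a lipfree \<Rightarrow> 'a lipfree \<Rightarrow> 'a lipfree" is "(+)"
  by (rule subspace_add[OF subspace_free_space])

lift_definition uminus_lipfree :: "'a lipfree \<Rightarrow> 'a lipfree" is uminus
  by (rule subspace_neg[OF subspace_free_space])

lift_definition minus_lipfree :: "'a lipfree \<Rightarrow> 'a lipfree \<Rightarrow> 'a lipfree" is "(-)"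
  by (rule subspace_diff[OF subspace_free_space])

lift_definition scaleR_lipfree :: "real \<Rightarrow> 'a lipfree \<Rightarrow> 'a lipfree" is scaleR
  by (rule subspace_scale[OF subspace_free_space])

lift_definition norm_lipfree :: "'a lipfree \<Rightarrow> real" is norm .

lift_definition dist_lipfree :: "'a lipfree \<Rightarrow> 'a lipfree \<Rightarrow> real" is dist .

lift_definition sgn_lipfree :: "'a lipfree \<Rightarrow> 'a lipfree" is sgn
  by (simp add: sgn_div_norm subspace_scale[OF subspace_free_space])

definition uniformity_lipfree :: "('a lipfree \<times> 'a lipfree) filter" where
  "uniformity_lipfree = (INF e\<in>{0 <..}. principal {(x, y). dist x y < e})"

definition open_lipfree :: "'a lipfree set \<Rightarrow> bool" where
  "open_lipfree S = (\<forall>x\<in>S. \<forall>\<^sub>F (x', y) in uniformity. x' = x \<longrightarrow> y \<in> S)"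

instance
proof
  fix f g h :: "'a lipfree" and a b :: real
  show "f + g + h = f + (g + h)" "f + g = g + f" "0 + f = f" "- f + f = 0" "f - g = f + - g"
    "a *\<^sub>R (f + g) = a *\<^sub>R f + a *\<^sub>R g" "(a + b) *\<^sub>R f = a *\<^sub>R f + b *\<^sub>R f"
    "a *\<^sub>R b *\<^sub>R f = (a * b) *\<^sub>R f" "1 *\<^sub>R f = f"
    by (transfer; simp add: algebra_simps)+
  show "dist f g = norm (f - g)" "sgn f = scaleR (inverse (norm f)) f"
    by (transfer; simp add: dist_norm sgn_div_norm)+
  show "uniformity = (INF e\<in>{0 <..}. principal {(x, y :: 'a lipfree). dist x y < e})"
    by (rule uniformity_lipfree_def)
  show "open U = (\<forall>x\<in>U. \<forall>\<^sub>F (x', y) in uniformity. x' = x \<longrightarrow> y \<in> U)" for U :: "'a lipfree set"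
    by (rule open_lipfree_def)
  show "norm (f + g) \<le> norm f + norm g"
    by transfer (rule norm_triangle_ineq)
  show "norm (a *\<^sub>R f) = \<bar>a\<bar> * norm f" "norm f = 0 \<longleftrightarrow> f = 0"
    by (transfer; simp)+
qed

end

lemma bounded_linear_lipfree_incl: "bounded_linear lipfree_incl"
  by (rule bounded_linear_intro[where K = 1])
     (simp_all add: plus_lipfree.rep_eq scaleR_lipfree.rep_eq norm_lipfree.rep_eq)

instance lipfree :: ("{metric_space,zero}") banach
proof
  fix s :: "nat \<Rightarrow> 'a lipfree"
  assume s: "Cauchy s"
  then have "Cauchy (\<lambda>n. lipfree_incl (s n))"
    by (rule bounded_linear.Cauchy[OF bounded_linear_lipfree_incl])
  then obtain l where l: "(\<lambda>n. lipfree_incl (s n)) \<longlonglongrightarrow> l"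
    using Cauchy_convergent_iff convergent_def by blast
  have "closed (free_space :: 'a lip0_dual set)"
    by (simp add: free_space_def)
  then have "l \<in> free_space"
    by (rule closed_sequentially) (use l lipfree_incl in auto)
  then have "l = lipfree_incl (Abs_lipfree l)"
    by (simp add: Abs_lipfree_inverse)
  with l have "(\<lambda>n. dist (s n) (Abs_lipfree l)) \<longlonglongrightarrow> 0"
    by (simp add: dist_lipfree.rep_eq tendsto_dist_iff[symmetric])
  then show "convergent s"
    unfolding convergent_def by (metis tendsto_dist_iff)
qed

section \<open>L-projections and L-embedded spaces\<close>

definition L_projection :: "('b::real_normed_vector \<Rightarrow> 'b) \<Rightarrow> 'b set \<Rightarrow> bool" where
  "L_projection P Y \<longleftrightarrow> bounded_linear P \<and> range P = Y \<and> (\<forall>x. P (P x) = P x) \<and>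
     (\<forall>x. norm x = norm (P x) + norm (x - P x))"

type_synonym 'b bidual = "('b \<Rightarrow>\<^sub>L real) \<Rightarrow>\<^sub>L real"

lift_definition bidual_embed :: "'b::real_normed_vector \<Rightarrow> 'b bidual" is
  "\<lambda>x \<phi>. blinfun_apply \<phi> x"
  by (rule blinfun.bounded_linear_left)

definition L_embedded :: "'b::banach itself \<Rightarrow> bool" where
  "L_embedded _ \<longleftrightarrow>
     (\<exists>P :: 'b bidual \<Rightarrow> 'b bidual. L_projection P (range bidual_embed))"

section \<open>The identification of the bidual with the dual of the Lipschitz space\<close>

lift_definition lip_functional :: "'a::{metric_space,zero} lip0 \<Rightarrow> ('a lipfree \<Rightarrow>\<^sub>L real)" is
  "\<lambda>f m. blinfun_apply (lipfree_incl m) f"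
  by (rule bounded_linear_compose[OF blinfun.bounded_linear_left bounded_linear_lipfree_incl])

lemma bounded_linear_lip_functional: "bounded_linear lip_functional"
proof (rule bounded_linear_intro[where K = 1])
  fix f g :: "'a lip0" and r :: real
  show "lip_functional (f + g) = lip_functional f + lip_functional g"
    by (rule blinfun_eqI) (simp add: lip_functional.rep_eq blinfun.add_left blinfun.add_right)
  show "lip_functional (r *\<^sub>R f) = r *\<^sub>R lip_functional f"
    by (rule blinfun_eqI)
       (simp add: lip_functional.rep_eq blinfun.scaleR_left blinfun.scaleR_right)
  show "norm (lip_functional f) \<le> norm f * 1"
    using norm_blinfun[of "lipfree_incl _" f]
    by (intro norm_blinfun_bound)
       (simp_all add: lip_functional.rep_eq norm_lipfree.rep_eq mult.commute)
qed

lift_definition lipfree_eval :: "'a::{metric_space,zero} \<Rightarrow> 'a lipfree" is lip_eval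
  unfolding free_space_def by (meson closure_subset rangeI span_base subsetD)

lemma lip_functional_eval: "lip_functional f (lipfree_eval x) = lip0_apply f x"
  by (simp add: lip_functional.rep_eq lipfree_eval.rep_eq lip_eval.rep_eq)

lemma norm_lipfree_eval_diff: "norm (lipfree_eval x - lipfree_eval y) \<le> dist x y"
proof -
  have "\<bar>lip0_apply f x - lip0_apply f y\<bar> \<le> dist x y * norm f" for f
    using lipschitz_onD[OF lipschitz_on_norm_lip0[of f], of x y]
    by (simp add: dist_real_def mult.commute)
  then show ?thesis
    by (simp add: norm_lipfree.rep_eq minus_lipfree.rep_eq lipfree_eval.rep_eq)
       (intro norm_blinfun_bound, auto simp: blinfun.diff_left lip_eval.rep_eq)
qed

lemma norm_lip_functional: "norm (lip_functional f) = norm f"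
proof (rule antisym)
  show "norm (lip_functional f) \<le> norm f"
    using norm_blinfun[of "lipfree_incl _" f]
    by (intro norm_blinfun_bound)
       (simp_all add: lip_functional.rep_eq norm_lipfree.rep_eq mult.commute)
  show "norm f \<le> norm (lip_functional f)"
  proof (intro norm_lip0_le lipschitz_onI)
    fix x y
    have "dist (lip0_apply f x) (lip0_apply f y) =
        norm (lip_functional f (lipfree_eval x - lipfree_eval y))"
      by (simp add: dist_norm blinfun.diff_right lip_functional_eval)
    also have "\<dots> \<le> norm (lip_functional f) * dist x y"
      using norm_blinfun norm_lipfree_eval_diff
      by (meson mult_left_mono norm_ge_zero order_trans)
    finally show "dist (lip0_apply f x) (lip0_apply f y) \<le> norm (lip_functional f) * dist x y" .
  qed (rule norm_ge_zero)
qed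

lemma bij_lip_functional: "bij (lip_functional :: 'a::{metric_space,zero} lip0 \<Rightarrow> _)"
proof (rule bijI)
  show "inj (lip_functional :: 'a lip0 \<Rightarrow> _)"
  proof (rule injI)
    fix f g :: "'a lip0" assume "lip_functional f = lip_functional g"
    then show "f = g"
      by (intro lip0_eqI) (metis lip_functional_eval)
  qed
  show "surj (lip_functional :: 'a lip0 \<Rightarrow> _)"
    unfolding surj_def
  proof
    fix \<psi> :: "'a lipfree \<Rightarrow>\<^sub>L real"
    have e0: "lipfree_eval 0 = (0 :: 'a lipfree)"
      by transfer (auto intro!: blinfun_eqI simp: lip_eval.rep_eq)
    have "(norm \<psi>)-lipschitz_on UNIV (\<lambda>x. \<psi> (lipfree_eval x))"
    proof (rule lipschitz_onI)
      fix x y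
      have "dist (\<psi> (lipfree_eval x)) (\<psi> (lipfree_eval y)) =
          norm (\<psi> (lipfree_eval x - lipfree_eval y))"
        by (simp add: dist_norm blinfun.diff_right)
      also have "\<dots> \<le> norm \<psi> * dist x y"
        using norm_blinfun norm_lipfree_eval_diff
        by (meson mult_left_mono norm_ge_zero order_trans)
      finally show "dist (\<psi> (lipfree_eval x)) (\<psi> (lipfree_eval y)) \<le> norm \<psi> * dist x y" .
    qed (rule norm_ge_zero)
    then have "\<exists>f. \<forall>x. lip0_apply f x = \<psi> (lipfree_eval x)"
      by (intro exI[of _ "Abs_lip0 (\<lambda>x. \<psi> (lipfree_eval x))"] allI, subst Abs_lip0_inverse)
         (auto simp: e0)
    then obtain f where f: "\<And>x. lip0_apply f x = \<psi> (lipfree_eval x)" by blast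
    define T where "T = {m. \<psi> m = lip_functional f m}"
    have T: "subspace T"
      by (auto simp: T_def subspace_def blinfun.add_right blinfun.scaleR_right)
    have "closed T"
      unfolding T_def by (intro closed_Collect_eq continuous_intros)
    then have "complete (lipfree_incl ` T)"
      by (intro complete_isometric_image[where e = 1] T bounded_linear_lipfree_incl)
         (auto simp: norm_lipfree.rep_eq complete_eq_closed)
    then have "closed (lipfree_incl ` T)"
      by (rule complete_imp_closed)
    moreover have "subspace (lipfree_incl ` T)"
      by (rule linear_subspace_image[OF bounded_linear.linear[OF bounded_linear_lipfree_incl] T])
    moreover have "range lip_eval \<subseteq> lipfree_incl ` T"
    proof
      fix u :: "'a lip0_dual" assume "u \<in> range lip_eval"
      then obtain x where "u = lipfree_incl (lipfree_eval x)"
        by (auto simp: lipfree_eval.rep_eq)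
      moreover have "lipfree_eval x \<in> T"
        by (simp add: T_def lip_functional_eval f)
      ultimately show "u \<in> lipfree_incl ` T" by blast
    qed
    ultimately have "free_space \<subseteq> lipfree_incl ` T"
      unfolding free_space_def by (intro closure_minimal span_minimal)
    then have "lipfree_incl m \<in> lipfree_incl ` T" for m
      using lipfree_incl by (rule subsetD)
    then have "m \<in> T" for m
      by (simp add: image_iff lipfree_incl_inject)
    then have "\<psi> = lip_functional f"
      by (intro blinfun_eqI) (auto simp: T_def)
    then show "\<exists>f. \<psi> = lip_functional f" ..
  qed
qed

text \<open>The adjoint of the isometric isomorphism \<open>lip_functional\<close>.\<close>

lift_definition bidual_iso :: "'a::{metric_space,zero} lipfree bidual \<Rightarrow> 'a lip0_dual" is
  "\<lambda>\<Psi> f. \<Psi> (lip_functional f)"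
  by (rule bounded_linear_compose[OF _ bounded_linear_lip_functional])

lemma norm_bidual_iso:
  fixes \<Psi> :: "'a::{metric_space,zero} lipfree bidual"
  shows "norm (bidual_iso \<Psi>) = norm \<Psi>"
proof (rule antisym)
  show "norm (bidual_iso \<Psi>) \<le> norm \<Psi>"
    using norm_blinfun[of \<Psi> "lip_functional _"]
    by (intro norm_blinfun_bound) (auto simp: bidual_iso.rep_eq norm_lip_functional)
  show "norm \<Psi> \<le> norm (bidual_iso \<Psi>)"
  proof (rule norm_blinfun_bound)
    fix \<psi> :: "'a lipfree \<Rightarrow>\<^sub>L real"
    obtain f where "\<psi> = lip_functional f"
      using bij_lip_functional by (metis bij_pointE)
    then show "norm (\<Psi> \<psi>) \<le> norm (bidual_iso \<Psi>) * norm \<psi>"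
      using norm_blinfun[of "bidual_iso \<Psi>" f]
      by (simp add: bidual_iso.rep_eq norm_lip_functional)
  qed simp
qed

lemma bounded_linear_bidual_iso: "bounded_linear bidual_iso"
  by (rule bounded_linear_intro[where K = 1])
     (auto intro!: blinfun_eqI
       simp: norm_bidual_iso bidual_iso.rep_eq blinfun.add_left blinfun.scaleR_left)

lemma bij_bidual_iso: "bij (bidual_iso :: 'a::{metric_space,zero} lipfree bidual \<Rightarrow> _)"
proof (rule bijI)
  show "inj (bidual_iso :: 'a lipfree bidual \<Rightarrow> _)"
    by (metis bounded_linear.linear bounded_linear_bidual_iso linear_injective_0 norm_bidual_iso
        norm_eq_zero)
  show "surj (bidual_iso :: 'a lipfree bidual \<Rightarrow> _)"
    unfolding surj_def
  proof
    fix \<phi> :: "'a lip0_dual"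
    let ?g = "inv lip_functional :: _ \<Rightarrow> 'a lip0"
    have g: "lip_functional (?g \<psi>) = \<psi>" for \<psi> :: "'a lipfree \<Rightarrow>\<^sub>L real"
      by (rule surj_f_inv_f) (rule bij_is_surj[OF bij_lip_functional])
    interpret lip: bounded_linear "lip_functional :: 'a lip0 \<Rightarrow> _"
      by (rule bounded_linear_lip_functional)
    have inj: "lip_functional a = lip_functional b \<longleftrightarrow> a = b" for a b :: "'a lip0"
      by (rule inj_eq) (rule bij_is_inj[OF bij_lip_functional])
    have "bounded_linear ?g"
    proof (rule bounded_linear_intro[where K = 1])
      fix x y :: "'a lipfree \<Rightarrow>\<^sub>L real" and r :: real
      show "?g (x + y) = ?g x + ?g y"
        by (subst inj[symmetric]) (simp add: g lip.add)
      show "?g (r *\<^sub>R x) = r *\<^sub>R ?g x"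
        by (subst inj[symmetric]) (simp add: g lip.scaleR)
      show "norm (?g x) \<le> norm x * 1"
        using norm_lip_functional[of "?g x"] by (simp add: g)
    qed
    then have "bounded_linear (\<lambda>\<psi>. \<phi> (?g \<psi>))"
      by (rule bounded_linear_compose[OF blinfun.bounded_linear_right])
    then have "\<phi> = bidual_iso (Blinfun (\<lambda>\<psi>. \<phi> (?g \<psi>)))"
      by (intro blinfun_eqI) (simp add: bidual_iso.rep_eq bounded_linear_Blinfun_apply
          inv_f_f[OF bij_is_inj[OF bij_lip_functional]])
    then show "\<exists>\<Psi>. \<phi> = bidual_iso \<Psi>" ..
  qed
qed

lemma bidual_iso_embed: "bidual_iso (bidual_embed m) = lipfree_incl m"
  by (rule blinfun_eqI) (simp add: bidual_iso.rep_eq bidual_embed.rep_eq lip_functional.rep_eq)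

section \<open>The de Leeuw map and its adjoint\<close>

definition offdiag :: "('a::metric_space \<times> 'a) topology" where
  "offdiag = top_of_set {(x, y). x \<noteq> y}"

abbreviation beta_offdiag :: "((('a::metric_space \<times> 'a) \<Rightarrow> real) \<Rightarrow> real) topology" where
  "beta_offdiag \<equiv> stone_cech offdiag"

definition offdiag_in_beta :: "((('a::metric_space \<times> 'a) \<Rightarrow> real) \<Rightarrow> real) set" where
  "offdiag_in_beta = stone_cech_embed offdiag ` topspace offdiag"

definition diff_quot :: "('a::metric_space \<Rightarrow> real) \<Rightarrow> 'a \<times> 'a \<Rightarrow> real" where
  "diff_quot f = (\<lambda>(x, y). (f x - f y) / dist x y)"

definition de_leeuw ::
  "'a::{metric_space,zero} lip0 \<Rightarrow> ((('a \<times> 'a) \<Rightarrow> real) \<Rightarrow> real) \<Rightarrow> real" where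
  "de_leeuw f = stone_cech_ext offdiag (diff_quot (lip0_apply f))"

definition de_leeuw_adj ::
  "(((('a::{metric_space,zero} \<times> 'a) \<Rightarrow> real) \<Rightarrow> real) set \<Rightarrow> real) \<Rightarrow> 'a lip0_dual" where
  "de_leeuw_adj \<mu> = Blinfun (\<lambda>f. signed_integral beta_offdiag \<mu> (de_leeuw f))"

lemma continuous_map_diff_quot:
  "continuous_map offdiag euclideanreal (diff_quot (lip0_apply f))"
proof -
  have c: "continuous_on UNIV (lip0_apply f)"
    by (rule lipschitz_on_continuous_on[OF lipschitz_on_norm_lip0])
  have "continuous_on {(x, y). x \<noteq> y}
      (\<lambda>p. (lip0_apply f (fst p) - lip0_apply f (snd p)) / dist (fst p) (snd p))"
    by (intro continuous_intros continuous_on_compose2[OF c]) auto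
  then show ?thesis
    by (simp add: offdiag_def diff_quot_def case_prod_unfold)
qed

lemma abs_diff_quot_le: "\<bar>diff_quot (lip0_apply f) p\<bar> \<le> norm f"
proof (cases p)
  case (Pair x y)
  show ?thesis
    using lipschitz_onD[OF lipschitz_on_norm_lip0[of f], of x y]
      lipschitz_on_nonneg[OF lipschitz_on_norm_lip0[of f]]
    by (cases "x = y") (simp_all add: Pair diff_quot_def dist_real_def abs_divide divide_le_eq)
qed

lemma continuous_map_de_leeuw: "continuous_map beta_offdiag euclideanreal (de_leeuw f)"
  and de_leeuw_embed: "p \<in> topspace offdiag \<Longrightarrow>
    de_leeuw f (stone_cech_embed offdiag p) = diff_quot (lip0_apply f) p"
proof -
  have "bounded (diff_quot (lip0_apply f) ` topspace offdiag)"
    unfolding bounded_iff using abs_diff_quot_le[of f] by (intro exI[of _ "norm f"]) auto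
  from stone_cech_ext[OF continuous_map_diff_quot this]
  show "continuous_map beta_offdiag euclideanreal (de_leeuw f)"
    and "p \<in> topspace offdiag \<Longrightarrow>
      de_leeuw f (stone_cech_embed offdiag p) = diff_quot (lip0_apply f) p"
    by (simp_all add: de_leeuw_def)
qed

lemma abs_de_leeuw_le:
  assumes "p \<in> topspace beta_offdiag"
  shows "\<bar>de_leeuw f p\<bar> \<le> norm f"
proof (rule forall_in_closure_of[of p beta_offdiag "stone_cech_embed offdiag ` topspace offdiag"])
  show "p \<in> beta_offdiag closure_of stone_cech_embed offdiag ` topspace offdiag"
    using assms by (simp add: stone_cech_embed_dense)
  show "\<bar>de_leeuw f q\<bar> \<le> norm f" if "q \<in> stone_cech_embed offdiag ` topspace offdiag" for q
    using that abs_diff_quot_le[of f] by (auto simp: de_leeuw_embed)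
  have "closedin beta_offdiag {q \<in> topspace beta_offdiag. de_leeuw f q \<in> {- norm f..norm f}}"
    by (rule closedin_continuous_map_preimage[OF continuous_map_de_leeuw]) simp
  then show "closedin beta_offdiag {q \<in> topspace beta_offdiag. \<bar>de_leeuw f q\<bar> \<le> norm f}"
    by (simp add: abs_le_iff minus_le_iff conj_commute)
qed

lemma de_leeuw_linear:
  assumes "p \<in> topspace beta_offdiag"
  shows "de_leeuw (f + g) p = de_leeuw f p + de_leeuw g p"
    and "de_leeuw (c *\<^sub>R f) p = c * de_leeuw f p"
proof -
  show "de_leeuw (f + g) p = de_leeuw f p + de_leeuw g p"
    by (rule stone_cech_ext_unique[OF _ _ _ assms])
       (auto intro!: continuous_map_de_leeuw continuous_map_add
         simp: de_leeuw_embed diff_quot_def plus_lip0.rep_eq add_divide_distrib diff_divide_distrib)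
  show "de_leeuw (c *\<^sub>R f) p = c * de_leeuw f p"
    by (rule stone_cech_ext_unique[OF _ _ _ assms])
       (auto intro!: continuous_map_de_leeuw continuous_map_real_mult_left
         simp: de_leeuw_embed diff_quot_def scaleR_lip0.rep_eq diff_divide_distrib right_diff_distrib)
qed

lemma integrable_de_leeuw:
  assumes "radon_measure beta_offdiag m"
  shows "integrable m (de_leeuw f)"
proof -
  have m: "sets m = sets (borel_of beta_offdiag)" "finite_measure m"
    using assms by (auto simp: radon_measure_def)
  have sp: "space m = topspace beta_offdiag"
    using sets_eq_imp_space_eq[OF m(1)] by simp
  have "de_leeuw f \<in> borel_measurable m"
  proof (rule borel_measurableI)
    fix S :: "real set" assume "open S"
    then have "openin beta_offdiag {p \<in> topspace beta_offdiag. de_leeuw f p \<in> S}"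
      by (intro openin_continuous_map_preimage[OF continuous_map_de_leeuw]) simp
    then have "{p \<in> topspace beta_offdiag. de_leeuw f p \<in> S} \<in> sets (borel_of beta_offdiag)"
      unfolding borel_of_def
      by (subst sets_measure_of) (auto dest: openin_subset)
    moreover have "{p \<in> topspace beta_offdiag. de_leeuw f p \<in> S} = de_leeuw f -` S \<inter> space m"
      by (auto simp: sp)
    ultimately show "de_leeuw f -` S \<inter> space m \<in> sets m"
      by (simp add: m(1))
  qed
  then show ?thesis
    using abs_de_leeuw_le[of _ f]
    by (intro finite_measure.integrable_const_bound[OF m(2), of _ "norm f"] AE_I2)
       (simp_all add: sp)
qed

text \<open>Hence \<open>Blinfun\<close> in \<open>de_leeuw_adj\<close> is applied to a bounded linear functional.\<close>

lemma bounded_linear_signed_integral_de_leeuw: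
  assumes "signed_radon_measure beta_offdiag \<mu>"
  shows "bounded_linear (\<lambda>f. signed_integral beta_offdiag \<mu> (de_leeuw f))"
proof -
  have "bounded_linear (\<lambda>f. integral\<^sup>L m (de_leeuw f))" if m: "radon_measure beta_offdiag m" for m
  proof (rule bounded_linear_intro)
    have sp: "space m = topspace beta_offdiag" and fin: "finite_measure m"
      using m sets_eq_imp_space_eq[of m "borel_of beta_offdiag"] by (auto simp: radon_measure_def)
    fix f g and r :: real
    have "integral\<^sup>L m (de_leeuw (f + g)) = (\<integral>p. de_leeuw f p + de_leeuw g p \<partial>m)"
      by (intro Bochner_Integration.integral_cong refl) (simp add: sp de_leeuw_linear)
    then show "integral\<^sup>L m (de_leeuw (f + g)) = integral\<^sup>L m (de_leeuw f) + integral\<^sup>L m (de_leeuw g)"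
      using m by (simp add: integrable_de_leeuw)
    have "integral\<^sup>L m (de_leeuw (r *\<^sub>R f)) = (\<integral>p. r * de_leeuw f p \<partial>m)"
      by (intro Bochner_Integration.integral_cong refl) (simp add: sp de_leeuw_linear)
    then show "integral\<^sup>L m (de_leeuw (r *\<^sub>R f)) = r *\<^sub>R integral\<^sup>L m (de_leeuw f)"
      by simp
    have "\<bar>integral\<^sup>L m (de_leeuw f)\<bar> \<le> (\<integral>p. \<bar>de_leeuw f p\<bar> \<partial>m)"
      by (rule integral_abs_bound)
    also have "\<dots> \<le> (\<integral>p. norm f \<partial>m)"
      using m fin by (intro integral_mono integrable_abs integrable_de_leeuw)
        (simp_all add: sp abs_de_leeuw_le finite_measure.integrable_const)
    finally show "norm (integral\<^sup>L m (de_leeuw f)) \<le> norm f * measure m (space m)"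
      by (simp add: mult.commute)
  qed
  then show ?thesis
    using assms unfolding signed_integral_def signed_radon_measure_def
    by (intro bounded_linear_sub) auto
qed

end

theory Submission
  imports Defs "HOL-Library.Function_Algebras"
begin

text \<open>
  Every functional \<open>\<phi>\<close> on the Lipschitz space has the form \<open>\<Phi>\<^sup>*m\<close> for a positive Radon measure \<open>m\<close> of
  total mass at most \<open>norm \<phi>\<close> (Hahn-Banach and Riesz). Since \<open>M\<close> is complete, the off-diagonal part is a
  \<open>G\<^sub>\<delta>\<close> in its Stone-Cech compactification, so \<open>m\<close> splits into its restriction to that part and to the
  complement; the masses add up, which gives the norm identity. The restriction to the off-diagonal
  part is sent into the free space because it is concentrated, up to small mass, on compact sets, on
  which the map from pairs to molecules is norm continuous and hence uniformly approximated by simple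
  functions. The hypothesis, applied to measures with \<open>\<Phi>\<^sup>*\<mu> = 0\<close>, makes the construction independent of
  the representing measure and therefore linear; applied to measures representing elements of the free
  space, it shows that the projection fixes that space.
\<close>

section \<open>The Hahn-Banach theorem\<close>

text \<open>The measure picked for a functional does not depend linearly on it. The mass bound
  therefore belongs to the picked measure alone, while linearity of the projection is checked on
  sums and multiples of picked measures, which represent the right functional but may carry too much
  mass. Two encodings shape the rest. Regularity of signed measures is defined through their
  variations, and these are not additive in the measure; closure under linear combinations and
  linearity of the integral are therefore obtained from a description by bounds and small
  remainders, and from finite sums. Continuous functions are total functions with arbitrary values
  off the space; the Hahn-Banach theorem is accordingly relative to a subspace of a function type,
  and positivity shows that values off the space do not matter. Borel measurability of the
  off-diagonal part is essential for restriction: \<open>restrict_signed\<close> reads a measure at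
  intersections with that part, and values on sets that are not Borel carry no information.\<close>

definition sublinear_on :: "'v::real_vector set \<Rightarrow> ('v \<Rightarrow> real) \<Rightarrow> bool" where
  "sublinear_on E q \<longleftrightarrow> (\<forall>x\<in>E. \<forall>y\<in>E. q (x + y) \<le> q x + q y) \<and>
     (\<forall>x\<in>E. \<forall>c\<ge>0. q (c *\<^sub>R x) = c * q x)"

lemma sublinear_onD:
  assumes "sublinear_on E q"
  shows "x \<in> E \<Longrightarrow> y \<in> E \<Longrightarrow> q (x + y) \<le> q x + q y"
    and "x \<in> E \<Longrightarrow> c \<ge> 0 \<Longrightarrow> q (c *\<^sub>R x) = c * q x"
  using assms by (auto simp: sublinear_on_def)

lemma sublinear_on_neg:
  assumes E: "subspace E" and q: "sublinear_on E q" and x: "x \<in> E"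
  shows "- q (- x) \<le> q x"
proof -
  have "q (x + - x) \<le> q x + q (- x)"
    by (intro sublinear_onD[OF q] x subspace_neg[OF E])
  moreover have "q 0 = 0"
    using sublinear_onD(2)[OF q x, of 0] by simp
  ultimately show ?thesis by simp
qed

text \<open>A pair \<open>(s, r)\<close> stands for the constraint that the functional sought be at
  least \<open>r\<close> at \<open>s\<close>. Closure under sums and positive multiples lets all
  constraints be imposed at once. Two instances occur: a single ray, which proves linearity, and the
  values of a given functional on an embedded space, which makes the result an extension.\<close>

definition dominated_cone :: "'v::real_vector set \<Rightarrow> ('v \<Rightarrow> real) \<Rightarrow> ('v \<times> real) set \<Rightarrow> bool" where
  "dominated_cone E q R \<longleftrightarrow> 0 \<in> R \<and> (\<forall>z\<in>R. \<forall>w\<in>R. z + w \<in> R) \<and>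
     (\<forall>c>0. \<forall>z\<in>R. c *\<^sub>R z \<in> R) \<and> (\<forall>(s, r)\<in>R. s \<in> E \<and> r \<le> q s)"

text \<open>\<open>q' x\<close> is the infimum of \<open>q (x + s) - r\<close> over the cone. The
  condition \<open>r \<le> q s\<close> bounds it below by \<open>- q (- x)\<close>, closure of the
  cone under sums gives subadditivity, and \<open>x = - s\<close> gives the last conclusion because
  \<open>q 0 = 0\<close>. Vanishing off \<open>E\<close> is a normalisation that lets minimality be
  an equality of functions.\<close>

lemma sublinear_on_minorant:
  assumes E: "subspace E" and q: "sublinear_on E q"
    and R: "dominated_cone E q R"
  obtains q' where "sublinear_on E q'" "\<And>x. x \<in> E \<Longrightarrow> q' x \<le> q x" "\<And>x. x \<notin> E \<Longrightarrow> q' x = 0"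
    "\<And>s r. (s, r) \<in> R \<Longrightarrow> q' (- s) \<le> - r"
proof
  have R0: "0 \<in> R" and Radd: "\<And>z w. z \<in> R \<Longrightarrow> w \<in> R \<Longrightarrow> z + w \<in> R"
    and Rscale: "\<And>c z. c > 0 \<Longrightarrow> z \<in> R \<Longrightarrow> c *\<^sub>R z \<in> R"
    and RE: "\<And>s r. (s, r) \<in> R \<Longrightarrow> s \<in> E" and Rq: "\<And>s r. (s, r) \<in> R \<Longrightarrow> r \<le> q s"
    using R by (auto simp: dominated_cone_def)
  define q' where "q' x = (if x \<in> E then (INF z\<in>R. q (x + fst z) - snd z) else 0)" for x
  have low: "- q (- x) \<le> q (x + fst z) - snd z" if "x \<in> E" "z \<in> R" for x z
  proof -
    obtain s r where z: "z = (s, r)" by (cases z)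
    have s: "s \<in> E" "r \<le> q s" using RE Rq that z by auto
    have "q ((x + s) + - x) \<le> q (x + s) + q (- x)"
      using that s by (intro sublinear_onD[OF q] subspace_neg[OF E] subspace_add[OF E])
    then show ?thesis using s z by simp
  qed
  have bdd: "bdd_below ((\<lambda>z. q (x + fst z) - snd z) ` R)" if "x \<in> E" for x
    using low[OF that] by (intro bdd_belowI[of _ "- q (- x)"]) auto
  have up: "q' x \<le> q (x + s) - r" if "x \<in> E" "(s, r) \<in> R" for x s r
    using cINF_lower[OF bdd[OF that(1)] that(2)] that by (simp add: q'_def)
  have great: "c \<le> q' x" if "x \<in> E" "\<And>s r. (s, r) \<in> R \<Longrightarrow> c \<le> q (x + s) - r" for c x
    using that R0 by (auto simp: q'_def intro!: cINF_greatest)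
  have sc: "q' (c *\<^sub>R x) \<le> c * q' x" if c: "c > 0" and x: "x \<in> E" for c x
  proof -
    have "q' (c *\<^sub>R x) / c \<le> q' x"
    proof (rule great[OF x])
      fix s r assume sr: "(s, r) \<in> R"
      have "q' (c *\<^sub>R x) \<le> q (c *\<^sub>R x + c *\<^sub>R s) - c * r"
        using Rscale[OF c sr] by (intro up subspace_scale[OF E] x) auto
      also have "c *\<^sub>R x + c *\<^sub>R s = c *\<^sub>R (x + s)" by (simp add: scaleR_add_right)
      also have "q \<dots> = c * q (x + s)"
        using c x RE[OF sr] by (intro sublinear_onD[OF q] subspace_add[OF E]) auto
      finally show "q' (c *\<^sub>R x) / c \<le> q (x + s) - r"
        using c by (simp add: field_simps)
    qed
    then show ?thesis using c by (simp add: divide_le_eq algebra_simps)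
  qed
  have q0: "q 0 = 0"
    using sublinear_onD(2)[OF q subspace_0[OF E], of 0] by simp
  have R0': "(0, 0) \<in> R" using R0 by (simp add: zero_prod_def)
  show le: "q' x \<le> q x" if "x \<in> E" for x
    using up[OF that R0'] by simp
  show "q' (- s) \<le> - r" if "(s, r) \<in> R" for s r
    using up[OF subspace_neg[OF E RE[OF that]] that] q0 by simp
  show "q' x = 0" if "x \<notin> E" for x
    using that by (simp add: q'_def)
  show "sublinear_on E q'"
    unfolding sublinear_on_def
  proof (intro conjI ballI allI impI)
    fix x y assume xy: "x \<in> E" "y \<in> E"
    have "q' (x + y) - (q (x + s) - r) \<le> q (y + s') - r'" if sr: "(s, r) \<in> R" "(s', r') \<in> R" for s r s' r'
    proof -
      have "q' (x + y) \<le> q (x + y + (s + s')) - (r + r')"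
        using Radd[OF sr] xy by (intro up subspace_add[OF E]) auto
      also have "x + y + (s + s') = (x + s) + (y + s')" by (simp add: algebra_simps)
      also have "q \<dots> \<le> q (x + s) + q (y + s')"
        using xy sr RE by (intro sublinear_onD[OF q] subspace_add[OF E]) auto
      finally show ?thesis by simp
    qed
    then have "q' (x + y) - (q (x + s) - r) \<le> q' y" if "(s, r) \<in> R" for s r
      using that xy by (intro great) auto
    then have "q' (x + y) - q' y \<le> q' x"
      using xy by (intro great) (auto simp: algebra_simps)
    then show "q' (x + y) \<le> q' x + q' y" by simp
  next
    fix x c assume x: "x \<in> E" and c: "(0::real) \<le> c"
    show "q' (c *\<^sub>R x) = c * q' x"
    proof (cases "c = 0")
      case True
      have "q' 0 \<ge> 0"
        using Rq by (intro great subspace_0[OF E]) auto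
      moreover have "q' 0 \<le> 0" using le[OF subspace_0[OF E]] q0 by simp
      ultimately show ?thesis using True by simp
    next
      case False
      with c have c: "c > 0" by simp
      have "q' (inverse c *\<^sub>R (c *\<^sub>R x)) \<le> inverse c * q' (c *\<^sub>R x)"
        using c x by (intro sc subspace_scale[OF E]) auto
      then have "c * q' x \<le> q' (c *\<^sub>R x)"
        using c by (simp add: field_simps)
      with sc[OF c x] show ?thesis by simp
    qed
  qed
qed

text \<open>Zorn's lemma, downwards in the pointwise order. The pointwise infimum of a nonempty
  chain is finite because every member lies above \<open>- p (- x)\<close>, and subadditive because
  of any two members one lies below the other.\<close>

lemma minimal_sublinear:
  assumes E: "subspace E" and p: "sublinear_on E p"
  obtains q where "sublinear_on E q" "\<And>x. x \<in> E \<Longrightarrow> q x \<le> p x"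
    "\<And>q'. sublinear_on E q' \<Longrightarrow> (\<And>x. x \<in> E \<Longrightarrow> q' x \<le> q x) \<Longrightarrow> (\<And>x. x \<notin> E \<Longrightarrow> q' x = 0) \<Longrightarrow> q' = q"
proof -
  define A where "A = {q. sublinear_on E q \<and> (\<forall>x\<in>E. q x \<le> p x) \<and> (\<forall>x. x \<notin> E \<longrightarrow> q x = 0)}"
  have "\<exists>m\<in>A. \<forall>a\<in>A. m \<ge> a \<longrightarrow> a = m"
  proof (rule predicate_Zorn)
    show "partial_order_on A (relation_of (\<ge>) A)"
      by (rule partial_order_on_relation_ofI) auto
    fix C assume "C \<in> Chains (relation_of (\<ge>) A)"
    then have CA: "C \<subseteq> A" and Cc: "\<And>a b. a \<in> C \<Longrightarrow> b \<in> C \<Longrightarrow> a \<le> b \<or> b \<le> a"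
      by (auto simp: Chains_def relation_of_def)
    show "\<exists>u\<in>A. \<forall>a\<in>C. a \<ge> u"
    proof (cases "C = {}")
      case True
      \<comment> \<open>\<open>p\<close> itself may be nonzero off \<open>E\<close> and so fail to
        belong to \<open>A\<close>.\<close>
      have "(\<lambda>x. if x \<in> E then p x else 0) \<in> A"
        using p E by (auto simp: A_def sublinear_on_def subspace_add subspace_scale)
      with True show ?thesis by blast
    next
      case False
      define u where "u x = (if x \<in> E then (INF q\<in>C. q x) else 0)" for x
      have sl: "sublinear_on E q" "\<And>x. x \<in> E \<Longrightarrow> q x \<le> p x" "\<And>x. x \<notin> E \<Longrightarrow> q x = 0" if "q \<in> C" for q
        using CA that by (auto simp: A_def)
      have bdd: "bdd_below ((\<lambda>q. q x) ` C)" if "x \<in> E" for x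
      proof (rule bdd_belowI)
        fix v assume "v \<in> (\<lambda>q. q x) ` C"
        then obtain q where q: "q \<in> C" "v = q x" by auto
        show "- p (- x) \<le> v"
          using sublinear_on_neg[OF E sl(1)[OF q(1)] that] sl(2)[OF q(1) subspace_neg[OF E that]] q
          by simp
      qed
      have up: "u x \<le> q x" if "x \<in> E" "q \<in> C" for x q
        using cINF_lower[OF bdd[OF that(1)] that(2)] that by (simp add: u_def)
      have great: "c \<le> u x" if "x \<in> E" "\<And>q. q \<in> C \<Longrightarrow> c \<le> q x" for c x
        using that False by (auto simp: u_def intro!: cINF_greatest)
      have "sublinear_on E u"
        unfolding sublinear_on_def
      proof (intro conjI ballI allI impI)
        fix x y assume xy: "x \<in> E" "y \<in> E"
        have "u (x + y) - q x \<le> q' y" if qq: "q \<in> C" "q' \<in> C" for q q'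
        proof -
          obtain k where k: "k \<in> C" "k x \<le> q x" "k y \<le> q' y"
            using Cc[OF qq] qq by (auto simp: le_fun_def)
          have "u (x + y) \<le> k (x + y)"
            using xy k by (intro up subspace_add[OF E])
          also have "\<dots> \<le> k x + k y"
            using xy by (intro sublinear_onD[OF sl(1)] k)
          finally show ?thesis using k by simp
        qed
        then have "u (x + y) - q x \<le> u y" if "q \<in> C" for q
          using that xy by (intro great) auto
        then have "u (x + y) - u y \<le> u x"
          using xy by (intro great) (auto simp: algebra_simps)
        then show "u (x + y) \<le> u x + u y" by simp
      next
        fix x c assume x: "x \<in> E" and c: "(0::real) \<le> c"
        show "u (c *\<^sub>R x) = c * u x"
        proof (cases "c = 0")
          case True
          have "q 0 = 0" if "q \<in> C" for q
            using sublinear_onD(2)[OF sl(1)[OF that] subspace_0[OF E], of 0] by simp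
          then have "(\<lambda>q. q 0) ` C = (\<lambda>q. 0) ` C"
            by (intro image_cong refl)
          then have "(\<lambda>q. q 0) ` C = {0}"
            using \<open>C \<noteq> {}\<close> by (simp add: image_constant_conv)
          then have "u 0 = 0"
            using subspace_0[OF E] by (simp add: u_def)
          then show ?thesis using True by simp
        next
          case False
          with c have c: "c > 0" by simp
          have cx: "c *\<^sub>R x \<in> E" by (rule subspace_scale[OF E x])
          have s: "q (c *\<^sub>R x) = c * q x" if "q \<in> C" for q
            using c by (intro sublinear_onD[OF sl(1)] that x) auto
          have "u (c *\<^sub>R x) / c \<le> u x"
            using up[OF cx] s c by (intro great x) (auto simp: divide_le_eq mult.commute)
          moreover have "c * u x \<le> u (c *\<^sub>R x)"
          proof (rule great[OF cx])
            fix q assume q: "q \<in> C"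
            have "c * u x \<le> c * q x"
              using up[OF x q] c by simp
            then show "c * u x \<le> q (c *\<^sub>R x)"
              by (simp add: s[OF q])
          qed
          ultimately show ?thesis using c by (simp add: divide_le_eq mult.commute)
        qed
      qed
      moreover have "u x \<le> p x" if "x \<in> E" for x
        using up[OF that] sl(2)[OF _ that] False by (meson all_not_in_conv order_trans)
      ultimately have "u \<in> A" by (auto simp: A_def u_def)
      moreover have "u \<le> q" if "q \<in> C" for q
        using up[OF _ that] sl(3)[OF that] by (auto simp: le_fun_def u_def)
      ultimately show ?thesis by blast
    qed
  qed
  then obtain m where m: "m \<in> A" "\<And>a. a \<in> A \<Longrightarrow> a \<le> m \<Longrightarrow> a = m" by blast
  show thesis
  proof (rule that[of m])
    fix q' assume q': "sublinear_on E q'" "\<And>x. x \<in> E \<Longrightarrow> q' x \<le> m x" "\<And>x. x \<notin> E \<Longrightarrow> q' x = 0"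
    have "q' \<le> m" using q' m(1) by (force simp: A_def le_fun_def)
    moreover have "q' \<in> A" using q' m(1) by (force simp: A_def)
    ultimately show "q' = m" using m(2) by blast
  qed (use m(1) in \<open>auto simp: A_def\<close>)
qed

text \<open>A minimal sublinear functional \<open>q\<close> is linear: its minorant for the ray
  through \<open>a\<close> equals \<open>q\<close> by minimality, which yields
  \<open>q (- a) \<le> - q a\<close>. Taking \<open>q\<close> below the minorant \<open>p'\<close>
  for \<open>R\<close>, and not merely below \<open>p\<close>, builds in the constraints, since
  \<open>q (- s) \<le> p' (- s) \<le> - r\<close>.\<close>

theorem hahn_banach_cone:
  assumes E: "subspace E" and p: "sublinear_on E p"
    and R: "dominated_cone E p R"
  obtains q where "\<forall>x\<in>E. \<forall>y\<in>E. q (x + y) = q x + q y"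
    "\<forall>c. \<forall>x\<in>E. q (c *\<^sub>R x) = c * q x"
    "\<forall>x\<in>E. q x \<le> p x" "\<forall>(s, r)\<in>R. r \<le> q s"
proof -
  obtain p' where p': "sublinear_on E p'" "\<And>x. x \<in> E \<Longrightarrow> p' x \<le> p x"
    "\<And>s r. (s, r) \<in> R \<Longrightarrow> p' (- s) \<le> - r"
    using sublinear_on_minorant[OF E p R] by metis
  obtain q where q: "sublinear_on E q" "\<And>x. x \<in> E \<Longrightarrow> q x \<le> p' x"
    and min: "\<And>q'. sublinear_on E q' \<Longrightarrow> (\<And>x. x \<in> E \<Longrightarrow> q' x \<le> q x) \<Longrightarrow> (\<And>x. x \<notin> E \<Longrightarrow> q' x = 0) \<Longrightarrow> q' = q"
    using minimal_sublinear[OF E p'(1)] by metis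
  have neg: "q (- a) = - q a" if a: "a \<in> E" for a
  proof -
    define S where "S = {(t *\<^sub>R a, t * q a) | t. t \<ge> 0}"
    have "dominated_cone E q S"
      unfolding dominated_cone_def
    proof (intro conjI ballI allI impI)
      show "0 \<in> S" by (auto simp: S_def zero_prod_def intro!: exI[of _ 0])
    next
      fix z w assume "z \<in> S" "w \<in> S"
      then obtain t t' where "t \<ge> 0" "t' \<ge> 0" "z = (t *\<^sub>R a, t * q a)" "w = (t' *\<^sub>R a, t' * q a)"
        by (auto simp: S_def)
      then show "z + w \<in> S"
        by (auto simp: S_def algebra_simps intro!: exI[of _ "t + t'"])
    next
      fix c :: real and z assume "c > 0" "z \<in> S"
      then obtain t where "t \<ge> 0" "z = (t *\<^sub>R a, t * q a)"
        by (auto simp: S_def)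
      then show "c *\<^sub>R z \<in> S"
        using \<open>c > 0\<close> by (auto simp: S_def intro!: exI[of _ "c * t"])
    next
      fix z assume "z \<in> S"
      then show "case z of (s, r) \<Rightarrow> s \<in> E \<and> r \<le> q s"
        using a by (auto simp: S_def subspace_scale[OF E] sublinear_onD(2)[OF q(1) a])
    qed
    obtain q' where q': "sublinear_on E q'" "\<And>x. x \<in> E \<Longrightarrow> q' x \<le> q x" "\<And>x. x \<notin> E \<Longrightarrow> q' x = 0"
      "\<And>s r. (s, r) \<in> S \<Longrightarrow> q' (- s) \<le> - r"
      using sublinear_on_minorant[OF E q(1) \<open>dominated_cone E q S\<close>] by metis
    have "(a, q a) \<in> S" by (auto simp: S_def intro!: exI[of _ 1])
    from q'(4)[OF this] min[OF q'(1-3)] have "q (- a) \<le> - q a" by simp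
    with sublinear_on_neg[OF E q(1) a] show ?thesis by simp
  qed
  show thesis
  proof (rule that[of q]; intro ballI allI)
    fix x y assume x: "x \<in> E" and y: "y \<in> E"
    have "q ((x + y) + - y) \<le> q (x + y) + q (- y)"
      using x y by (intro sublinear_onD[OF q(1)] subspace_neg[OF E] subspace_add[OF E])
    then have "q x + q y \<le> q (x + y)" using neg[OF y] by simp
    with sublinear_onD(1)[OF q(1) x y] show "q (x + y) = q x + q y" by simp
  next
    fix c x assume x: "x \<in> E"
    show "q (c *\<^sub>R x) = c * q x"
    proof (cases "c \<ge> 0")
      case False
      have "q (- ((-c) *\<^sub>R x)) = - q ((-c) *\<^sub>R x)"
        by (intro neg subspace_scale[OF E x])
      also have "q ((-c) *\<^sub>R x) = (-c) * q x"
        using False by (intro sublinear_onD[OF q(1)] x) auto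
      finally show ?thesis by simp
    qed (rule sublinear_onD[OF q(1) x])
  next
    show "q x \<le> p x" if "x \<in> E" for x
      using q(2)[OF that] p'(2)[OF that] by simp
  next
    fix z assume "z \<in> R"
    then obtain s r where z: "z = (s, r)" and sr: "(s, r) \<in> R" by (cases z) auto
    then have sE: "s \<in> E" using R by (auto simp: dominated_cone_def)
    have "q (- s) \<le> - r"
      using q(2)[of "- s"] p'(3)[OF sr] subspace_neg[OF E sE] by simp
    then show "case z of (s, r) \<Rightarrow> r \<le> q s" using neg[OF sE] z by simp
  qed
qed

text \<open>Makes the continuous functions a \<open>subspace\<close>, the form in which the
  Hahn-Banach theorem is applied to them.\<close>

instantiation "fun" :: (type, real_vector) real_vector
begin
definition scaleR_fun :: "real \<Rightarrow> ('a \<Rightarrow> 'b) \<Rightarrow> 'a \<Rightarrow> 'b" where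
  "scaleR_fun c f = (\<lambda>x. c *\<^sub>R f x)"
instance
  by standard (auto simp: scaleR_fun_def fun_eq_iff algebra_simps)
end

section \<open>The Riesz representation theorem on compact Hausdorff spaces\<close>

lemma sets_borel_of: "sets (borel_of X) = sigma_sets (topspace X) {U. openin X U}"
  unfolding borel_of_def by (rule sets_measure_of) (auto dest: openin_subset)

lemma openin_sets_borel_of: "openin X U \<Longrightarrow> U \<in> sets (borel_of X)"
  by (auto simp: sets_borel_of)

lemma closedin_sets_borel_of:
  assumes "closedin X S"
  shows "S \<in> sets (borel_of X)"
proof -
  have "topspace X - (topspace X - S) \<in> sets (borel_of X)"
    using assms sets.compl_sets[OF openin_sets_borel_of[of X "topspace X - S"]] by auto
  then show ?thesis using closedin_subset[OF assms] by (simp add: double_diff)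
qed

lemma compactin_sets_borel_of: "Hausdorff_space X \<Longrightarrow> compactin X K \<Longrightarrow> K \<in> sets (borel_of X)"
  by (intro closedin_sets_borel_of compactin_imp_closedin)

lemma continuous_map_borel_measurable:
  assumes f: "continuous_map X euclideanreal f" and m: "sets m = sets (borel_of X)"
  shows "f \<in> borel_measurable m"
proof (rule borel_measurableI)
  fix S :: "real set" assume "open S"
  then have "{x \<in> topspace X. f x \<in> S} \<in> sets m"
    unfolding m by (intro openin_sets_borel_of openin_continuous_map_preimage[OF f]) simp
  moreover have "f -` S \<inter> space m = {x \<in> topspace X. f x \<in> S}"
    using sets_eq_imp_space_eq[OF m] by auto
  ultimately show "f -` S \<inter> space m \<in> sets m" by simp
qed

lemma continuous_map_bounded:
  assumes "compact_space X" "continuous_map X euclideanreal f"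
  obtains B where "B > 0" "\<And>x. x \<in> topspace X \<Longrightarrow> \<bar>f x\<bar> \<le> B"
proof -
  have "compactin euclideanreal (f ` topspace X)"
    using assms by (intro image_compactin) (auto simp: compact_space_def)
  then have "bounded (f ` topspace X)"
    by (simp add: compact_imp_bounded)
  then show thesis using that by (auto simp: bounded_pos)
qed

lemma integrable_continuous_map:
  assumes X: "compact_space X" and f: "continuous_map X euclideanreal f"
    and m: "finite_measure m" "sets m = sets (borel_of X)"
  shows "integrable m f"
proof -
  obtain B where "\<And>x. x \<in> topspace X \<Longrightarrow> \<bar>f x\<bar> \<le> B"
    using continuous_map_bounded[OF X f] by metis
  then show ?thesis
    using sets_eq_imp_space_eq[OF m(2)]
    by (intro finite_measure.integrable_const_bound[OF m(1), of _ B]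
        continuous_map_borel_measurable[OF f m(2)] AE_I2) simp
qed

text \<open>Compact sets are Borel in a Hausdorff space and the measure is finite, so a supremum
  over compact subsets can be traded for a small remainder \<open>A - K\<close>, which is easier to
  combine and to compare.\<close>

lemma radon_measure_iff:
  assumes X: "Hausdorff_space X"
  shows "radon_measure X m \<longleftrightarrow> sets m = sets (borel_of X) \<and> finite_measure m \<and>
    (\<forall>A\<in>sets m. \<forall>e>0. \<exists>K. compactin X K \<and> K \<subseteq> A \<and> measure m (A - K) \<le> e)" (is "?L \<longleftrightarrow> ?R")
proof (cases "sets m = sets (borel_of X) \<and> finite_measure m")
  case True
  then have sm: "sets m = sets (borel_of X)" and "finite_measure m" by auto
  then interpret finite_measure m by simp
  have K: "K \<in> sets m" if "compactin X K" for K
    using that by (simp add: sm compactin_sets_borel_of[OF X])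
  have "emeasure m A = (SUP K\<in>{K. compactin X K \<and> K \<subseteq> A}. emeasure m K) \<longleftrightarrow>
      (\<forall>e>0. \<exists>K. compactin X K \<and> K \<subseteq> A \<and> measure m (A - K) \<le> e)"
    (is "_ = ?S \<longleftrightarrow> ?E") if A: "A \<in> sets m" for A
  proof
    assume eq: "emeasure m A = ?S"
    show ?E
    proof (intro allI impI)
      fix e :: real assume e: "e > 0"
      show "\<exists>K. compactin X K \<and> K \<subseteq> A \<and> measure m (A - K) \<le> e"
      \<comment> \<open>For a null set, truncation at 0 in \<open>ennreal\<close> would spoil the
        strict inequality used in the other case.\<close>
      proof (cases "measure m A = 0")
        case True
        then show ?thesis using e by (intro exI[of _ "{}"]) auto
      next
        case False
        then have "ennreal (measure m A - e) < ennreal (measure m A)"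
          using e by (intro ennreal_lessI) (auto simp: zero_less_measure_iff)
        also have "\<dots> = ?S" using eq by (simp add: emeasure_eq_measure)
        finally obtain C where C: "compactin X C" "C \<subseteq> A" "ennreal (measure m A - e) < emeasure m C"
          by (auto simp: less_SUP_iff)
        have "measure m A - e < measure m C"
          using C(3) by (simp add: emeasure_eq_measure) (metis ennreal_leI not_less)
        then show ?thesis
          using C A K by (intro exI[of _ C]) (auto simp: finite_measure_Diff)
      qed
    qed
  next
    assume E: ?E
    show "emeasure m A = ?S"
    proof (rule antisym)
      show "?S \<le> emeasure m A"
        using A by (auto intro!: SUP_least emeasure_mono)
      show "emeasure m A \<le> ?S"
      proof (rule ennreal_le_epsilon)
        fix e :: real assume e: "e > 0"
        then obtain C where C: "compactin X C" "C \<subseteq> A" "measure m (A - C) \<le> e"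
          using E by blast
        have "measure m A \<le> measure m C + e"
          using C A K by (auto simp: finite_measure_Diff)
        then have "emeasure m A \<le> emeasure m C + ennreal e"
          using e by (simp add: emeasure_eq_measure ennreal_leI flip: ennreal_plus)
        also have "emeasure m C \<le> ?S" using C by (auto intro: SUP_upper)
        finally show "emeasure m A \<le> ?S + ennreal e" by (simp add: add_mono)
      qed
    qed
  qed
  then show ?thesis using True by (auto simp: radon_measure_def)
qed (auto simp: radon_measure_def)

section \<open>Positive functionals on the continuous functions of a compact Hausdorff space\<close>

locale positive_functional =
  fixes X :: "'b topology" and L :: "('b \<Rightarrow> real) \<Rightarrow> real"
  assumes compact: "compact_space X" and Hausdorff: "Hausdorff_space X"
    and add: "continuous_map X euclideanreal f \<Longrightarrow> continuous_map X euclideanreal g \<Longrightarrow>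
      L (\<lambda>x. f x + g x) = L f + L g"
    and scale: "continuous_map X euclideanreal f \<Longrightarrow> L (\<lambda>x. c * f x) = c * L f"
    and nonneg: "continuous_map X euclideanreal f \<Longrightarrow> (\<And>x. x \<in> topspace X \<Longrightarrow> 0 \<le> f x) \<Longrightarrow> 0 \<le> L f"
begin

lemma diff:
  assumes "continuous_map X euclideanreal f" "continuous_map X euclideanreal g"
  shows "L (\<lambda>x. f x - g x) = L f - L g"
  using add[OF assms(1) continuous_map_real_mult_left[OF assms(2), of "-1"]] scale[OF assms(2), of "-1"]
  by simp

lemma mono:
  assumes "continuous_map X euclideanreal f" "continuous_map X euclideanreal g"
    and "\<And>x. x \<in> topspace X \<Longrightarrow> f x \<le> g x"
  shows "L f \<le> L g"
  using nonneg[OF continuous_map_diff[OF assms(2,1)]] assms(3) diff[OF assms(2,1)] by simp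

text \<open>\<open>f\<close> and \<open>g\<close> may differ off the space; positivity alone makes
  \<open>L\<close> blind to that.\<close>

lemma cong:
  assumes "continuous_map X euclideanreal f" "continuous_map X euclideanreal g"
    and "\<And>x. x \<in> topspace X \<Longrightarrow> f x = g x"
  shows "L f = L g"
  using assms by (intro antisym mono) auto

definition total :: real where "total = L (\<lambda>_. 1)"

lemma total_nonneg: "0 \<le> total"
  unfolding total_def by (intro nonneg) (auto simp: continuous_map_const)

text \<open>Only vanishing off \<open>U\<close> is required, which is weaker than having support
  inside \<open>U\<close>. A closed set inside \<open>U\<close> that carries the function is
  recovered at small cost in \<open>shrink\<close>.\<close>

definition below :: "'b set \<Rightarrow> ('b \<Rightarrow> real) set" where
  "below U = {g. continuous_map X euclideanreal g \<and> (\<forall>x\<in>topspace X. 0 \<le> g x \<and> g x \<le> 1) \<and>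
     (\<forall>x\<in>topspace X - U. g x = 0)}"

lemma belowD:
  assumes "g \<in> below U"
  shows "continuous_map X euclideanreal g" "x \<in> topspace X \<Longrightarrow> 0 \<le> g x" "x \<in> topspace X \<Longrightarrow> g x \<le> 1"
    "x \<in> topspace X \<Longrightarrow> x \<notin> U \<Longrightarrow> g x = 0"
  using assms by (auto simp: below_def)

lemma zero_below: "(\<lambda>_. 0) \<in> below U"
  by (simp add: below_def continuous_map_const)

lemma below_le_total: "g \<in> below U \<Longrightarrow> L g \<le> total"
  unfolding total_def by (intro mono) (auto simp: continuous_map_const dest: belowD)

lemma below_nonneg: "g \<in> below U \<Longrightarrow> 0 \<le> L g"
  by (intro nonneg) (auto dest: belowD)

section \<open>The content of open sets and the outer measure it induces\<close>

definition content :: "'b set \<Rightarrow> ennreal" where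
  "content U = (SUP g\<in>below U. ennreal (L g))"

definition outer :: "'b set \<Rightarrow> ennreal" where
  "outer A = (INF U\<in>{U. openin X U \<and> A \<subseteq> U}. content U)"

lemma content_upper: "g \<in> below U \<Longrightarrow> ennreal (L g) \<le> content U"
  unfolding content_def by (rule SUP_upper)

lemma content_mono: "U \<subseteq> V \<Longrightarrow> content U \<le> content V"
  unfolding content_def by (rule SUP_subset_mono) (auto simp: below_def)

lemma content_le_total: "content U \<le> ennreal total"
  unfolding content_def by (intro SUP_least ennreal_leI below_le_total)

lemma content_topspace: "content (topspace X) = ennreal total"
proof (rule antisym[OF content_le_total])
  have "(\<lambda>_. 1) \<in> below (topspace X)" by (simp add: below_def continuous_map_const)
  from content_upper[OF this] show "ennreal total \<le> content (topspace X)"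
    by (simp add: total_def)
qed

lemma content_empty: "content {} = 0"
proof -
  have "L g \<le> L (\<lambda>_. 0)" if "g \<in> below {}" for g
    using that by (intro mono) (auto simp: continuous_map_const dest: belowD)
  moreover have "L (\<lambda>_. 0) = 0"
    using scale[of "\<lambda>_. 1" 0] by (simp add: continuous_map_const)
  ultimately have "ennreal (L g) \<le> 0" if "g \<in> below {}" for g
    using that by (simp add: ennreal_neg)
  then show ?thesis
    unfolding content_def by (intro antisym SUP_least) auto
qed

text \<open>The positive part of \<open>g - e\<close> vanishes off the closed set where
  \<open>g\<close> is at least \<open>e\<close>, and this set lies in \<open>U\<close> because
  \<open>g\<close> vanishes off \<open>U\<close>. The cut lowers \<open>g\<close> by at most
  \<open>e\<close> everywhere, hence \<open>L g\<close> by at most \<open>e * total\<close>.\<close>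

lemma shrink:
  assumes g: "g \<in> below U" and e: "e > 0"
  obtains g' S where "g' \<in> below U" "closedin X S" "S \<subseteq> U" "\<And>x. x \<in> topspace X \<Longrightarrow> x \<notin> S \<Longrightarrow> g' x = 0"
    "L g \<le> L g' + e * total"
proof
  let ?g' = "\<lambda>x. max (g x - e) 0" and ?S = "{x \<in> topspace X. g x \<in> {e..}}"
  note gc = belowD(1)[OF g]
  have c: "continuous_map X euclideanreal ?g'"
    by (intro continuous_map_real_max continuous_map_diff gc) (auto simp: continuous_map_const)
  then show "?g' \<in> below U"
    using g e by (fastforce simp: below_def)
  show "closedin X ?S"
    by (rule closedin_continuous_map_preimage[OF gc]) simp
  show "?S \<subseteq> U" using g e by (force simp: below_def)
  show "?g' x = 0" if "x \<in> topspace X" "x \<notin> ?S" for x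
    using that by auto
  have "L g \<le> L (\<lambda>x. ?g' x + e * 1)"
    by (intro mono continuous_map_add c gc) (auto simp: continuous_map_const)
  also have "\<dots> = L ?g' + L (\<lambda>x. e * 1)"
    by (intro add c) (auto simp: continuous_map_const)
  also have "L (\<lambda>x. e * 1) = e * total"
    unfolding total_def by (rule scale) (auto simp: continuous_map_const)
  finally show "L g \<le> L ?g' + e * total" .
qed

lemma epsilon_total:
  assumes "e > 0"
  obtains d where "d > 0" "d * total \<le> e"
proof
  \<comment> \<open>The summand 1 covers the case \<open>total = 0\<close>.\<close>
  show "e / (total + 1) > 0" using assms total_nonneg by simp
  show "e / (total + 1) * total \<le> e" using assms total_nonneg by (simp add: field_simps)
qed

lemma below_shrunk:
  assumes g: "g \<in> below U" and e: "e > 0"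
  obtains g' S where "g' \<in> below U" "closedin X S" "S \<subseteq> U" "\<And>x. x \<in> topspace X \<Longrightarrow> x \<notin> S \<Longrightarrow> g' x = 0"
    "L g \<le> L g' + e"
proof -
  obtain d where d: "d > 0" "d * total \<le> e" using epsilon_total[OF e] .
  show thesis
    using shrink[OF g d(1)] d(2) that by (metis add_left_mono order_trans)
qed

lemma urysohn:
  assumes "closedin X S" "openin X U" "S \<subseteq> U"
  obtains h where "h \<in> below U" "\<And>x. x \<in> S \<Longrightarrow> h x = 1"
proof -
  have "normal_space X"
    using compact_Hausdorff_or_regular_imp_normal_space compact Hausdorff by blast
  moreover have "closedin X (topspace X - U)" "disjnt (topspace X - U) S"
    using assms by (auto simp: disjnt_def)
  ultimately obtain h where h: "continuous_map X (top_of_set {0..1::real}) h"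
    "h ` (topspace X - U) \<subseteq> {0}" "h ` S \<subseteq> {1}"
    using assms(1) unfolding normal_space_iff_Urysohn by meson
  then have "h \<in> below U"
    by (auto simp: below_def continuous_map_in_subtopology image_subset_iff)
  then show thesis by (rule that[of h]) (use h(3) in auto)
qed

text \<open>A partition of unity with two members. The Urysohn function \<open>h\<close> is 1 on the
  part of \<open>S\<close> outside \<open>V\<close> and vanishes off \<open>U\<close>, so
  \<open>h * g'\<close> competes for \<open>U\<close> and \<open>(1 - h) * g'\<close> for
  \<open>V\<close>.\<close>

lemma content_Un:
  assumes U: "openin X U" and V: "openin X V"
  shows "content (U \<union> V) \<le> content U + content V"
  unfolding content_def[of "U \<union> V"]
proof (rule SUP_least, rule ennreal_le_epsilon)
  fix g e assume g: "g \<in> below (U \<union> V)" and e: "(e::real) > 0"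
  obtain g' S where g': "g' \<in> below (U \<union> V)" "closedin X S" "S \<subseteq> U \<union> V"
    "\<And>x. x \<in> topspace X \<Longrightarrow> x \<notin> S \<Longrightarrow> g' x = 0" "L g \<le> L g' + e"
    using below_shrunk[OF g e] by metis
  note b = belowD[OF g'(1)]
  have "closedin X (S - V)" "S - V \<subseteq> U"
    using g' V by (auto simp: closedin_diff)
  then obtain h where h: "h \<in> below U" "\<And>x. x \<in> S - V \<Longrightarrow> h x = 1"
    using urysohn[OF _ U] by metis
  note bh = belowD[OF h(1)]
  have c1: "continuous_map X euclideanreal (\<lambda>x. h x * g' x)"
    by (intro continuous_map_real_mult b bh)
  have c2: "continuous_map X euclideanreal (\<lambda>x. (1 - h x) * g' x)"
    by (intro continuous_map_real_mult continuous_map_diff b bh) (auto simp: continuous_map_const)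
  have 1: "(\<lambda>x. h x * g' x) \<in> below U"
    using c1 b bh by (auto simp: below_def mult_le_one)
  have "(1 - h x) * g' x = 0" if "x \<in> topspace X" "x \<notin> V" for x
    using that h(2)[of x] g'(4)[of x] by (cases "x \<in> S") auto
  then have 2: "(\<lambda>x. (1 - h x) * g' x) \<in> below V"
    using c2 b bh by (auto simp: below_def intro!: mult_le_one)
  have "L g' = L (\<lambda>x. h x * g' x + (1 - h x) * g' x)"
    by (rule arg_cong[where f = L]) (auto simp: algebra_simps)
  also have "\<dots> = L (\<lambda>x. h x * g' x) + L (\<lambda>x. (1 - h x) * g' x)"
    by (intro add c1 c2)
  finally have "ennreal (L g) \<le> ennreal (L (\<lambda>x. h x * g' x) + L (\<lambda>x. (1 - h x) * g' x) + e)"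
    using g'(5) by (intro ennreal_leI) simp
  also have "\<dots> = ennreal (L (\<lambda>x. h x * g' x)) + ennreal (L (\<lambda>x. (1 - h x) * g' x)) + ennreal e"
    using e below_nonneg[OF 1] below_nonneg[OF 2] by (simp add: ennreal_plus)
  also have "\<dots> \<le> content U + content V + ennreal e"
    by (intro add_mono content_upper 1 2 order_refl)
  finally show "ennreal (L g) \<le> content U + content V + ennreal e" .
qed

lemma content_UN_finite:
  assumes "\<And>n::nat. openin X (U n)"
  shows "content (\<Union>n<N. U n) \<le> (\<Sum>n<N. content (U n))"
proof (induction N)
  case (Suc N)
  have "content (\<Union>n<Suc N. U n) = content ((\<Union>n<N. U n) \<union> U N)"
    by (rule arg_cong[where f = content]) (auto simp: less_Suc_eq)
  also have "\<dots> \<le> content (\<Union>n<N. U n) + content (U N)"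
    using assms by (intro content_Un) auto
  also have "\<dots> \<le> (\<Sum>n<N. content (U n)) + content (U N)"
    by (intro add_right_mono Suc)
  finally show ?case by simp
qed (simp add: content_empty)

text \<open>After shrinking, \<open>g'\<close> vanishes off a closed, hence compact, set covered by
  the \<open>U n\<close>; finitely many of them suffice, and finite subadditivity applies.\<close>

lemma content_UN:
  assumes U: "\<And>n::nat. openin X (U n)"
  shows "content (\<Union>n. U n) \<le> (\<Sum>n. content (U n))"
  unfolding content_def[of "\<Union>n. U n"]
proof (rule SUP_least, rule ennreal_le_epsilon)
  fix g e assume g: "g \<in> below (\<Union>n. U n)" and e: "(e::real) > 0"
  obtain g' S where g': "g' \<in> below (\<Union>n. U n)" "closedin X S" "S \<subseteq> (\<Union>n. U n)"
    "\<And>x. x \<in> topspace X \<Longrightarrow> x \<notin> S \<Longrightarrow> g' x = 0" "L g \<le> L g' + e"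
    using below_shrunk[OF g e] by metis
  have "compactin X S" by (rule closedin_compact_space[OF compact g'(2)])
  then obtain F where F: "finite F" "F \<subseteq> range U" "S \<subseteq> \<Union>F"
    using compactinD[of X S "range U"] U g'(3) by auto
  then obtain I where I: "finite I" "F = U ` I" by (meson finite_subset_image)
  obtain N where N: "I \<subseteq> {..<N}" using finite_nat_iff_bounded I(1) by auto
  have "g' \<in> below (\<Union>n<N. U n)"
    using g'(1,4) F(3) I N by (auto simp: below_def)
  then have "ennreal (L g') \<le> content (\<Union>n<N. U n)" by (rule content_upper)
  also have "\<dots> \<le> (\<Sum>n<N. content (U n))" by (rule content_UN_finite[OF U])
  also have "\<dots> \<le> (\<Sum>n. content (U n))" by (rule sum_le_suminf) auto
  finally have 1: "ennreal (L g') \<le> (\<Sum>n. content (U n))" .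
  have "ennreal (L g) \<le> ennreal (L g' + e)"
    using g'(5) by (intro ennreal_leI)
  also have "\<dots> = ennreal (L g') + ennreal e"
    using e below_nonneg[OF g'(1)] by (simp add: ennreal_plus)
  finally show "ennreal (L g) \<le> (\<Sum>n. content (U n)) + ennreal e"
    using 1 by (meson add_right_mono order_trans)
qed

lemma outer_open: "openin X U \<Longrightarrow> outer U = content U"
  unfolding outer_def by (intro antisym INF_greatest INF_lower content_mono) auto

lemma outer_mono: "A \<subseteq> B \<Longrightarrow> outer A \<le> outer B"
  unfolding outer_def by (rule INF_superset_mono) auto

lemma outer_less: "outer A < c \<Longrightarrow> \<exists>U. openin X U \<and> A \<subseteq> U \<and> content U < c"
  unfolding outer_def INF_less_iff by auto

lemma outer_measure_space_outer: "outer_measure_space (Pow (topspace X)) outer"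
  unfolding outer_measure_space_def
proof (intro conjI)
  show "positive (Pow (topspace X)) outer"
    by (simp add: positive_def outer_open content_empty)
  show "increasing (Pow (topspace X)) outer"
    by (simp add: increasing_def outer_mono)
  show "countably_subadditive (Pow (topspace X)) outer"
    unfolding countably_subadditive_def
  proof (intro allI impI, rule ennreal_le_epsilon)
    fix A :: "nat \<Rightarrow> 'b set" and e :: real
    assume e: "0 < e" and "(\<Sum>n. outer (A n)) < top"
    then have "outer (A n) < outer (A n) + e * (1/2)^Suc n" for n
      by (auto simp add: less_top dest!: ennreal_suminf_lessD)
    then have "\<forall>n. \<exists>U. openin X U \<and> A n \<subseteq> U \<and> content U < outer (A n) + e * (1/2)^Suc n"
      by (intro allI outer_less)
    then obtain U where U: "\<And>n. openin X (U n)" "\<And>n. A n \<subseteq> U n"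
      "\<And>n. content (U n) \<le> outer (A n) + e * (1/2)^Suc n"
      by (metis less_imp_le)
    have "outer (\<Union>n. A n) \<le> outer (\<Union>n. U n)"
      using U(2) by (intro outer_mono) blast
    also have "\<dots> = content (\<Union>n. U n)"
      using U(1) by (intro outer_open) auto
    also have "\<dots> \<le> (\<Sum>n. content (U n))"
      by (rule content_UN[OF U(1)])
    also have "\<dots> \<le> (\<Sum>n. outer (A n) + e * (1/2)^Suc n)"
      by (intro suminf_le allI U) auto
    also have "\<dots> = (\<Sum>n. outer (A n)) + (\<Sum>n. ennreal e * ennreal ((1/2) ^ Suc n))"
      using e by (subst suminf_add[symmetric])
        (auto simp del: ennreal_suminf_cmult simp add: ennreal_mult[symmetric])
    also have "\<dots> = (\<Sum>n. outer (A n)) + e"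
      unfolding ennreal_suminf_cmult
      by (subst suminf_ennreal_eq[OF zero_le_power power_half_series]) auto
    finally show "outer (\<Union>n. A n) \<le> (\<Sum>n. outer (A n)) + ennreal e" .
  qed
qed

lemma outer_subadditive:
  assumes "A \<subseteq> topspace X" "B \<subseteq> topspace X" "A \<inter> B = {}"
  shows "outer (A \<union> B) \<le> outer A + outer B"
proof -
  interpret P: sigma_algebra "topspace X" "Pow (topspace X)" by (rule sigma_algebra_Pow)
  have "subadditive (Pow (topspace X)) outer"
    using outer_measure_space_outer
    by (intro P.countably_subadditive_subadditive) (auto simp: outer_measure_space_def)
  then show ?thesis using assms by (auto simp: subadditive_def)
qed

text \<open>Caratheodory's inequality for an open test set \<open>V\<close>. A function carried by a
  closed \<open>S\<close> inside \<open>U \<inter> V\<close> and one that vanishes off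
  \<open>V - S\<close> are never both nonzero, so their sum is still at most 1 and competes for
  \<open>V\<close>.\<close>

lemma content_split:
  assumes U: "openin X U" and V: "openin X V"
  shows "content (U \<inter> V) + outer (V - U) \<le> content V"
proof (rule ennreal_le_epsilon)
  fix e :: real assume e: "e > 0"
  have "ennreal (L g) + outer (V - U) \<le> content V + ennreal e" if g: "g \<in> below (U \<inter> V)" for g
  proof -
    obtain g' S where g': "g' \<in> below (U \<inter> V)" "closedin X S" "S \<subseteq> U \<inter> V"
      "\<And>x. x \<in> topspace X \<Longrightarrow> x \<notin> S \<Longrightarrow> g' x = 0" "L g \<le> L g' + e"
      using below_shrunk[OF g e] by metis
    note b = belowD[OF g'(1)]
    have W: "openin X (V - S)" using V g'(2) by (rule openin_diff)
    have "outer (V - U) \<le> outer (V - S)"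
      using g'(3) by (intro outer_mono) auto
    also have "\<dots> = content (V - S)" by (rule outer_open[OF W])
    finally have 1: "outer (V - U) \<le> content (V - S)" .
    have "ennreal (L g') + ennreal (L h) \<le> content V" if h: "h \<in> below (V - S)" for h
    proof -
      note bh = belowD[OF h]
      have c: "continuous_map X euclideanreal (\<lambda>x. g' x + h x)"
        by (intro continuous_map_add b bh)
      have "g' x + h x \<le> 1" "0 \<le> g' x + h x" "x \<notin> V \<Longrightarrow> g' x + h x = 0" if x: "x \<in> topspace X" for x
        using b(2-4)[OF x] bh(2-4)[OF x] g'(4)[OF x] g'(3) by (cases "x \<in> S"; auto)+
      with c have "(\<lambda>x. g' x + h x) \<in> below V" by (simp add: below_def)
      from content_upper[OF this] show ?thesis
        using below_nonneg[OF g'(1)] below_nonneg[OF h] by (simp add: add[OF b(1) bh(1)])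
    qed
    then have "ennreal (L g') + content (V - S) \<le> content V"
      unfolding content_def[of "V - S"] using zero_below
      by (subst ennreal_SUP_add_right) (auto intro!: SUP_least)
    then have "ennreal (L g') + outer (V - U) \<le> content V"
      using 1 by (meson add_left_mono order_trans)
    then have le: "(ennreal (L g') + outer (V - U)) + ennreal e \<le> content V + ennreal e"
      by (rule add_right_mono)
    have "ennreal (L g) \<le> ennreal (L g') + ennreal e"
      using g'(5) e below_nonneg[OF g'(1)] by (simp add: ennreal_leI flip: ennreal_plus)
    then have "ennreal (L g) + outer (V - U) \<le> (ennreal (L g') + ennreal e) + outer (V - U)"
      by (rule add_right_mono)
    also have "\<dots> = (ennreal (L g') + outer (V - U)) + ennreal e"
      by (simp only: ac_simps)
    finally show ?thesis using le by (rule order_trans)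
  qed
  then show "content (U \<inter> V) + outer (V - U) \<le> content V + ennreal e"
    unfolding content_def[of "U \<inter> V"] using zero_below
    by (subst ennreal_SUP_add_left[symmetric]) (auto intro!: SUP_least)
qed

text \<open>Caratheodory's condition must be tested on arbitrary \<open>A\<close>; the infimum
  defining \<open>outer A\<close> reduces it to open test sets, where \<open>content_split\<close>
  applies.\<close>

lemma open_in_lambda_system:
  assumes U: "openin X U"
  shows "U \<in> lambda_system (topspace X) (Pow (topspace X)) outer"
  unfolding lambda_system_def
proof (intro CollectI conjI ballI)
  show "U \<in> Pow (topspace X)" using openin_subset[OF U] by simp
  fix A assume "A \<in> Pow (topspace X)"
  then have A: "A \<subseteq> topspace X" by simp
  show "outer (U \<inter> A) + outer ((topspace X - U) \<inter> A) = outer A"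
  proof (rule antisym)
    have "A = (U \<inter> A) \<union> ((topspace X - U) \<inter> A)" using A by auto
    then show "outer A \<le> outer (U \<inter> A) + outer ((topspace X - U) \<inter> A)"
      using outer_subadditive[of "U \<inter> A" "(topspace X - U) \<inter> A"] A by auto
    show "outer (U \<inter> A) + outer ((topspace X - U) \<inter> A) \<le> outer A"
      unfolding outer_def[of A]
    proof (rule INF_greatest)
      fix V assume "V \<in> {U. openin X U \<and> A \<subseteq> U}"
      then have V: "openin X V" "A \<subseteq> V" by auto
      have "outer (U \<inter> A) + outer ((topspace X - U) \<inter> A) \<le> outer (U \<inter> V) + outer (V - U)"
        using V by (intro add_mono outer_mono) auto
      also have "outer (U \<inter> V) = content (U \<inter> V)"
        using U V by (intro outer_open) auto
      also have "content (U \<inter> V) + outer (V - U) \<le> content V"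
        by (rule content_split[OF U V(1)])
      finally show "outer (U \<inter> A) + outer ((topspace X - U) \<inter> A) \<le> content V" .
    qed
  qed
qed

section \<open>The Riesz measure, its regularity and its integral\<close>

definition riesz :: "'b measure" where
  "riesz = measure_of (topspace X) (sets (borel_of X)) outer"

lemma sets_riesz [simp]: "sets riesz = sets (borel_of X)"
  unfolding riesz_def using sets.sets_measure_of_eq[of "borel_of X"] by simp

lemma space_riesz [simp]: "space riesz = topspace X"
  using sets_eq_imp_space_eq[OF sets_riesz] by simp

lemma emeasure_riesz:
  assumes "A \<in> sets (borel_of X)"
  shows "emeasure riesz A = outer A"
proof -
  let ?L = "lambda_system (topspace X) (Pow (topspace X)) outer"
  interpret P: sigma_algebra "topspace X" "Pow (topspace X)" by (rule sigma_algebra_Pow)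
  have ms: "measure_space (topspace X) ?L outer"
    by (rule P.caratheodory_lemma[OF outer_measure_space_outer])
  then have "sigma_sets (topspace X) {U. openin X U} \<subseteq> ?L"
    using open_in_lambda_system unfolding measure_space_def
    by (intro sigma_algebra.sigma_sets_subset) auto
  then have "sets (borel_of X) \<subseteq> ?L" by (simp add: sets_borel_of)
  then have "positive (sets (borel_of X)) outer" "countably_additive (sets (borel_of X)) outer"
    using ms by (auto simp: measure_space_def positive_def countably_additive_def)
  then show ?thesis
    using assms sets.sigma_algebra_axioms[of "borel_of X"] unfolding riesz_def
    by (intro emeasure_measure_of_sigma) simp_all
qed

lemma emeasure_riesz_open: "openin X U \<Longrightarrow> emeasure riesz U = content U"
  by (simp add: emeasure_riesz openin_sets_borel_of outer_open)

lemma emeasure_riesz_space: "emeasure riesz (topspace X) = ennreal total"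
  by (simp add: emeasure_riesz_open content_topspace)

lemma finite_measure_riesz: "finite_measure riesz"
  by (rule finite_measureI) (simp add: emeasure_riesz_space)

lemma measure_riesz_space: "measure riesz (topspace X) = total"
  by (simp add: measure_def emeasure_riesz_space total_nonneg)

text \<open>Outer regularity is built into \<open>outer\<close>. Applied to the complement of
  \<open>A\<close>, it gives an open \<open>U\<close> whose complement is compact, lies in
  \<open>A\<close>, and misses little of \<open>A\<close>.\<close>

lemma radon_measure_riesz: "radon_measure X riesz"
  unfolding radon_measure_iff[OF Hausdorff]
proof (intro conjI ballI allI impI)
  interpret finite_measure riesz by (rule finite_measure_riesz)
  fix A and e :: real assume A: "A \<in> sets riesz" and e: "e > 0"
  let ?A = "topspace X - A"
  have A': "?A \<in> sets riesz" using sets.compl_sets[OF A] by simp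
  have "outer ?A < outer ?A + ennreal e"
    using e A' emeasure_finite[of ?A] by (simp add: emeasure_riesz ennreal_add_left_cancel_less)
  then obtain U where U: "openin X U" "?A \<subseteq> U" "content U < outer ?A + ennreal e"
    using outer_less by blast
  have "emeasure riesz U \<le> emeasure riesz ?A + ennreal e"
    using U A' by (simp add: emeasure_riesz_open emeasure_riesz less_imp_le)
  then have le: "measure riesz U \<le> measure riesz ?A + e"
    using e by (simp add: emeasure_eq_measure flip: ennreal_plus)
  have "A - (topspace X - U) = U - ?A"
    using sets.sets_into_space[OF A] openin_subset[OF U(1)] by auto
  then have "measure riesz (A - (topspace X - U)) = measure riesz U - measure riesz ?A"
    using U A' by (simp add: finite_measure_Diff openin_sets_borel_of)
  moreover have "compactin X (topspace X - U)"
    using U(1) by (intro closedin_compact_space[OF compact]) auto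
  ultimately show "\<exists>K. compactin X K \<and> K \<subseteq> A \<and> measure riesz (A - K) \<le> e"
    using le U(2) by (intro exI[of _ "topspace X - U"]) auto
qed (simp_all add: finite_measure_riesz)

lemma sum:
  assumes "finite I" "\<And>i. i \<in> I \<Longrightarrow> continuous_map X euclideanreal (f i)"
  shows "L (\<lambda>x. \<Sum>i\<in>I. f i x) = (\<Sum>i\<in>I. L (f i))"
  using assms
proof (induction I rule: finite_induct)
  case empty
  then show ?case using scale[of "\<lambda>_. 1" 0] by (simp add: continuous_map_const)
next
  case (insert i I)
  then show ?case by (simp add: add continuous_map_sum)
qed

text \<open>The layer-cake argument: \<open>n * g\<close> is the sum of its \<open>n\<close> slices
  \<open>h i\<close> of height 1, and \<open>h i\<close> vanishes off the open set
  \<open>U i\<close> where \<open>n * g\<close> exceeds \<open>i\<close>. Hence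
  \<open>n * L g\<close> is at most the sum of the measures of the \<open>U i\<close>. The surplus
  \<open>total\<close> in \<open>bound\<close> does not grow with \<open>n\<close>, so dividing by a
  large \<open>n\<close> removes it.\<close>

lemma le_integral_unit:
  assumes g: "continuous_map X euclideanreal g" and g01: "\<And>x. x \<in> topspace X \<Longrightarrow> 0 \<le> g x \<and> g x \<le> 1"
  shows "L g \<le> integral\<^sup>L riesz g"
proof -
  interpret finite_measure riesz by (rule finite_measure_riesz)
  have int: "integrable riesz g"
    by (rule integrable_continuous_map[OF compact g finite_measure_riesz]) simp
  have sum_clip: "(\<Sum>i<k. min 1 (max 0 (t - real i))) = min (real k) t" if "t \<ge> 0" for t k
    using that by (induction k) (auto simp: min_def max_def)
  have bound: "real n * L g \<le> real n * integral\<^sup>L riesz g + total" for n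
  proof -
    define U where "U i = {x \<in> topspace X. g x * real n \<in> {real i<..}}" for i
    define h where "h i x = min 1 (max 0 (g x * real n - real i))" for i x
    have U: "openin X (U i)" for i
      unfolding U_def
      by (rule openin_continuous_map_preimage[OF continuous_map_real_mult_right[OF g]]) simp
    have hc: "continuous_map X euclideanreal (h i)" for i
      unfolding h_def
      by (intro continuous_map_real_min continuous_map_real_max continuous_map_diff
          continuous_map_real_mult_right g) (auto simp: continuous_map_const)
    have hU: "h i \<in> below (U i)" for i
      using hc[of i] by (auto simp: below_def) (auto simp: h_def U_def)
    have hm: "L (h i) \<le> measure riesz (U i)" for i
      using content_upper[OF hU[of i]] U[of i]
      by (simp add: emeasure_eq_measure flip: emeasure_riesz_open)
    have "real n * L g = L (\<lambda>x. real n * g x)"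
      by (rule scale[OF g, symmetric])
    also have "\<dots> = L (\<lambda>x. \<Sum>i<n. h i x)"
    proof (rule cong)
      fix x assume "x \<in> topspace X"
      then have "0 \<le> g x * real n" "g x * real n \<le> real n"
        using g01[of x] by (auto simp: mult_left_le_one_le)
      then show "real n * g x = (\<Sum>i<n. h i x)"
        unfolding h_def by (simp add: sum_clip mult.commute)
    qed (intro continuous_map_sum continuous_map_real_mult_left g hc; simp)+
    also have "\<dots> = (\<Sum>i<n. L (h i))"
      by (intro sum hc) auto
    also have "\<dots> \<le> (\<Sum>i<n. measure riesz (U i))"
      by (intro sum_mono hm)
    also have "\<dots> = (\<integral>x. (\<Sum>i<n. indicator (U i) x) \<partial>riesz)"
      using U by (simp add: openin_sets_borel_of emeasure_eq_measure Int_absorb2 openin_subset)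
    also have "\<dots> \<le> (\<integral>x. real n * g x + 1 \<partial>riesz)"
    proof (rule integral_mono)
      show "integrable riesz (\<lambda>x. \<Sum>i<n. indicator (U i) x :: real)"
        using U by (intro Bochner_Integration.integrable_sum integrable_real_indicator)
          (auto simp: openin_sets_borel_of emeasure_eq_measure)
      show "integrable riesz (\<lambda>x. real n * g x + 1)"
        using int by (intro Bochner_Integration.integrable_add) auto
      fix x assume "x \<in> space riesz"
      then have x: "x \<in> topspace X" by simp
      \<comment> \<open>On \<open>U i\<close> the value \<open>g x * n + 1\<close> exceeds
        \<open>i + 1\<close>, so the indicator is at most the \<open>i\<close>-th slice of that
        larger value.\<close>
      have "(\<Sum>i<n. indicator (U i) x) \<le> (\<Sum>i<n. min 1 (max 0 ((g x * real n + 1) - real i)))"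
        by (rule sum_mono) (auto simp: indicator_def U_def)
      also have "\<dots> = min (real n) (g x * real n + 1)"
        using g01[OF x] by (intro sum_clip) simp
      finally show "(\<Sum>i<n. indicator (U i) x) \<le> real n * g x + 1"
        by (simp add: mult.commute)
    qed
    also have "\<dots> = real n * integral\<^sup>L riesz g + total"
      using int by (simp add: measure_riesz_space)
    finally show ?thesis .
  qed
  show ?thesis
  proof (rule ccontr)
    assume "\<not> ?thesis"
    then have "L g - integral\<^sup>L riesz g > 0" by simp
    then obtain n where "total < real n * (L g - integral\<^sup>L riesz g)"
      using reals_Archimedean3 by blast
    with bound[of n] show False by (simp add: algebra_simps)
  qed
qed

text \<open>Adding \<open>B\<close> and dividing by \<open>2 * B\<close> moves the values of
  \<open>f\<close> into the unit interval, which gives one inequality; the other is the same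
  inequality for \<open>- f\<close>.\<close>

theorem riesz_representation:
  assumes f: "continuous_map X euclideanreal f"
  shows "integral\<^sup>L riesz f = L f"
proof -
  interpret finite_measure riesz by (rule finite_measure_riesz)
  have le: "L f \<le> integral\<^sup>L riesz f" if f: "continuous_map X euclideanreal f" for f
  proof -
    obtain B where B: "B > 0" "\<And>x. x \<in> topspace X \<Longrightarrow> \<bar>f x\<bar> \<le> B"
      using continuous_map_bounded[OF compact f] by metis
    have int: "integrable riesz f"
      by (rule integrable_continuous_map[OF compact f finite_measure_riesz]) simp
    have c: "continuous_map X euclideanreal (\<lambda>x. f x + B * 1)"
      by (intro continuous_map_add f) (auto simp: continuous_map_const)
    have "L (\<lambda>x. inverse (2 * B) * (f x + B * 1)) \<le> (\<integral>x. inverse (2 * B) * (f x + B * 1) \<partial>riesz)"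
    proof (rule le_integral_unit[OF continuous_map_real_mult_left[OF c]])
      fix x assume "x \<in> topspace X"
      then have "- B \<le> f x" "f x \<le> B" using B(2) abs_le_iff by force+
      then show "0 \<le> inverse (2 * B) * (f x + B * 1) \<and> inverse (2 * B) * (f x + B * 1) \<le> 1"
        using B(1) by (auto simp: field_simps)
    qed
    also have "\<dots> = inverse (2 * B) * (\<integral>x. f x + B * 1 \<partial>riesz)"
      by simp
    also have "(\<integral>x. f x + B * 1 \<partial>riesz) = integral\<^sup>L riesz f + B * total"
      using int by (simp add: measure_riesz_space)
    also have "L (\<lambda>x. inverse (2 * B) * (f x + B * 1)) = inverse (2 * B) * L (\<lambda>x. f x + B * 1)"
      by (rule scale[OF c])
    also have "L (\<lambda>x. f x + B * 1) = L f + L (\<lambda>x. B * 1)"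
      by (rule add[OF f]) (simp add: continuous_map_const)
    also have "L (\<lambda>x. B * 1) = B * total"
      unfolding total_def by (rule scale) (simp add: continuous_map_const)
    finally show ?thesis using B(1) by (simp add: field_simps)
  qed
  have "L (\<lambda>x. (-1) * f x) \<le> (\<integral>x. (-1) * f x \<partial>riesz)"
    by (rule le[OF continuous_map_real_mult_left[OF f]])
  then have "integral\<^sup>L riesz f \<le> L f"
    using scale[OF f, of "-1"] by simp
  with le[OF f] show ?thesis by simp
qed

end

section \<open>Signed Radon measures\<close>

lemma signed_borel_measure_Un:
  assumes \<nu>: "signed_borel_measure X \<nu>" and AB: "A \<in> sets (borel_of X)" "B \<in> sets (borel_of X)" "A \<inter> B = {}"
  shows "\<nu> (A \<union> B) = \<nu> A + \<nu> B"
proof -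
  have "range (binaryset A B) \<subseteq> sets (borel_of X)" "disjoint_family (binaryset A B)"
    using AB by (auto simp: binaryset_def disjoint_family_on_def)
  then have "(\<lambda>n. \<nu> (binaryset A B n)) sums \<nu> (\<Union>n. binaryset A B n)"
    using \<nu> unfolding signed_borel_measure_def by blast
  moreover have "(\<lambda>n. \<nu> (binaryset A B n)) sums (\<nu> A + \<nu> B)"
    using \<nu> by (intro binaryset_sums) (simp add: signed_borel_measure_def)
  ultimately show ?thesis by (simp add: UN_binaryset_eq sums_iff)
qed

lemma signed_borel_measure_scale:
  "signed_borel_measure X \<nu> \<Longrightarrow> signed_borel_measure X (\<lambda>A. c * \<nu> A)"
  by (auto simp: signed_borel_measure_def intro: sums_mult)

lemma signed_borel_measure_add:
  "signed_borel_measure X \<mu> \<Longrightarrow> signed_borel_measure X \<nu> \<Longrightarrow> signed_borel_measure X (\<lambda>A. \<mu> A + \<nu> A)"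
  by (auto simp: signed_borel_measure_def intro: sums_add)

lemma le_pos_variation:
  assumes "signed_borel_measure X \<nu>" "finite_measure (pos_variation X \<nu>)" "B \<in> sets (borel_of X)"
  shows "\<nu> B \<le> measure (pos_variation X \<nu>) B"
proof -
  have "ennreal (\<nu> B) \<le> emeasure (pos_variation X \<nu>) B"
    using assms(3) unfolding emeasure_pos_variation[OF assms(1,3)] by (auto intro: SUP_upper)
  then show ?thesis
    by (simp add: finite_measure.emeasure_eq_measure[OF assms(2)])
qed

text \<open>For Borel \<open>B \<subseteq> A\<close>, the value \<open>\<nu> B\<close> equals
  \<open>\<nu> A - \<nu> (A - B)\<close>, and \<open>- \<nu> (A - B)\<close> is at most the negative
  variation of \<open>A\<close>; then the supremum over \<open>B\<close> is taken.\<close>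

lemma jordan_decomposition_le:
  assumes \<nu>: "signed_borel_measure X \<nu>"
    and fin: "finite_measure (pos_variation X \<nu>)" "finite_measure (neg_variation X \<nu>)"
    and A: "A \<in> sets (borel_of X)"
  shows "measure (pos_variation X \<nu>) A \<le> \<nu> A + measure (neg_variation X \<nu>) A"
proof -
  interpret N: finite_measure "neg_variation X \<nu>" by fact
  have le: "\<nu> B \<le> \<nu> A + measure (neg_variation X \<nu>) A" if B: "B \<in> sets (borel_of X)" "B \<subseteq> A" for B
  proof -
    have "\<nu> (B \<union> (A - B)) = \<nu> B + \<nu> (A - B)"
      using A B by (intro signed_borel_measure_Un[OF \<nu>]) auto
    moreover have "B \<union> (A - B) = A" using B by auto
    moreover have "- \<nu> (A - B) \<le> measure (neg_variation X \<nu>) (A - B)"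
      using le_pos_variation[OF signed_borel_measure_scale[OF \<nu>, of "-1"]] fin A B
      by (simp add: neg_variation_def)
    moreover have "measure (neg_variation X \<nu>) (A - B) \<le> measure (neg_variation X \<nu>) A"
      using A by (intro N.finite_measure_mono) (auto simp: neg_variation_def)
    ultimately show ?thesis by simp
  qed
  have "0 \<le> \<nu> A + measure (neg_variation X \<nu>) A"
    using le[of "{}"] \<nu> by (simp add: signed_borel_measure_def)
  moreover have "emeasure (pos_variation X \<nu>) A \<le> ennreal (\<nu> A + measure (neg_variation X \<nu>) A)"
    unfolding emeasure_pos_variation[OF \<nu> A] using le by (intro SUP_least ennreal_leI) auto
  ultimately show ?thesis
    by (simp add: finite_measure.emeasure_eq_measure[OF fin(1)])
qed

lemma jordan_decomposition:
  assumes \<nu>: "signed_borel_measure X \<nu>"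
    and fin: "finite_measure (pos_variation X \<nu>)" "finite_measure (neg_variation X \<nu>)"
    and A: "A \<in> sets (borel_of X)"
  shows "\<nu> A = measure (pos_variation X \<nu>) A - measure (neg_variation X \<nu>) A"
proof -
  \<comment> \<open>Replacing \<open>\<nu>\<close> by its negative exchanges the two
    variations.\<close>
  have "measure (neg_variation X \<nu>) A \<le> - \<nu> A + measure (pos_variation X \<nu>) A"
    using jordan_decomposition_le[OF signed_borel_measure_scale[OF \<nu>, of "-1"]] fin A
    by (simp add: neg_variation_def)
  with jordan_decomposition_le[OF assms] show ?thesis by simp
qed

text \<open>
  Unlike the definition through the variations, this description is visibly stable under linear
  combinations and restriction.
\<close>

lemma signed_radon_measure_iff:
  assumes X: "Hausdorff_space X"
  shows "signed_radon_measure X \<nu> \<longleftrightarrow> signed_borel_measure X \<nu> \<and>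
    (\<exists>c. \<forall>A\<in>sets (borel_of X). \<bar>\<nu> A\<bar> \<le> c) \<and>
    (\<forall>A\<in>sets (borel_of X). \<forall>e>0. \<exists>K. compactin X K \<and> K \<subseteq> A \<and>
       (\<forall>B\<in>sets (borel_of X). B \<subseteq> A - K \<longrightarrow> \<bar>\<nu> B\<bar> \<le> e))" (is "?L \<longleftrightarrow> ?R")
proof
  assume L: ?L
  define p n where "p = pos_variation X \<nu>" and "n = neg_variation X \<nu>"
  have \<nu>: "signed_borel_measure X \<nu>" and rad: "radon_measure X p" "radon_measure X n"
    using L by (auto simp: signed_radon_measure_def p_def n_def)
  have fin: "finite_measure p" "finite_measure n" and sets: "sets p = sets (borel_of X)" "sets n = sets (borel_of X)"
    using rad by (auto simp: radon_measure_def)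
  interpret p: finite_measure p by fact
  interpret n: finite_measure n by fact
  have J: "\<bar>\<nu> A\<bar> \<le> measure p A + measure n A" if "A \<in> sets (borel_of X)" for A
    using jordan_decomposition[OF \<nu> _ _ that] fin measure_nonneg[of p A] measure_nonneg[of n A]
    unfolding p_def n_def by linarith
  have 1: "\<exists>c. \<forall>A\<in>sets (borel_of X). \<bar>\<nu> A\<bar> \<le> c"
    using J p.bounded_measure n.bounded_measure by (meson add_mono order_trans)
  have 2: "\<exists>K. compactin X K \<and> K \<subseteq> A \<and> (\<forall>B\<in>sets (borel_of X). B \<subseteq> A - K \<longrightarrow> \<bar>\<nu> B\<bar> \<le> e)"
    if A: "A \<in> sets (borel_of X)" and e: "e > 0" for A e
  proof -
    have e2: "e / 2 > 0" using e by simp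
    obtain K where K: "compactin X K" "K \<subseteq> A" "measure p (A - K) \<le> e / 2"
      using rad(1) A e2 unfolding radon_measure_iff[OF X] by (metis sets(1))
    obtain K' where K': "compactin X K'" "K' \<subseteq> A" "measure n (A - K') \<le> e / 2"
      using rad(2) A e2 unfolding radon_measure_iff[OF X] by (metis sets(2))
    show ?thesis
    proof (intro exI[of _ "K \<union> K'"] conjI ballI impI)
      fix B assume B: "B \<in> sets (borel_of X)" "B \<subseteq> A - (K \<union> K')"
      have "measure p B \<le> measure p (A - K)" "measure n B \<le> measure n (A - K')"
        using A B K K' by (auto intro!: p.finite_measure_mono n.finite_measure_mono
          simp: sets compactin_sets_borel_of[OF X])
      then show "\<bar>\<nu> B\<bar> \<le> e" using J[OF B(1)] K K' by simp
    qed (use K K' in \<open>auto intro: compactin_Un\<close>)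
  qed
  show ?R using \<nu> 1 2 by blast
next
  assume R: ?R
  \<comment> \<open>The bound \<open>\<nu>\<close> is arbitrary here: the fact is used again for the
    negated set function, whose positive variation is the negative variation.\<close>
  have *: "radon_measure X (pos_variation X \<nu>)" if \<nu>: "signed_borel_measure X \<nu>"
    and c: "\<And>A. A \<in> sets (borel_of X) \<Longrightarrow> \<bar>\<nu> A\<bar> \<le> c"
    and t: "\<And>A e. A \<in> sets (borel_of X) \<Longrightarrow> e > 0 \<Longrightarrow> \<exists>K. compactin X K \<and> K \<subseteq> A \<and>
       (\<forall>B\<in>sets (borel_of X). B \<subseteq> A - K \<longrightarrow> \<bar>\<nu> B\<bar> \<le> e)" for \<nu> :: "'a set \<Rightarrow> real" and c
  proof -
    have bound: "emeasure (pos_variation X \<nu>) A \<le> ennreal d"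
      if "A \<in> sets (borel_of X)" "\<And>B. B \<in> sets (borel_of X) \<Longrightarrow> B \<subseteq> A \<Longrightarrow> \<bar>\<nu> B\<bar> \<le> d" for A d
      unfolding emeasure_pos_variation[OF \<nu> that(1)]
      using that(2) by (intro SUP_least ennreal_leI) (auto simp: abs_le_iff)
    have sp: "space (pos_variation X \<nu>) = topspace X"
      using sets_eq_imp_space_eq[of "pos_variation X \<nu>" "borel_of X"] by simp
    have fin: "finite_measure (pos_variation X \<nu>)"
      using bound[of "topspace X" c] c
      by (intro finite_measureI) (auto simp: sp openin_sets_borel_of top_unique)
    then interpret finite_measure "pos_variation X \<nu>" .
    have "\<exists>K. compactin X K \<and> K \<subseteq> A \<and> measure (pos_variation X \<nu>) (A - K) \<le> e"
      if A: "A \<in> sets (borel_of X)" and e: "e > 0" for A e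
    proof -
      obtain K where K: "compactin X K" "K \<subseteq> A" "\<And>B. B \<in> sets (borel_of X) \<Longrightarrow> B \<subseteq> A - K \<Longrightarrow> \<bar>\<nu> B\<bar> \<le> e"
        using t[OF A e] by blast
      have "emeasure (pos_variation X \<nu>) (A - K) \<le> ennreal e"
        using A K compactin_sets_borel_of[OF X K(1)] by (intro bound) auto
      then show ?thesis using K e by (auto simp: emeasure_eq_measure)
    qed
    then show ?thesis using fin by (simp add: radon_measure_iff[OF X])
  qed
  obtain c where c: "\<And>A. A \<in> sets (borel_of X) \<Longrightarrow> \<bar>\<nu> A\<bar> \<le> c" using R by blast
  have "radon_measure X (pos_variation X \<nu>)" using R c by (intro *) auto
  moreover have "radon_measure X (neg_variation X \<nu>)"
    unfolding neg_variation_def using R c signed_borel_measure_scale[of X \<nu> "-1"] by (intro *) auto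
  ultimately show ?L using R by (simp add: signed_radon_measure_def)
qed

lemma signed_radon_measure_scale:
  assumes X: "Hausdorff_space X" and \<nu>: "signed_radon_measure X \<nu>"
  shows "signed_radon_measure X (\<lambda>A. a * \<nu> A)"
  unfolding signed_radon_measure_iff[OF X]
proof (intro conjI ballI allI impI)
  note \<nu>' = \<nu>[unfolded signed_radon_measure_iff[OF X]]
  show "signed_borel_measure X (\<lambda>A. a * \<nu> A)"
    using \<nu>' by (simp add: signed_borel_measure_scale)
  obtain c where "\<And>A. A \<in> sets (borel_of X) \<Longrightarrow> \<bar>\<nu> A\<bar> \<le> c" using \<nu>' by blast
  then show "\<exists>c. \<forall>A\<in>sets (borel_of X). \<bar>a * \<nu> A\<bar> \<le> c"
    by (intro exI[of _ "\<bar>a\<bar> * c"]) (auto simp: abs_mult mult_left_mono)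
  fix A and e :: real assume A: "A \<in> sets (borel_of X)" and e: "e > 0"
  \<comment> \<open>The summand 1 covers \<open>a = 0\<close>.\<close>
  have "e / (\<bar>a\<bar> + 1) > 0" using e by simp
  then obtain K where K: "compactin X K" "K \<subseteq> A"
    "\<And>B. B \<in> sets (borel_of X) \<Longrightarrow> B \<subseteq> A - K \<Longrightarrow> \<bar>\<nu> B\<bar> \<le> e / (\<bar>a\<bar> + 1)"
    using \<nu>' A by meson
  have "\<bar>a * \<nu> B\<bar> \<le> e" if "B \<in> sets (borel_of X)" "B \<subseteq> A - K" for B
  proof -
    have "\<bar>a * \<nu> B\<bar> \<le> (\<bar>a\<bar> + 1) * (e / (\<bar>a\<bar> + 1))"
      unfolding abs_mult using K(3)[OF that] by (intro mult_mono) auto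
    then show ?thesis by simp
  qed
  with K show "\<exists>K. compactin X K \<and> K \<subseteq> A \<and>
      (\<forall>B\<in>sets (borel_of X). B \<subseteq> A - K \<longrightarrow> \<bar>a * \<nu> B\<bar> \<le> e)"
    by blast
qed

lemma signed_radon_measure_add:
  assumes X: "Hausdorff_space X" and \<mu>: "signed_radon_measure X \<mu>" and \<nu>: "signed_radon_measure X \<nu>"
  shows "signed_radon_measure X (\<lambda>A. \<mu> A + \<nu> A)"
  unfolding signed_radon_measure_iff[OF X]
proof (intro conjI ballI allI impI)
  note \<mu>' = \<mu>[unfolded signed_radon_measure_iff[OF X]] and \<nu>' = \<nu>[unfolded signed_radon_measure_iff[OF X]]
  show "signed_borel_measure X (\<lambda>A. \<mu> A + \<nu> A)"
    using \<mu>' \<nu>' by (simp add: signed_borel_measure_add)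
  obtain c where c: "\<And>A. A \<in> sets (borel_of X) \<Longrightarrow> \<bar>\<mu> A\<bar> \<le> c"
    using \<mu>' by blast
  obtain d where d: "\<And>A. A \<in> sets (borel_of X) \<Longrightarrow> \<bar>\<nu> A\<bar> \<le> d"
    using \<nu>' by blast
  have "\<bar>\<mu> A + \<nu> A\<bar> \<le> c + d" if "A \<in> sets (borel_of X)" for A
    using c[OF that] d[OF that] by linarith
  then show "\<exists>c. \<forall>A\<in>sets (borel_of X). \<bar>\<mu> A + \<nu> A\<bar> \<le> c"
    by blast
  fix A and e :: real assume A: "A \<in> sets (borel_of X)" and "e > 0"
  then have e: "e / 2 > 0" by simp
  obtain K where K: "compactin X K" "K \<subseteq> A"
    "\<And>B. B \<in> sets (borel_of X) \<Longrightarrow> B \<subseteq> A - K \<Longrightarrow> \<bar>\<mu> B\<bar> \<le> e / 2"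
    using \<mu>' A e by meson
  obtain K' where K': "compactin X K'" "K' \<subseteq> A"
    "\<And>B. B \<in> sets (borel_of X) \<Longrightarrow> B \<subseteq> A - K' \<Longrightarrow> \<bar>\<nu> B\<bar> \<le> e / 2"
    using \<nu>' A e by meson
  have "\<bar>\<mu> B + \<nu> B\<bar> \<le> e" if "B \<in> sets (borel_of X)" "B \<subseteq> A - (K \<union> K')" for B
  proof -
    have "B \<subseteq> A - K" "B \<subseteq> A - K'" using that(2) by auto
    from K(3)[OF that(1) this(1)] K'(3)[OF that(1) this(2)] show ?thesis by linarith
  qed
  with K K' show "\<exists>K. compactin X K \<and> K \<subseteq> A \<and>
      (\<forall>B\<in>sets (borel_of X). B \<subseteq> A - K \<longrightarrow> \<bar>\<mu> B + \<nu> B\<bar> \<le> e)"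
    by (intro exI[of _ "K \<union> K'"]) (auto intro: compactin_Un)
qed

lemma signed_radon_measure_restrict:
  assumes X: "Hausdorff_space X" and \<nu>: "signed_radon_measure X \<nu>" and S: "S \<in> sets (borel_of X)"
  shows "signed_radon_measure X (restrict_signed \<nu> S)"
  unfolding signed_radon_measure_iff[OF X]
proof (intro conjI ballI allI impI)
  note \<nu>' = \<nu>[unfolded signed_radon_measure_iff[OF X]]
  show "signed_borel_measure X (restrict_signed \<nu> S)"
    unfolding signed_borel_measure_def
  proof (intro conjI allI impI)
    show "restrict_signed \<nu> S {} = 0"
      using \<nu>' by (simp add: restrict_signed_def signed_borel_measure_def)
    fix A :: "nat \<Rightarrow> _" assume A: "range A \<subseteq> sets (borel_of X)" "disjoint_family A"
    have "range (\<lambda>n. A n \<inter> S) \<subseteq> sets (borel_of X)" "disjoint_family (\<lambda>n. A n \<inter> S)"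
      using A S by (auto simp: disjoint_family_on_def)
    then have "(\<lambda>n. \<nu> (A n \<inter> S)) sums \<nu> (\<Union>n. A n \<inter> S)"
      using \<nu>' unfolding signed_borel_measure_def by blast
    then show "(\<lambda>n. restrict_signed \<nu> S (A n)) sums restrict_signed \<nu> S (\<Union>n. A n)"
      by (simp add: restrict_signed_def Int_UN_distrib2)
  qed
  obtain c where "\<And>A. A \<in> sets (borel_of X) \<Longrightarrow> \<bar>\<nu> A\<bar> \<le> c" using \<nu>' by blast
  then show "\<exists>c. \<forall>A\<in>sets (borel_of X). \<bar>restrict_signed \<nu> S A\<bar> \<le> c"
    using S by (intro exI[of _ c]) (auto simp: restrict_signed_def)
  fix A and e :: real assume A: "A \<in> sets (borel_of X)" and e: "e > 0"
  have "A \<inter> S \<in> sets (borel_of X)" using A S by auto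
  then obtain K where K: "compactin X K" "K \<subseteq> A \<inter> S"
    "\<And>B. B \<in> sets (borel_of X) \<Longrightarrow> B \<subseteq> A \<inter> S - K \<Longrightarrow> \<bar>\<nu> B\<bar> \<le> e"
    using \<nu>' e by meson
  have "\<bar>restrict_signed \<nu> S B\<bar> \<le> e" if "B \<in> sets (borel_of X)" "B \<subseteq> A - K" for B
    unfolding restrict_signed_def using that S by (intro K) auto
  with K show "\<exists>K. compactin X K \<and> K \<subseteq> A \<and>
      (\<forall>B\<in>sets (borel_of X). B \<subseteq> A - K \<longrightarrow> \<bar>restrict_signed \<nu> S B\<bar> \<le> e)"
    by blast
qed

lemma signed_radon_measure_measure:
  assumes X: "Hausdorff_space X" and m: "radon_measure X m"
  shows "signed_radon_measure X (measure m)"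
  unfolding signed_radon_measure_iff[OF X]
proof (intro conjI ballI allI impI)
  note m' = m[unfolded radon_measure_iff[OF X]]
  interpret finite_measure m using m' by simp
  show "signed_borel_measure X (measure m)"
    using m' finite_measure_UNION by (auto simp: signed_borel_measure_def)
  show "\<exists>c. \<forall>A\<in>sets (borel_of X). \<bar>measure m A\<bar> \<le> c"
    using bounded_measure by auto
  fix A and e :: real assume A: "A \<in> sets (borel_of X)" and e: "e > 0"
  then obtain K where K: "compactin X K" "K \<subseteq> A" "measure m (A - K) \<le> e"
    using m' by metis
  have "measure m B \<le> e" if "B \<subseteq> A - K" for B
  proof -
    have "A - K \<in> sets m"
      using A compactin_sets_borel_of[OF X K(1)] m' by auto
    then have "measure m B \<le> measure m (A - K)"
      using that by (intro finite_measure_mono)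
    then show ?thesis using K by simp
  qed
  with K show "\<exists>K. compactin X K \<and> K \<subseteq> A \<and>
      (\<forall>B\<in>sets (borel_of X). B \<subseteq> A - K \<longrightarrow> \<bar>measure m B\<bar> \<le> e)"
    by auto
qed

text \<open>
  Integrals against signed measures are limits of these sums, which are linear in \<open>\<nu>\<close>;
  \<open>c\<close> is a bound of \<open>\<bar>f\<bar>\<close> on the space.
\<close>

definition step_sum :: "'b topology \<Rightarrow> real \<Rightarrow> ('b \<Rightarrow> real) \<Rightarrow> nat \<Rightarrow> ('b set \<Rightarrow> real) \<Rightarrow> real" where
  "step_sum X c f n \<nu> = (\<Sum>k\<in>{-\<lceil>real (Suc n) * c\<rceil> - 1..\<lceil>real (Suc n) * c\<rceil>}.
     real_of_int k / real (Suc n) * \<nu> {x \<in> topspace X. \<lfloor>real (Suc n) * f x\<rfloor> = k})"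

lemma step_sum_sets:
  assumes "f \<in> borel_measurable (borel_of X)"
  shows "{x \<in> topspace X. \<lfloor>real (Suc n) * f x\<rfloor> = k} \<in> sets (borel_of X)"
proof -
  have "{x \<in> space (borel_of X). \<lfloor>real (Suc n) * f x\<rfloor> = k} \<in> sets (borel_of X)"
    using assms by measurable
  then show ?thesis by simp
qed

text \<open>Rounding \<open>f\<close> down to a multiple of \<open>1 / (n + 1)\<close> gives a
  simple function, uniformly within that distance of \<open>f\<close>, whose integral is
  \<open>step_sum\<close>. The bound \<open>c\<close> confines the rounded values to finitely
  many.\<close>

lemma step_sum_tendsto_integral:
  assumes m: "finite_measure m" "sets m = sets (borel_of X)"
    and f: "f \<in> borel_measurable (borel_of X)" and c: "\<And>x. x \<in> topspace X \<Longrightarrow> \<bar>f x\<bar> \<le> c"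
  shows "(\<lambda>n. step_sum X c f n (measure m)) \<longlonglongrightarrow> integral\<^sup>L m f"
proof -
  interpret finite_measure m by fact
  have sp: "space m = topspace X" using sets_eq_imp_space_eq[OF m(2)] by simp
  have fm: "f \<in> borel_measurable m" using f measurable_cong_sets[OF m(2) refl] by blast
  have int: "integrable m f"
    using c by (intro integrable_const_bound[of _ c] fm AE_I2) (simp add: sp)
  have bound: "\<bar>step_sum X c f n (measure m) - integral\<^sup>L m f\<bar> \<le> measure m (topspace X) * inverse (real (Suc n))" for n
  proof -
    define N where "N = real (Suc n)"
    have N: "N > 0" by (simp add: N_def)
    define K where "K = {-\<lceil>N * c\<rceil> - 1..\<lceil>N * c\<rceil>}"
    define A where "A k = {x \<in> topspace X. \<lfloor>N * f x\<rfloor> = k}" for k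
    have A: "A k \<in> sets m" for k
      using step_sum_sets[OF f, of n k] by (simp add: A_def N_def m)
    define s where "s x = (\<Sum>k\<in>K. real_of_int k / N * indicator (A k) x)" for x
    have ints: "integrable m s"
      unfolding s_def using A
      by (intro Bochner_Integration.integrable_sum integrable_mult_right integrable_real_indicator)
        (auto simp: emeasure_eq_measure)
    have "A k \<inter> space m = A k" for k using sp by (auto simp: A_def)
    then have eq: "step_sum X c f n (measure m) = integral\<^sup>L m s"
      unfolding s_def step_sum_def using A
      by (subst Bochner_Integration.integral_sum)
        (auto simp: A_def N_def K_def emeasure_eq_measure intro!: integrable_mult_right integrable_real_indicator)
    have close: "\<bar>s x - f x\<bar> \<le> inverse N" if x: "x \<in> topspace X" for x
    proof -
      have "\<bar>N * f x\<bar> \<le> N * c" using c[OF x] N by (simp add: abs_mult)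
      then have "\<lfloor>N * f x\<rfloor> \<in> K"
        unfolding K_def atLeastAtMost_iff by linarith
      then have "s x = (\<Sum>k\<in>{\<lfloor>N * f x\<rfloor>}. real_of_int k / N * indicator (A k) x)"
        unfolding s_def by (intro sum.mono_neutral_right) (auto simp: K_def A_def)
      then have "s x - f x = (real_of_int \<lfloor>N * f x\<rfloor> - N * f x) * inverse N"
        using x N by (simp add: A_def field_simps)
      moreover have "\<bar>real_of_int \<lfloor>N * f x\<rfloor> - N * f x\<bar> \<le> 1" by linarith
      ultimately show ?thesis
        using N mult_right_mono[of "\<bar>real_of_int \<lfloor>N * f x\<rfloor> - N * f x\<bar>" 1 "inverse N"]
        by (simp add: abs_mult)
    qed
    have "\<bar>integral\<^sup>L m s - integral\<^sup>L m f\<bar> = \<bar>\<integral>x. s x - f x \<partial>m\<bar>"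
      using ints int by simp
    also have "\<dots> \<le> (\<integral>x. \<bar>s x - f x\<bar> \<partial>m)"
      by (rule integral_abs_bound)
    also have "\<dots> \<le> (\<integral>x. inverse N \<partial>m)"
      using ints int close by (intro integral_mono integrable_abs Bochner_Integration.integrable_diff) (auto simp: sp)
    finally show ?thesis by (simp add: eq sp N_def)
  qed
  have "(\<lambda>n. measure m (topspace X) * inverse (real (Suc n))) \<longlonglongrightarrow> 0"
    using tendsto_mult[OF tendsto_const LIMSEQ_inverse_real_of_nat] by (simp only: mult_zero_right)
  moreover have "\<forall>\<^sub>F n in sequentially. norm (step_sum X c f n (measure m) - integral\<^sup>L m f)
      \<le> measure m (topspace X) * inverse (real (Suc n))"
    unfolding real_norm_def by (intro always_eventually allI bound)
  ultimately have "(\<lambda>n. step_sum X c f n (measure m) - integral\<^sup>L m f) \<longlonglongrightarrow> 0"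
    by (rule Lim_null_comparison[rotated])
  then show ?thesis by (simp add: LIM_zero_iff)
qed

lemma step_sum_cong:
  assumes "f \<in> borel_measurable (borel_of X)" "\<And>A. A \<in> sets (borel_of X) \<Longrightarrow> \<mu> A = \<nu> A"
  shows "step_sum X c f n \<mu> = step_sum X c f n \<nu>"
  unfolding step_sum_def using assms(2)[OF step_sum_sets[OF assms(1)]] by simp

lemma step_sum_tendsto_signed_integral:
  assumes \<nu>: "signed_radon_measure X \<nu>"
    and f: "f \<in> borel_measurable (borel_of X)" and c: "\<And>x. x \<in> topspace X \<Longrightarrow> \<bar>f x\<bar> \<le> c"
  shows "(\<lambda>n. step_sum X c f n \<nu>) \<longlonglongrightarrow> signed_integral X \<nu> f"
proof -
  define p n where "p = pos_variation X \<nu>" and "n = neg_variation X \<nu>"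
  have fin: "finite_measure p" "sets p = sets (borel_of X)" "finite_measure n" "sets n = sets (borel_of X)"
    using \<nu> by (auto simp: signed_radon_measure_def p_def n_def radon_measure_def)
  have "\<nu> A = measure p A - measure n A" if "A \<in> sets (borel_of X)" for A
    using \<nu> fin that jordan_decomposition[of X \<nu> A]
    by (simp add: p_def n_def signed_radon_measure_def)
  then have "step_sum X c f k \<nu> = step_sum X c f k (\<lambda>A. measure p A - measure n A)" for k
    by (intro step_sum_cong f)
  also have "\<dots> k = step_sum X c f k (measure p) - step_sum X c f k (measure n)" for k
    by (simp add: step_sum_def right_diff_distrib sum_subtractf)
  finally have "step_sum X c f k \<nu> = step_sum X c f k (measure p) - step_sum X c f k (measure n)" for k .
  moreover have "(\<lambda>k. step_sum X c f k (measure p) - step_sum X c f k (measure n)) \<longlonglongrightarrow>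
      integral\<^sup>L p f - integral\<^sup>L n f"
    by (intro tendsto_diff step_sum_tendsto_integral fin f c)
  ultimately show ?thesis by (simp add: signed_integral_def p_def n_def)
qed

lemma signed_integral_add:
  assumes X: "Hausdorff_space X" and \<mu>: "signed_radon_measure X \<mu>" and \<nu>: "signed_radon_measure X \<nu>"
    and f: "f \<in> borel_measurable (borel_of X)" and c: "\<And>x. x \<in> topspace X \<Longrightarrow> \<bar>f x\<bar> \<le> c"
  shows "signed_integral X (\<lambda>A. \<mu> A + \<nu> A) f = signed_integral X \<mu> f + signed_integral X \<nu> f"
proof -
  have "step_sum X c f n (\<lambda>A. \<mu> A + \<nu> A) = step_sum X c f n \<mu> + step_sum X c f n \<nu>" for n
    by (simp add: step_sum_def distrib_left sum.distrib)
  then show ?thesis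
    using step_sum_tendsto_signed_integral[OF signed_radon_measure_add[OF X \<mu> \<nu>] f c]
      tendsto_add[OF step_sum_tendsto_signed_integral[OF \<mu> f c] step_sum_tendsto_signed_integral[OF \<nu> f c]]
    by (auto intro: LIMSEQ_unique)
qed

lemma signed_integral_scale:
  assumes X: "Hausdorff_space X" and \<nu>: "signed_radon_measure X \<nu>"
    and f: "f \<in> borel_measurable (borel_of X)" and c: "\<And>x. x \<in> topspace X \<Longrightarrow> \<bar>f x\<bar> \<le> c"
  shows "signed_integral X (\<lambda>A. a * \<nu> A) f = a * signed_integral X \<nu> f"
proof -
  have "step_sum X c f n (\<lambda>A. a * \<nu> A) = a * step_sum X c f n \<nu>" for n
    by (simp add: step_sum_def sum_distrib_left mult.left_commute)
  then show ?thesis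
    using step_sum_tendsto_signed_integral[OF signed_radon_measure_scale[OF X \<nu>, of a] f c]
      tendsto_mult[OF tendsto_const[of a] step_sum_tendsto_signed_integral[OF \<nu> f c]]
    by (auto intro: LIMSEQ_unique)
qed

text \<open>Both sides are limits of the same sums, so the variations of \<open>\<nu>\<close> need
  not be identified with \<open>m\<close> and the zero measure.\<close>

lemma signed_integral_eq_integral:
  assumes \<nu>: "signed_radon_measure X \<nu>" and m: "finite_measure m" "sets m = sets (borel_of X)"
    and eq: "\<And>A. A \<in> sets (borel_of X) \<Longrightarrow> \<nu> A = measure m A"
    and f: "f \<in> borel_measurable (borel_of X)" and c: "\<And>x. x \<in> topspace X \<Longrightarrow> \<bar>f x\<bar> \<le> c"
  shows "signed_integral X \<nu> f = integral\<^sup>L m f"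
  using step_sum_tendsto_signed_integral[OF \<nu> f c] step_sum_tendsto_integral[OF m f c]
    step_sum_cong[OF f eq] by (auto intro: LIMSEQ_unique)

section \<open>Completely metrizable spaces in their Stone-Cech compactification\<close>

text \<open>
  The classical argument that completely metrizable spaces are Cech-complete: a point of the
  compactification with neighbourhoods whose traces have arbitrarily small diameter is the limit of
  a Cauchy sequence.
\<close>

lemma stone_cech_embed_Gdelta:
  assumes X: "completely_metrizable_space X"
  obtains U :: "nat \<Rightarrow> (('b \<Rightarrow> real) \<Rightarrow> real) set"
  where "\<And>n. openin (stone_cech X) (U n)" "stone_cech_embed X ` topspace X = (\<Inter>n. U n)"
proof -
  let ?\<beta> = "stone_cech X" and ?e = "stone_cech_embed X"
  obtain M d where "Metric_space M d" and mc: "Metric_space.mcomplete M d"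
    and XM: "X = Metric_space.mtopology M d"
    using X unfolding completely_metrizable_space_def by blast
  then interpret Metric_space M d by simp
  have M: "topspace X = M" by (simp add: XM)
  have met: "metrizable_space X" using X by (rule completely_metrizable_imp_metrizable_space)
  have emb: "homeomorphic_map X (subtopology ?\<beta> (?e ` M)) ?e"
    using stone_cech_embedding[OF metrizable_imp_completely_regular_space[OF met]
        metrizable_imp_Hausdorff_space[OF met]]
    unfolding embedding_map_def M .
  have inj: "inj_on ?e M"
    using homeomorphic_imp_injective_map[OF emb] by (simp add: M)
  \<comment> \<open>The embedding is open only onto its image, so a ball of \<open>M\<close> is the
    trace of some open \<open>W\<close>; points of \<open>W\<close> outside the image are not
    restricted.\<close>
  have nbhd: "\<exists>W. openin ?\<beta> W \<and> ?e z \<in> W \<and> (\<forall>w\<in>M. ?e w \<in> W \<longrightarrow> w \<in> mball z r)"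
    if z: "z \<in> M" and r: "r > 0" for z r
  proof -
    have "openin (subtopology ?\<beta> (?e ` M)) (?e ` mball z r)"
      using homeomorphic_imp_open_map[OF emb] unfolding open_map_def XM by (simp add: openin_mball)
    then obtain W where W: "openin ?\<beta> W" "?e ` mball z r = W \<inter> ?e ` M"
      by (auto simp: openin_subtopology)
    have "w \<in> mball z r" if "w \<in> M" "?e w \<in> W" for w
    proof -
      have "?e w \<in> ?e ` mball z r" using W that by blast
      then show ?thesis using inj that(1) by (auto dest: inj_onD)
    qed
    moreover have "?e z \<in> W" using W z r by (metis IntD1 centre_in_mball_iff imageI)
    ultimately show ?thesis using W(1) by blast
  qed
  define U where "U n = \<Union>{W. openin ?\<beta> W \<and>
      (\<exists>x\<in>M. \<forall>w\<in>M. ?e w \<in> W \<longrightarrow> w \<in> mball x (inverse (real (Suc n))))}" for n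
  show thesis
  proof (rule that[of U])
    show "openin ?\<beta> (U n)" for n
      unfolding U_def by (rule openin_Union) auto
    show "?e ` topspace X = (\<Inter>n. U n)"
    proof (intro equalityI subsetI)
      fix p assume "p \<in> ?e ` topspace X"
      then obtain z where z: "z \<in> M" "p = ?e z" by (auto simp: M)
      have "p \<in> U n" for n
        using nbhd[OF z(1), of "inverse (real (Suc n))"] z unfolding U_def by auto
      then show "p \<in> (\<Inter>n. U n)" by blast
    next
      fix p assume p: "p \<in> (\<Inter>n. U n)"
      have "\<forall>n. \<exists>W x. openin ?\<beta> W \<and> p \<in> W \<and> x \<in> M \<and>
          (\<forall>w\<in>M. ?e w \<in> W \<longrightarrow> w \<in> mball x (inverse (real (Suc n))))"
      proof
        fix n
        have "p \<in> U n" using p by blast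
        then show "\<exists>W x. openin ?\<beta> W \<and> p \<in> W \<and> x \<in> M \<and>
            (\<forall>w\<in>M. ?e w \<in> W \<longrightarrow> w \<in> mball x (inverse (real (Suc n))))"
          unfolding U_def by blast
      qed
      then obtain W x where W: "\<And>n. openin ?\<beta> (W n)" "\<And>n. p \<in> W n" and x: "\<And>n. x n \<in> M"
        and ball: "\<And>n w. w \<in> M \<Longrightarrow> ?e w \<in> W n \<Longrightarrow> w \<in> mball (x n) (inverse (real (Suc n)))"
        by metis
      \<comment> \<open>Intersecting the first neighbourhoods puts every \<open>z k\<close> with
        \<open>k \<ge> n\<close> into \<open>W n\<close>, which makes the sequence Cauchy.\<close>
      define V where "V n = (\<Inter>i\<le>n. W i)" for n
      have V: "openin ?\<beta> (V n)" "p \<in> V n" for n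
        unfolding V_def using W by (auto intro: openin_INT)
      have dense: "\<exists>w\<in>M. ?e w \<in> T" if T: "openin ?\<beta> T" "p \<in> T" for T
      proof -
        have "p \<in> topspace ?\<beta>" using openin_subset[OF T(1)] T(2) by auto
        then have "p \<in> ?\<beta> closure_of (?e ` M)"
          using stone_cech_embed_dense[of X] by (simp add: M)
        then show ?thesis using T unfolding in_closure_of by blast
      qed
      obtain z where z: "\<And>n. z n \<in> M" "\<And>n. ?e (z n) \<in> V n"
        using dense[OF V] by metis
      have close: "d w w' < 2 * inverse (real (Suc n))"
        if "w \<in> M" "w' \<in> M" "?e w \<in> W n" "?e w' \<in> W n" for w w' n
      proof -
        have "d w w' \<le> d w (x n) + d (x n) w'" by (rule triangle[OF that(1) x that(2)])
        moreover have "d (x n) w < inverse (real (Suc n))" "d (x n) w' < inverse (real (Suc n))"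
          using ball[OF that(1,3)] ball[OF that(2,4)] by auto
        ultimately show ?thesis by (simp add: commute)
      qed
      have small: "\<exists>n. 2 * inverse (real (Suc n)) < r" if "r > 0" for r
      proof -
        have "r / 2 > 0" using that by simp
        then obtain n where "inverse (real (Suc n)) < r / 2" using reals_Archimedean by blast
        then show ?thesis by (intro exI[of _ n]) linarith
      qed
      have zW: "?e (z k) \<in> W n" if "n \<le> k" for n k
        using z(2)[of k] that by (auto simp: V_def)
      have "MCauchy z"
        unfolding MCauchy_def
      proof (intro conjI allI impI)
        show "range z \<subseteq> M" using z(1) by auto
        fix r :: real assume "r > 0"
        then obtain n where n: "2 * inverse (real (Suc n)) < r" using small by blast
        show "\<exists>N. \<forall>k k'. N \<le> k \<longrightarrow> N \<le> k' \<longrightarrow> d (z k) (z k') < r"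
          using close[OF z(1) z(1) zW zW] n by (meson order_less_trans)
      qed
      then obtain l where l: "limitin mtopology z l sequentially"
        using mc unfolding mcomplete_def by blast
      have lM: "l \<in> M" using l by (rule limitin_mspace)
      have "p = ?e l"
      proof (rule ccontr)
        assume "p \<noteq> ?e l"
        moreover have "p \<in> topspace ?\<beta>" using openin_subset[OF V(1)] V(2) by blast
        moreover have "?e l \<in> topspace ?\<beta>" by (rule stone_cech_embed_in) (simp add: M lM)
        ultimately obtain T T' where T: "openin ?\<beta> T" "openin ?\<beta> T'" "p \<in> T" "?e l \<in> T'" "disjnt T T'"
          using Hausdorff_space_stone_cech[of X] unfolding Hausdorff_space_def by metis
        have "openin X {w \<in> topspace X. ?e w \<in> T'}"
          using homeomorphic_imp_continuous_map[OF emb] T(2)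
          by (intro openin_continuous_map_preimage[of _ ?\<beta>]) (auto simp: continuous_map_in_subtopology)
        then obtain r where r: "r > 0" "mball l r \<subseteq> {w \<in> topspace X. ?e w \<in> T'}"
          using lM T(4) unfolding XM openin_mtopology by auto
        obtain n where n: "2 * inverse (real (Suc n)) < r / 2" using small[of "r / 2"] r(1) by auto
        \<comment> \<open>Density gives a point of \<open>M\<close> whose image is in both
          \<open>T\<close> and \<open>W n\<close>. It is within \<open>r / 2\<close> of a late
          \<open>z k\<close>, which is within \<open>r / 2\<close> of \<open>l\<close>; so its image
          also lies in \<open>T'\<close>, against disjointness.\<close>
        obtain w where w: "w \<in> M" "?e w \<in> T \<inter> W n"
          using dense[of "T \<inter> W n"] T W by auto
        have "\<forall>\<^sub>F k in sequentially. z k \<in> M \<and> d (z k) l < r / 2"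
          using l half_gt_zero[OF r(1)] unfolding limitin_metric by blast
        moreover have "\<forall>\<^sub>F k in sequentially. n \<le> k" by (rule eventually_ge_at_top)
        ultimately obtain k where k: "d (z k) l < r / 2" "n \<le> k"
          by (metis (mono_tags, lifting) eventually_conj eventually_happens trivial_limit_sequentially)
        have "d w l \<le> d w (z k) + d (z k) l" by (rule triangle[OF w(1) z(1) lM])
        also have "d w (z k) < r / 2"
          using close[OF w(1) z(1) _ zW[OF k(2)]] w(2) n by fastforce
        finally have "w \<in> mball l r" using k w(1) lM by (simp add: commute)
        with r(2) T(5) w(2) show False by (auto simp: disjnt_iff)
      qed
      then show "p \<in> ?e ` topspace X" using lM by (simp add: M)
    qed
  qed
qed

text \<open>The product metric need not be complete here, since pairs of distinct points can
  converge to the diagonal. The set is nevertheless open in a complete space, so another metric with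
  the same topology is complete.\<close>

lemma completely_metrizable_space_offdiag:
  "completely_metrizable_space (offdiag :: ('a::complete_space \<times> 'a) topology)"
proof -
  have "{(x, y). x \<noteq> (y::'a)} = - {p. fst p = snd p}" by auto
  then have "open {(x, y). x \<noteq> (y::'a)}"
    by (simp add: open_Collect_neg closed_Collect_eq continuous_on_fst continuous_on_snd closed_def[symmetric])
  then show ?thesis
    unfolding offdiag_def
    by (intro completely_metrizable_space_openin completely_metrizable_space_euclidean) simp
qed

lemma offdiag_in_beta_sets:
  "(offdiag_in_beta :: ((('a::complete_space \<times> 'a) \<Rightarrow> real) \<Rightarrow> real) set) \<in> sets (borel_of beta_offdiag)"
proof -
  obtain U :: "nat \<Rightarrow> ((('a \<times> 'a) \<Rightarrow> real) \<Rightarrow> real) set"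
    where U: "\<And>n. openin beta_offdiag (U n)" "offdiag_in_beta = (\<Inter>n. U n)"
    using stone_cech_embed_Gdelta[OF completely_metrizable_space_offdiag] unfolding offdiag_in_beta_def by metis
  have "(\<Inter>n. U n) \<in> sets (borel_of beta_offdiag)"
    using openin_sets_borel_of[OF U(1)] by (intro sets.countable_INT) auto
  then show ?thesis by (simp add: U(2))
qed

section \<open>Measures on the off-diagonal part and the free space\<close>

definition molecule :: "'a::{metric_space,zero} \<times> 'a \<Rightarrow> 'a lip0_dual" where
  "molecule p = (lip_eval (fst p) - lip_eval (snd p)) /\<^sub>R dist (fst p) (snd p)"

lemma molecule_apply: "molecule p f = diff_quot (lip0_apply f) p"
  by (simp add: molecule_def diff_quot_def case_prod_unfold blinfun.diff_left blinfun.scaleR_left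
      lip_eval.rep_eq divide_inverse mult.commute)

lemma molecule_in_span: "molecule p \<in> span (range lip_eval)"
  unfolding molecule_def by (intro span_scale span_diff span_base rangeI)

lemma continuous_map_molecule: "continuous_map offdiag euclidean molecule"
proof -
  have "1-lipschitz_on UNIV (lip_eval :: 'a \<Rightarrow> _)"
    using norm_lipfree_eval_diff
    by (intro lipschitz_onI) (auto simp: dist_norm norm_lipfree.rep_eq minus_lipfree.rep_eq lipfree_eval.rep_eq)
  then have c: "continuous_on UNIV (lip_eval :: 'a \<Rightarrow> _)"
    by (rule lipschitz_on_continuous_on)
  have "continuous_on {(x, y). x \<noteq> y} (molecule :: 'a \<times> 'a \<Rightarrow> _)"
    unfolding molecule_def
    by (intro continuous_intros continuous_on_compose2[OF c]) auto
  then show ?thesis by (simp add: offdiag_def)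
qed

text \<open>A finite \<open>e\<close>-net of the compact image of \<open>C\<close> yields preimages
  of balls, which are then made disjoint. As \<open>g\<close> is continuous only relative to
  \<open>S\<close>, such a preimage is the intersection of \<open>C\<close> with an open set and
  with \<open>S\<close>, and is Borel because \<open>S\<close> is.\<close>

lemma finite_borel_partition:
  fixes g :: "'b \<Rightarrow> 'c::metric_space"
  assumes X: "Hausdorff_space X" and S: "S \<in> sets (borel_of X)"
    and C: "compactin X C" "C \<subseteq> S" and g: "continuous_map (subtopology X S) euclidean g"
    and e: "e > 0"
  obtains A :: "nat \<Rightarrow> 'b set" and k :: nat and t where "range A \<subseteq> sets (borel_of X)" "disjoint_family A" "(\<Union>i<k. A i) = C"
    "\<forall>i<k. t i \<in> g ` C" "\<forall>i<k. \<forall>q\<in>A i. dist (t i) (g q) < e"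
proof -
  have SX: "topspace (subtopology X S) = S"
    using sets.sets_into_space[OF S] by auto
  have "compactin (subtopology X S) C"
    using C by (simp add: compactin_subtopology)
  then have "compact (g ` C)"
    using image_compactin[OF _ g] by simp
  then obtain T where T: "T \<subseteq> g ` C" "finite T" "g ` C \<subseteq> (\<Union>c\<in>T. ball c e)"
  proof (rule compactE_image[of "g ` C" "g ` C" "\<lambda>c. ball c e"])
    show "g ` C \<subseteq> (\<Union>c\<in>g ` C. ball c e)" using e by auto
  qed auto
  obtain k :: nat and t where t: "T = t ` {i. i < k}"
    using finite_imp_nat_seg_image_inj_on[OF T(2)] by blast
  \<comment> \<open>The sets are empty from \<open>k\<close> on, so that a finite cover becomes a
    sequence to which \<open>disjointed\<close> applies.\<close>
  define B where "B i = (if i < k then {q \<in> C. g q \<in> ball (t i) e} else {})" for i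
  have B: "B i \<in> sets (borel_of X)" for i
  proof -
    have "openin (subtopology X S) {q \<in> topspace (subtopology X S). g q \<in> ball (t i) e}"
      by (rule openin_continuous_map_preimage[OF g]) simp
    then obtain W where W: "openin X W" "{q \<in> S. g q \<in> ball (t i) e} = W \<inter> S"
      unfolding SX openin_subtopology by blast
    have "{q \<in> C. g q \<in> ball (t i) e} = C \<inter> (W \<inter> S)"
      using C(2) W(2) by blast
    moreover have "C \<inter> (W \<inter> S) \<in> sets (borel_of X)"
      by (intro sets.Int openin_sets_borel_of compactin_sets_borel_of[OF X] W C S)
    ultimately show ?thesis by (simp add: B_def)
  qed
  show thesis
  proof (rule that[of "disjointed B" k t])
    show "range (disjointed B) \<subseteq> sets (borel_of X)"
      using B by (intro sets.range_disjointed_sets) auto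
    show "disjoint_family (disjointed B)" by (rule disjoint_family_disjointed)
    have "\<exists>i\<in>{0..<k}. g q \<in> ball (t i) e" if "q \<in> C" for q
    proof -
      have "g q \<in> (\<Union>c\<in>T. ball c e)" using T(3) that by blast
      then show ?thesis by (force simp: t)
    qed
    then have "(\<Union>i\<in>{0..<k}. B i) = C"
      by (auto simp: B_def)
    then show "(\<Union>i<k. disjointed B i) = C"
      using finite_UN_disjointed_eq[of B k] by (simp add: atLeast0LessThan)
    show "\<forall>i<k. t i \<in> g ` C"
      using T(1) by (auto simp: t)
    have "dist (t i) (g q) < e" if "i < k" "q \<in> disjointed B i" for i q
      using that disjointed_subset[of B i] by (auto simp: B_def)
    then show "\<forall>i<k. \<forall>q\<in>disjointed B i. dist (t i) (g q) < e" by blast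
  qed
qed

text \<open>On the off-diagonal part \<open>de_leeuw f\<close> is evaluation of the molecule at
  \<open>f\<close>, so \<open>\<phi>\<close> is formally an integral of molecules. Vector-valued
  integration is avoided: a finite combination of molecules is compared with \<open>\<phi>\<close>
  on each \<open>f\<close>, with an error proportional to \<open>norm f\<close>, and this is an
  estimate in the dual norm.\<close>

lemma radon_functional_in_free_space:
  fixes \<phi> :: "'a::{complete_space,zero} lip0_dual"
  assumes S: "offdiag_in_beta \<in> sets (borel_of (beta_offdiag :: ((('a \<times> 'a) \<Rightarrow> real) \<Rightarrow> real) topology))"
    and m: "radon_measure beta_offdiag m"
    and null: "measure m (topspace beta_offdiag - offdiag_in_beta) = 0"
    and \<phi>: "\<And>f. blinfun_apply \<phi> f = integral\<^sup>L m (de_leeuw f)"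
  shows "\<phi> \<in> free_space"
proof -
  let ?\<beta> = "beta_offdiag :: ((('a \<times> 'a) \<Rightarrow> real) \<Rightarrow> real) topology"
  let ?S = "offdiag_in_beta :: ((('a \<times> 'a) \<Rightarrow> real) \<Rightarrow> real) set"
  have X: "Hausdorff_space ?\<beta>" by (rule Hausdorff_space_stone_cech)
  have m': "sets m = sets (borel_of ?\<beta>)" "finite_measure m"
    using m by (auto simp: radon_measure_def)
  interpret finite_measure m by fact
  have sp: "space m = topspace ?\<beta>" using sets_eq_imp_space_eq[OF m'(1)] by simp
  have met: "metrizable_space (offdiag :: ('a \<times> 'a) topology)"
    unfolding offdiag_def by (intro metrizable_space_subtopology metrizable_space_euclidean)
  have "embedding_map offdiag ?\<beta> (stone_cech_embed offdiag)"
    by (intro stone_cech_embedding metrizable_imp_completely_regular_space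
        metrizable_imp_Hausdorff_space met)
  then obtain r where r: "homeomorphic_maps offdiag (subtopology ?\<beta> ?S) (stone_cech_embed offdiag) r"
    unfolding embedding_map_def homeomorphic_map_maps offdiag_in_beta_def by blast
  define g where "g = molecule \<circ> r"
  have g: "continuous_map (subtopology ?\<beta> ?S) euclidean g"
    unfolding g_def using r continuous_map_molecule
    by (intro continuous_map_compose[of _ offdiag]) (auto simp: homeomorphic_maps_def)
  have gS: "blinfun_apply (g q) f = de_leeuw f q" "g q \<in> span (range lip_eval)" if qS: "q \<in> ?S" for q f
  proof -
    obtain p where p: "p \<in> topspace offdiag" "q = stone_cech_embed offdiag p"
      using qS unfolding offdiag_in_beta_def by blast
    then have "r q = p" using r by (auto simp: homeomorphic_maps_def)
    then show "blinfun_apply (g q) f = de_leeuw f q" "g q \<in> span (range lip_eval)"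
      using p by (simp_all add: g_def molecule_apply de_leeuw_embed molecule_in_span)
  qed
  \<comment> \<open>The error on the compact set \<open>C\<close> is at most \<open>e\<close> times
    the mass. The summand 1 pays for the rest, where the integrand is at most \<open>norm f\<close>
    and the mass at most \<open>e\<close>.\<close>
  have approx: "\<exists>\<psi>\<in>span (range lip_eval). dist \<psi> \<phi> \<le> e * (measure m (topspace ?\<beta>) + 1)" if e: "e > 0" for e
  proof -
    obtain C where C: "compactin ?\<beta> C" "C \<subseteq> ?S" "measure m (?S - C) \<le> e"
      using m S e unfolding radon_measure_iff[OF X] by metis
    have Cs: "C \<in> sets m" by (simp add: m' compactin_sets_borel_of[OF X C(1)])
    have Ss: "?S \<in> sets m" by (simp add: m' S)
    have top: "topspace ?\<beta> \<in> sets m" using sets.top[of m] by (simp add: sp)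
    have "topspace ?\<beta> - C \<subseteq> (topspace ?\<beta> - ?S) \<union> (?S - C)" by auto
    then have "measure m (topspace ?\<beta> - C) \<le> measure m ((topspace ?\<beta> - ?S) \<union> (?S - C))"
      using Cs Ss top by (intro finite_measure_mono) auto
    also have "\<dots> \<le> measure m (topspace ?\<beta> - ?S) + measure m (?S - C)"
      using Cs Ss top by (intro measure_Un_le) auto
    finally have mC: "measure m (topspace ?\<beta> - C) \<le> e" using C(3) null by simp
    obtain A and k :: nat and t where A: "range A \<subseteq> sets (borel_of ?\<beta>)" "disjoint_family A" "(\<Union>i<k. A i) = C"
      and t: "\<forall>i<k. t i \<in> g ` C" "\<forall>i<k. \<forall>q\<in>A i. dist (t i) (g q) < e"
      by (rule finite_borel_partition[OF X S C(1,2) g e])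
    have As: "A i \<in> sets m" for i using A(1) by (auto simp: m')
    have AC: "A i \<subseteq> C" if "i < k" for i using A(3) that by blast
    define \<psi> where "\<psi> = (\<Sum>i<k. measure m (A i) *\<^sub>R t i)"
    have "t i \<in> span (range lip_eval)" if i: "i < k" for i
    proof -
      obtain q where "q \<in> C" "t i = g q" using t(1) i by auto
      then show ?thesis using gS(2)[of q] C(2) by auto
    qed
    then have "\<psi> \<in> span (range lip_eval)"
      unfolding \<psi>_def by (intro span_sum span_scale) simp
    moreover have "norm (\<psi> - \<phi>) \<le> e * (measure m (topspace ?\<beta>) + 1)"
    proof (rule norm_blinfun_bound)
      show "0 \<le> e * (measure m (topspace ?\<beta>) + 1)" using e by simp
      fix f :: "'a lip0"
      define s where "s q = (\<Sum>i<k. t i f * indicator (A i) q)" for q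
      have ints: "integrable m s"
        unfolding s_def using As
        by (intro Bochner_Integration.integrable_sum integrable_mult_right integrable_real_indicator)
          (auto simp: emeasure_eq_measure)
      have intf: "integrable m (de_leeuw f)" by (rule integrable_de_leeuw[OF m])
      have As': "A i \<inter> space m = A i" for i
        using sets.sets_into_space[OF As] by blast
      have "\<psi> f = integral\<^sup>L m s"
        unfolding s_def \<psi>_def using As As'
        by (subst Bochner_Integration.integral_sum)
          (auto simp: emeasure_eq_measure blinfun.sum_left blinfun.scaleR_left mult.commute
            intro!: integrable_mult_right integrable_real_indicator)
      then have "norm ((\<psi> - \<phi>) f) = \<bar>\<integral>q. s q - de_leeuw f q \<partial>m\<bar>"
        using ints intf by (simp add: blinfun.diff_left \<phi>)
      also have "\<dots> \<le> (\<integral>q. \<bar>s q - de_leeuw f q\<bar> \<partial>m)"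
        by (rule integral_abs_bound)
      also have "\<dots> \<le> (\<integral>q. e * norm f + norm f * indicator (topspace ?\<beta> - C) q \<partial>m)"
      proof (rule integral_mono)
        show "integrable m (\<lambda>q. \<bar>s q - de_leeuw f q\<bar>)"
          using ints intf by (intro integrable_abs Bochner_Integration.integrable_diff)
        show "integrable m (\<lambda>q. e * norm f + norm f * indicator (topspace ?\<beta> - C) q)"
          using Cs top by (intro Bochner_Integration.integrable_add integrable_mult_right integrable_real_indicator)
            (auto simp: emeasure_eq_measure)
        fix q assume "q \<in> space m"
        then have q: "q \<in> topspace ?\<beta>" by (simp add: sp)
        show "\<bar>s q - de_leeuw f q\<bar> \<le> e * norm f + norm f * indicator (topspace ?\<beta> - C) q"
        proof (cases "q \<in> C")
          case False
          then have "q \<notin> A i" if "i < k" for i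
            using AC[OF that] by blast
          then have "s q = 0"
            unfolding s_def by (intro sum.neutral) simp
          then show ?thesis using False q abs_de_leeuw_le[OF q, of f] e by (simp add: add_increasing)
        next
          case True
          then obtain i where i: "i < k" "q \<in> A i" using A(3) by blast
          have "q \<notin> A j" if "j \<noteq> i" for j
            using disjoint_family_onD[OF A(2), of i j] i(2) that by auto
          then have "s q = (\<Sum>j\<in>{i}. t j f * indicator (A j) q)"
            unfolding s_def using i(1) by (intro sum.mono_neutral_right) auto
          then have "\<bar>s q - de_leeuw f q\<bar> = norm ((t i - g q) f)"
            using i(2) gS(1)[of q f] True C(2) by (auto simp: blinfun.diff_left)
          also have "\<dots> \<le> norm (t i - g q) * norm f" by (rule norm_blinfun)
          also have "\<dots> \<le> e * norm f"
            using t(2) i by (intro mult_right_mono) (auto simp: dist_norm less_imp_le)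
          finally show ?thesis using True by simp
        qed
      qed
      also have "\<dots> = e * norm f * measure m (topspace ?\<beta>) + norm f * measure m (topspace ?\<beta> - C)"
        using Cs top by (subst Bochner_Integration.integral_add)
          (auto simp: emeasure_eq_measure sp Int_absorb2 intro!: integrable_mult_right integrable_real_indicator)
      also have "\<dots> \<le> e * norm f * measure m (topspace ?\<beta>) + norm f * e"
        using mC by (intro add_left_mono mult_left_mono) auto
      finally show "norm ((\<psi> - \<phi>) f) \<le> e * (measure m (topspace ?\<beta>) + 1) * norm f"
        by (simp add: algebra_simps)
    qed
    ultimately show ?thesis by (auto simp: dist_norm)
  qed
  show ?thesis
    unfolding free_space_def closure_approachable
  proof (intro allI impI)
    fix e :: real assume e: "e > 0"
    define c where "c = measure m (topspace ?\<beta>) + 1"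
    have c: "c > 0" by (simp add: c_def add_nonneg_pos)
    obtain \<psi> where \<psi>: "\<psi> \<in> span (range lip_eval)" "dist \<psi> \<phi> \<le> e / (2 * c) * c"
      using approx[of "e / (2 * c)"] e c unfolding c_def by auto
    moreover have "e / (2 * c) * c < e" using e c by simp
    ultimately show "\<exists>\<psi>\<in>span (range lip_eval). dist \<psi> \<phi> < e"
      by (intro bexI[of _ \<psi>]) simp_all
  qed
qed

section \<open>Representing functionals by positive measures\<close>

text \<open>The \<open>0\<close> covers the empty set \<open>K\<close>, which occurs when \<open>M\<close> is a single point.\<close>

definition sup_pos :: "'b set \<Rightarrow> ('b \<Rightarrow> real) \<Rightarrow> real" where
  "sup_pos K g = Sup (insert 0 (g ` K))"

lemma sup_pos_least: "0 \<le> b \<Longrightarrow> (\<And>x. x \<in> K \<Longrightarrow> g x \<le> b) \<Longrightarrow> sup_pos K g \<le> b"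
  unfolding sup_pos_def by (intro cSup_least) auto

lemma sup_pos_upper:
  assumes "compact_space X" "continuous_map X euclideanreal g"
  shows "0 \<le> sup_pos (topspace X) g" "x \<in> topspace X \<Longrightarrow> g x \<le> sup_pos (topspace X) g"
proof -
  obtain B where B: "B > 0" "\<And>x. x \<in> topspace X \<Longrightarrow> \<bar>g x\<bar> \<le> B"
    using continuous_map_bounded[OF assms] by metis
  have "bdd_above (insert 0 (g ` topspace X))"
  proof (rule bdd_aboveI)
    fix y assume "y \<in> insert 0 (g ` topspace X)"
    then show "y \<le> B" using B by (auto simp: abs_le_iff)
  qed
  then show "0 \<le> sup_pos (topspace X) g" "x \<in> topspace X \<Longrightarrow> g x \<le> sup_pos (topspace X) g"
    unfolding sup_pos_def by (auto intro: cSup_upper)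
qed

lemma subspace_continuous_map: "subspace {g. continuous_map X euclideanreal g}"
  by (auto simp: subspace_def plus_fun_def zero_fun_def scaleR_fun_def continuous_map_const
      intro: continuous_map_add continuous_map_real_mult_left)

lemma sublinear_on_sup_pos:
  assumes X: "compact_space X" and c: "0 \<le> c"
  shows "sublinear_on {g. continuous_map X euclideanreal g} (\<lambda>g. c * sup_pos (topspace X) g)"
proof -
  note up = sup_pos_upper[OF X]
  let ?s = "sup_pos (topspace X)"
  have add: "?s (g + h) \<le> ?s g + ?s h"
    if "continuous_map X euclideanreal g" "continuous_map X euclideanreal h" for g h
    using up[OF that(1)] up[OF that(2)] by (intro sup_pos_least) (auto intro: add_mono)
  have scale_le: "?s (a *\<^sub>R g) \<le> a * ?s g" if "continuous_map X euclideanreal g" "0 \<le> a" for a g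
    using up[OF that(1)] that(2) by (intro sup_pos_least) (auto simp: scaleR_fun_def mult_left_mono)
  have scale: "?s (a *\<^sub>R g) = a * ?s g" if g: "continuous_map X euclideanreal g" and a: "0 \<le> a" for a g
  proof (cases "a = 0")
    case True
    have "continuous_map X euclideanreal (a *\<^sub>R g)"
      using g by (simp add: scaleR_fun_def continuous_map_real_mult_left)
    then show ?thesis using scale_le[OF g a] up(1)[of "a *\<^sub>R g"] True by simp
  next
    case False
    have "continuous_map X euclideanreal (a *\<^sub>R g)"
      using g by (simp add: scaleR_fun_def continuous_map_real_mult_left)
    from scale_le[OF this, of "inverse a"] False a
    have "a * ?s g \<le> ?s (a *\<^sub>R g)" by (simp add: field_simps)
    with scale_le[OF g a] show ?thesis by simp
  qed
  have "c * ?s (g + h) \<le> c * ?s g + c * ?s h"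
    if "continuous_map X euclideanreal g" "continuous_map X euclideanreal h" for g h
    using mult_left_mono[OF add[OF that] c] by (simp add: distrib_left)
  then show ?thesis using scale by (simp add: sublinear_on_def mult.left_commute)
qed

lemma norm_lip0_le_sup_pos:
  fixes f :: "'a::{metric_space,zero} lip0"
  shows "norm f \<le> sup_pos (topspace beta_offdiag) (de_leeuw f)"
proof (intro norm_lip0_le lipschitz_onI)
  let ?s = "sup_pos (topspace beta_offdiag) (de_leeuw f)"
  note up = sup_pos_upper[OF compact_space_stone_cech continuous_map_de_leeuw[of f]]
  show "0 \<le> ?s" by (rule up(1))
  have le: "lip0_apply f x - lip0_apply f y \<le> ?s * dist x y" for x y
  proof (cases "x = y")
    case False
    then have p: "(x, y) \<in> topspace offdiag" by (simp add: offdiag_def)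
    have "diff_quot (lip0_apply f) (x, y) \<le> ?s"
      using up(2)[OF stone_cech_embed_in[OF p]] by (simp add: de_leeuw_embed[OF p])
    then show ?thesis using False by (simp add: diff_quot_def divide_le_eq)
  qed simp
  show "dist (lip0_apply f x) (lip0_apply f y) \<le> ?s * dist x y" for x y
    using le[of x y] le[of y x] by (simp add: dist_real_def dist_commute abs_le_iff)
qed

text \<open>
  Positive measures suffice, since swapping \<open>x\<close> and \<open>y\<close> changes the sign of the difference
  quotient: the norm of \<open>f\<close> is the supremum of \<open>de_leeuw f\<close>, not only of its absolute value.
\<close>

lemma lip0_dual_representation:
  fixes \<phi> :: "'a::{metric_space,zero} lip0_dual"
  obtains m where "radon_measure beta_offdiag m" "measure m (topspace beta_offdiag) \<le> norm \<phi>"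
    "\<And>f. blinfun_apply \<phi> f = integral\<^sup>L m (de_leeuw f)"
proof -
  let ?\<beta> = "beta_offdiag :: ((('a \<times> 'a) \<Rightarrow> real) \<Rightarrow> real) topology"
  let ?K = "topspace ?\<beta>"
  define E where "E = {g. continuous_map ?\<beta> euclideanreal g}"
  define p where "p g = norm \<phi> * sup_pos ?K g" for g
  \<comment> \<open>\<open>de_leeuw\<close> is additive and homogeneous only on the
    compactification, because the extension is unspecified elsewhere; the cut-off makes
    \<open>T\<close> a linear map into the function space.\<close>
  define T where "T f q = (if q \<in> ?K then de_leeuw f q else 0)" for f :: "'a lip0" and q
  have E: "subspace E" unfolding E_def by (rule subspace_continuous_map)
  have p: "sublinear_on E p"
    unfolding E_def p_def by (intro sublinear_on_sup_pos compact_space_stone_cech norm_ge_zero)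
  have T: "T f \<in> E" for f
    unfolding E_def mem_Collect_eq
    by (rule continuous_map_eq[OF continuous_map_de_leeuw[of f]]) (simp add: T_def)
  have Tadd: "T (f + g) = T f + T g" and Tscale: "T (a *\<^sub>R f) = a *\<^sub>R T f" for f g a
    by (auto simp: T_def fun_eq_iff scaleR_fun_def de_leeuw_linear)
  have Tsup: "sup_pos ?K (T f) = sup_pos ?K (de_leeuw f)" for f
    unfolding sup_pos_def by (auto simp: T_def intro!: arg_cong[where f = Sup])
  have R: "dominated_cone E p (range (\<lambda>f. (T f, \<phi> f)))"
    unfolding dominated_cone_def
  proof (intro conjI ballI allI impI)
    have "T 0 = 0" using Tscale[of 0 0] by (simp only: scaleR_zero_left)
    then have "0 = (T 0, \<phi> 0)" by (simp only: zero_prod_def blinfun.zero_right)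
    then show "0 \<in> range (\<lambda>f. (T f, \<phi> f))" by (rule range_eqI)
  next
    fix z w assume "z \<in> range (\<lambda>f. (T f, \<phi> f))" "w \<in> range (\<lambda>f. (T f, \<phi> f))"
    then obtain f g where "z = (T f, \<phi> f)" "w = (T g, \<phi> g)" by blast
    then have "z + w = (T (f + g), \<phi> (f + g))"
      by (simp only: Tadd blinfun.add_right add_Pair)
    then show "z + w \<in> range (\<lambda>f. (T f, \<phi> f))" by blast
  next
    fix c :: real and z assume "z \<in> range (\<lambda>f. (T f, \<phi> f))"
    then obtain f where "z = (T f, \<phi> f)" by blast
    then have "c *\<^sub>R z = (T (c *\<^sub>R f), \<phi> (c *\<^sub>R f))"
      by (simp only: Tscale blinfun.scaleR_right scaleR_Pair)
    then show "c *\<^sub>R z \<in> range (\<lambda>f. (T f, \<phi> f))" by blast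
  next
    fix z assume "z \<in> range (\<lambda>f. (T f, \<phi> f))"
    then obtain f where f: "z = (T f, \<phi> f)" by blast
    have "\<phi> f \<le> norm \<phi> * norm f"
      using norm_blinfun[of \<phi> f] by (simp add: abs_le_iff)
    also have "\<dots> \<le> p (T f)"
      unfolding p_def Tsup by (intro mult_left_mono norm_lip0_le_sup_pos norm_ge_zero)
    finally show "case z of (s, r) \<Rightarrow> s \<in> E \<and> r \<le> p s" using T f by simp
  qed
  obtain q where q': "\<forall>x\<in>E. \<forall>y\<in>E. q (x + y) = q x + q y"
    "\<forall>c. \<forall>x\<in>E. q (c *\<^sub>R x) = c * q x" "\<forall>x\<in>E. q x \<le> p x"
    "\<forall>(s, r)\<in>range (\<lambda>f. (T f, \<phi> f)). r \<le> q s"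
    by (rule hahn_banach_cone[OF E p R])
  have q: "x \<in> E \<Longrightarrow> y \<in> E \<Longrightarrow> q (x + y) = q x + q y" "x \<in> E \<Longrightarrow> q (c *\<^sub>R x) = c * q x"
    "x \<in> E \<Longrightarrow> q x \<le> p x" "\<phi> f \<le> q (T f)" for x y c f
    using q' by auto
  have \<phi>q: "q (T f) = \<phi> f" for f
  proof -
    \<comment> \<open>The cone only yields \<open>\<phi> f \<le> q (T f)\<close>; the same
      inequality for the negative of \<open>f\<close> turns it into equality.\<close>
    have "q (T (-1 *\<^sub>R f)) = - q (T f)" using q(2)[OF T[of f], of "-1"] unfolding Tscale by simp
    moreover have "\<phi> (-1 *\<^sub>R f) = - \<phi> f" by (simp add: blinfun.minus_right)
    ultimately show ?thesis using q(4)[of f] q(4)[of "-1 *\<^sub>R f"] by simp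
  qed
  interpret positive_functional ?\<beta> q
  proof
    show "compact_space ?\<beta>" "Hausdorff_space ?\<beta>"
      by (rule compact_space_stone_cech Hausdorff_space_stone_cech)+
    fix f g :: "(('a \<times> 'a \<Rightarrow> real) \<Rightarrow> real) \<Rightarrow> real" and c :: real
    assume f: "continuous_map ?\<beta> euclideanreal f"
    show "q (\<lambda>x. f x + g x) = q f + q g" if g: "continuous_map ?\<beta> euclideanreal g"
      using q(1)[of f g] f g by (simp add: E_def plus_fun_def)
    show scale: "q (\<lambda>x. c * f x) = c * q f" for c
      using q(2)[of f c] f by (simp add: E_def scaleR_fun_def)
    show "0 \<le> q f" if "\<And>x. x \<in> ?K \<Longrightarrow> 0 \<le> f x"
    proof -
      \<comment> \<open>Domination by a multiple of the one-sided supremum forces positivity: if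
        \<open>f\<close> is nonnegative, the dominating value at \<open>- f\<close> is at most
        0.\<close>
      have "sup_pos ?K (\<lambda>x. -1 * f x) \<le> 0" using that by (intro sup_pos_least) auto
      then have "p (\<lambda>x. -1 * f x) \<le> 0" unfolding p_def by (intro mult_nonneg_nonpos) auto
      moreover have "q (\<lambda>x. -1 * f x) \<le> p (\<lambda>x. -1 * f x)"
        using continuous_map_real_mult_left[OF f, of "-1"] by (intro q(3)) (simp add: E_def)
      ultimately show ?thesis using scale[of "-1"] by simp
    qed
  qed
  show thesis
  proof (rule that[of riesz])
    show "radon_measure ?\<beta> riesz" by (rule radon_measure_riesz)
    \<comment> \<open>The mass is the value of the functional at the constant 1, so the domination
      that controls the extension also bounds the mass.\<close>
    have "total \<le> p (\<lambda>_. 1)"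
      unfolding total_def by (intro q(3)) (simp add: E_def continuous_map_const)
    also have "\<dots> \<le> norm \<phi> * 1"
      unfolding p_def by (intro mult_left_mono sup_pos_least) auto
    finally show "measure riesz ?K \<le> norm \<phi>" by (simp add: measure_riesz_space)
    fix f
    have "integral\<^sup>L riesz (de_leeuw f) = q (de_leeuw f)"
      by (rule riesz_representation[OF continuous_map_de_leeuw])
    also have "\<dots> = q (T f)"
      using T[of f] by (intro cong continuous_map_de_leeuw) (auto simp: E_def T_def)
    finally show "\<phi> f = integral\<^sup>L riesz (de_leeuw f)" by (simp add: \<phi>q)
  qed
qed

section \<open>The L-projection\<close>

text \<open>A density keeps the Borel sets of the whole compactification, so the restriction stays
  comparable with \<open>restrict_signed\<close>.\<close>

lemma radon_measure_restricted:
  assumes X: "Hausdorff_space X" and m: "radon_measure X m" and S: "S \<in> sets (borel_of X)"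
  shows "radon_measure X (density m (indicator S))"
  unfolding radon_measure_iff[OF X]
proof (intro conjI ballI allI impI)
  have m': "sets m = sets (borel_of X)" "finite_measure m"
    using m by (auto simp: radon_measure_def)
  interpret finite_measure m by fact
  have Sm: "S \<in> sets m" by (simp add: m' S)
  show "sets (density m (indicator S)) = sets (borel_of X)" by (simp add: m')
  show "finite_measure (density m (indicator S))" by (rule finite_measure_restricted[OF Sm])
  fix A and e :: real assume A: "A \<in> sets (density m (indicator S))" and e: "e > 0"
  then have A: "A \<in> sets m" by simp
  then obtain K where K: "compactin X K" "K \<subseteq> A" "measure m (A - K) \<le> e"
    using m e unfolding radon_measure_iff[OF X] by metis
  have AK: "A - K \<in> sets m"
    using A m' compactin_sets_borel_of[OF X K(1)] by auto
  have "measure (density m (indicator S)) (A - K) = measure m (S \<inter> (A - K))"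
    by (rule measure_restricted[OF Sm AK])
  also have "\<dots> \<le> measure m (A - K)"
    using AK by (intro finite_measure_mono) auto
  finally show "\<exists>K. compactin X K \<and> K \<subseteq> A \<and> measure (density m (indicator S)) (A - K) \<le> e"
    using K by (intro exI[of _ K]) auto
qed

section \<open>The adjoint of the de Leeuw map on signed Radon measures\<close>

lemma de_leeuw_adj_apply:
  "signed_radon_measure beta_offdiag \<mu> \<Longrightarrow>
    blinfun_apply (de_leeuw_adj \<mu>) f = signed_integral beta_offdiag \<mu> (de_leeuw f)"
  unfolding de_leeuw_adj_def
  by (rule fun_cong[OF bounded_linear_Blinfun_apply[OF bounded_linear_signed_integral_de_leeuw]])

lemma de_leeuw_measurable: "de_leeuw f \<in> borel_measurable (borel_of beta_offdiag)"
  by (rule continuous_map_borel_measurable[OF continuous_map_de_leeuw refl])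

lemma de_leeuw_adj_add:
  assumes "signed_radon_measure beta_offdiag \<mu>" "signed_radon_measure beta_offdiag \<nu>"
  shows "de_leeuw_adj (\<lambda>A. \<mu> A + \<nu> A) = de_leeuw_adj \<mu> + de_leeuw_adj \<nu>"
  by (intro blinfun_eqI)
    (simp add: blinfun.add_left de_leeuw_adj_apply assms
      signed_radon_measure_add[OF Hausdorff_space_stone_cech assms]
      signed_integral_add[OF Hausdorff_space_stone_cech assms de_leeuw_measurable abs_de_leeuw_le])

lemma de_leeuw_adj_scale:
  assumes "signed_radon_measure beta_offdiag \<nu>"
  shows "de_leeuw_adj (\<lambda>A. a * \<nu> A) = a *\<^sub>R de_leeuw_adj \<nu>"
  by (intro blinfun_eqI)
    (simp add: blinfun.scaleR_left de_leeuw_adj_apply assms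
      signed_radon_measure_scale[OF Hausdorff_space_stone_cech assms]
      signed_integral_scale[OF Hausdorff_space_stone_cech assms de_leeuw_measurable abs_de_leeuw_le])

lemma de_leeuw_adj_eq_integral:
  assumes \<nu>: "signed_radon_measure beta_offdiag \<nu>" and m: "radon_measure beta_offdiag m"
    and eq: "\<And>A. A \<in> sets (borel_of beta_offdiag) \<Longrightarrow> \<nu> A = measure m A"
  shows "blinfun_apply (de_leeuw_adj \<nu>) f = integral\<^sup>L m (de_leeuw f)"
  unfolding de_leeuw_adj_apply[OF \<nu>] using m
  by (intro signed_integral_eq_integral[OF \<nu> _ _ eq de_leeuw_measurable abs_de_leeuw_le])
    (auto simp: radon_measure_def)

lemma norm_de_leeuw_adj_le:
  assumes \<nu>: "signed_radon_measure beta_offdiag \<nu>" and m: "radon_measure beta_offdiag m"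
    and eq: "\<And>A. A \<in> sets (borel_of beta_offdiag) \<Longrightarrow> \<nu> A = measure m A"
  shows "norm (de_leeuw_adj \<nu>) \<le> measure m (topspace beta_offdiag)"
proof (rule norm_blinfun_bound)
  have m': "finite_measure m" "space m = topspace beta_offdiag"
    using m sets_eq_imp_space_eq[of m "borel_of beta_offdiag"] by (auto simp: radon_measure_def)
  interpret finite_measure m by fact
  fix f
  have adj: "de_leeuw_adj \<nu> f = integral\<^sup>L m (de_leeuw f)"
    by (rule de_leeuw_adj_eq_integral[OF \<nu> m eq])
  have "\<bar>integral\<^sup>L m (de_leeuw f)\<bar> \<le> (\<integral>p. \<bar>de_leeuw f p\<bar> \<partial>m)"
    by (rule integral_abs_bound)
  also have "\<dots> \<le> (\<integral>p. norm f \<partial>m)"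
    by (intro integral_mono integrable_abs integrable_de_leeuw[OF m]) (auto simp: m' abs_de_leeuw_le)
  finally show "norm (de_leeuw_adj \<nu> f) \<le> measure m (topspace beta_offdiag) * norm f"
    by (simp add: adj m' mult.commute)
qed simp

text \<open>Carries the projection from the dual of the Lipschitz space to the bidual of the free
  space. As \<open>J\<close> is injective and isometric, each law can be verified after applying
  \<open>J\<close>.\<close>

lemma L_projection_conj:
  fixes J :: "'b::real_normed_vector \<Rightarrow> 'c::real_normed_vector"
  assumes J: "bounded_linear J" "bij J" "\<And>x. norm (J x) = norm x" and P: "L_projection P (J ` Y)"
  shows "L_projection (inv J \<circ> P \<circ> J) Y"
proof -
  interpret J: bounded_linear J by fact
  have P': "bounded_linear P" "range P = J ` Y" "\<And>x. P (P x) = P x"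
    "\<And>x. norm x = norm (P x) + norm (x - P x)"
    using P unfolding L_projection_def by blast+
  interpret P: bounded_linear P by fact
  have JI: "J (inv J y) = y" for y by (rule surj_f_inv_f[OF bij_is_surj[OF J(2)]])
  have IJ: "inv J (J x) = x" for x by (rule inv_f_f[OF bij_is_inj[OF J(2)]])
  have inj: "x = y \<longleftrightarrow> J x = J y" for x y
    using bij_is_inj[OF J(2)] by (simp add: inj_eq)
  define Q where "Q = inv J \<circ> P \<circ> J"
  have JQ: "J (Q x) = P (J x)" for x by (simp add: Q_def JI)
  have nQ: "norm x = norm (Q x) + norm (x - Q x)" for x
    using P'(4)[of "J x"] J(3)[of x] J(3)[of "Q x"] J(3)[of "x - Q x"] by (simp add: JQ J.diff)
  have "bounded_linear Q"
  proof (rule bounded_linear_intro[where K = 1])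
    show "Q (x + y) = Q x + Q y" for x y
      unfolding inj[of "Q (x + y)"] by (simp add: JQ J.add P.add)
    show "Q (r *\<^sub>R x) = r *\<^sub>R Q x" for r x
      unfolding inj[of "Q (r *\<^sub>R x)"] by (simp add: JQ J.scaleR P.scaleR)
    show "norm (Q x) \<le> norm x * 1" for x
      using nQ[of x] by simp
  qed
  moreover have "range Q = Y"
  proof -
    have "J ` range Q = P ` range J" by (auto simp: JQ image_image)
    also have "range J = UNIV" by (rule bij_is_surj[OF J(2)])
    finally have "J ` range Q = J ` Y" using P'(2) by simp
    then show ?thesis by (simp add: inj_image_eq_iff[OF bij_is_inj[OF J(2)]])
  qed
  moreover have "Q (Q x) = Q x" for x
    unfolding inj[of "Q (Q x)"] by (simp add: JQ P'(3))
  ultimately show ?thesis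
    using nQ unfolding L_projection_def Q_def by blast
qed

lemma bidual_iso_range: "bidual_iso ` range bidual_embed = free_space"
proof -
  have "bidual_iso ` range bidual_embed = range lipfree_incl"
    by (simp add: image_image bidual_iso_embed)
  also have "\<dots> = free_space" by (rule type_definition.Rep_range[OF type_definition_lipfree])
  finally show ?thesis .
qed

theorem proposition6p2:
  assumes "\<And>\<mu>. signed_radon_measure beta_offdiag \<mu> \<Longrightarrow>
      de_leeuw_adj \<mu> \<in> (free_space :: 'a::{complete_space,zero} lip0_dual set) \<Longrightarrow>
      de_leeuw_adj \<mu> = de_leeuw_adj (restrict_signed \<mu> offdiag_in_beta)"
  shows "L_embedded TYPE('a lipfree) \<and>
    (\<exists>P :: 'a lip0_dual \<Rightarrow> 'a lip0_dual.
       L_projection P free_space \<and>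
       L_projection (inv bidual_iso \<circ> P \<circ> bidual_iso) (range bidual_embed) \<and>
       (\<forall>\<phi> :: 'a lip0_dual.
          (\<exists>\<mu>. signed_radon_measure beta_offdiag \<mu> \<and> \<phi> = de_leeuw_adj \<mu>) \<and>
          (\<forall>\<mu>. signed_radon_measure beta_offdiag \<mu> \<longrightarrow> \<phi> = de_leeuw_adj \<mu> \<longrightarrow>
             P \<phi> = de_leeuw_adj (restrict_signed \<mu> offdiag_in_beta))))"
proof -
  let ?\<beta> = "beta_offdiag :: ((('a \<times> 'a) \<Rightarrow> real) \<Rightarrow> real) topology"
  define S where "S = (offdiag_in_beta :: ((('a \<times> 'a) \<Rightarrow> real) \<Rightarrow> real) set)"
  define S' where "S' = topspace ?\<beta> - S"
  note X = Hausdorff_space_stone_cech[of "offdiag :: ('a \<times> 'a) topology"]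
  note restr = signed_radon_measure_restrict[OF X]
  have S: "S \<in> sets (borel_of ?\<beta>)" unfolding S_def by (rule offdiag_in_beta_sets)
  have S': "S' \<in> sets (borel_of ?\<beta>)" using sets.compl_sets[OF S] by (simp add: S'_def)
  have hyp: "de_leeuw_adj (restrict_signed \<mu> S) = de_leeuw_adj \<mu>"
    if "signed_radon_measure ?\<beta> \<mu>" "de_leeuw_adj \<mu> \<in> free_space" for \<mu>
    using assms[OF that] by (simp add: S_def)
  have "\<forall>\<phi> :: 'a lip0_dual. \<exists>m. radon_measure ?\<beta> m \<and> measure m (topspace ?\<beta>) \<le> norm \<phi> \<and>
      (\<forall>f. blinfun_apply \<phi> f = integral\<^sup>L m (de_leeuw f))"
    using lip0_dual_representation by metis
  \<comment> \<open>The choices for different functionals are unrelated; \<open>wd\<close> below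
    removes the dependence on them.\<close>
  then obtain m where m: "\<And>\<phi>. radon_measure ?\<beta> (m \<phi>)" "\<And>\<phi>. measure (m \<phi>) (topspace ?\<beta>) \<le> norm \<phi>"
    "\<And>\<phi> f. blinfun_apply \<phi> f = integral\<^sup>L (m \<phi>) (de_leeuw f)"
    by metis
  have sets_m: "sets (m \<phi>) = sets (borel_of ?\<beta>)" and fin_m: "finite_measure (m \<phi>)" for \<phi>
    using m(1)[of \<phi>] by (auto simp: radon_measure_def)
  have srm: "signed_radon_measure ?\<beta> (measure (m \<phi>))" for \<phi>
    by (rule signed_radon_measure_measure[OF X m(1)])
  have adj_m: "de_leeuw_adj (measure (m \<phi>)) = \<phi>" for \<phi>
    by (intro blinfun_eqI) (simp add: de_leeuw_adj_eq_integral[OF srm m(1)] m(3)[of \<phi>])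
  define P where "P \<phi> = de_leeuw_adj (restrict_signed (measure (m \<phi>)) S)" for \<phi>
  have wd: "P \<phi> = de_leeuw_adj (restrict_signed \<mu> S)"
    if \<mu>: "signed_radon_measure ?\<beta> \<mu>" and \<phi>: "\<phi> = de_leeuw_adj \<mu>" for \<mu> \<phi>
  proof -
    have neg: "signed_radon_measure ?\<beta> (\<lambda>A. (-1) * \<mu> A)"
      by (rule signed_radon_measure_scale[OF X \<mu>])
    have sum: "signed_radon_measure ?\<beta> (\<lambda>A. measure (m \<phi>) A + (-1) * \<mu> A)"
      by (rule signed_radon_measure_add[OF X srm neg])
    \<comment> \<open>The functional 0 lies in the free space, so the hypothesis applies to the
      difference of two representing measures even when \<open>\<phi>\<close> is outside that
      space.\<close>
    have "de_leeuw_adj (\<lambda>A. measure (m \<phi>) A + (-1) * \<mu> A) = 0"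
      unfolding de_leeuw_adj_add[OF srm neg] de_leeuw_adj_scale[OF \<mu>] adj_m by (simp add: \<phi>)
    then have "0 = de_leeuw_adj (restrict_signed (\<lambda>A. measure (m \<phi>) A + (-1) * \<mu> A) S)"
      using hyp[OF sum] subspace_0[OF subspace_free_space] by simp
    also have "restrict_signed (\<lambda>A. measure (m \<phi>) A + (-1) * \<mu> A) S =
        (\<lambda>A. restrict_signed (measure (m \<phi>)) S A + (-1) * restrict_signed \<mu> S A)"
      by (simp add: restrict_signed_def fun_eq_iff)
    also have "de_leeuw_adj \<dots> = P \<phi> + (-1) *\<^sub>R de_leeuw_adj (restrict_signed \<mu> S)"
      unfolding P_def
      using de_leeuw_adj_add[OF restr[OF srm S] signed_radon_measure_scale[OF X restr[OF \<mu> S], of "-1"]]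
        de_leeuw_adj_scale[OF restr[OF \<mu> S], of "-1"] by simp
    finally show ?thesis by simp
  qed
  have P_add: "P (\<phi> + \<psi>) = P \<phi> + P \<psi>" for \<phi> \<psi>
  proof -
    \<comment> \<open>The sum of the chosen measures represents \<open>\<phi> + \<psi>\<close>,
      although it need not be the measure chosen for that functional.\<close>
    have "P (\<phi> + \<psi>) = de_leeuw_adj (restrict_signed (\<lambda>A. measure (m \<phi>) A + measure (m \<psi>) A) S)"
      by (rule wd[OF signed_radon_measure_add[OF X srm srm]]) (simp add: de_leeuw_adj_add srm adj_m)
    also have "restrict_signed (\<lambda>A. measure (m \<phi>) A + measure (m \<psi>) A) S =
        (\<lambda>A. restrict_signed (measure (m \<phi>)) S A + restrict_signed (measure (m \<psi>)) S A)"
      by (simp add: restrict_signed_def fun_eq_iff)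
    finally show ?thesis by (simp add: P_def de_leeuw_adj_add restr[OF srm S])
  qed
  have P_scale: "P (r *\<^sub>R \<phi>) = r *\<^sub>R P \<phi>" for r \<phi>
  proof -
    have "P (r *\<^sub>R \<phi>) = de_leeuw_adj (restrict_signed (\<lambda>A. r * measure (m \<phi>) A) S)"
      by (rule wd[OF signed_radon_measure_scale[OF X srm]]) (simp add: de_leeuw_adj_scale srm adj_m)
    also have "restrict_signed (\<lambda>A. r * measure (m \<phi>) A) S = (\<lambda>A. r * restrict_signed (measure (m \<phi>)) S A)"
      by (simp add: restrict_signed_def fun_eq_iff)
    finally show ?thesis by (simp add: P_def de_leeuw_adj_scale restr[OF srm S])
  qed
  have restr_m: "restrict_signed (measure (m \<phi>)) T A = measure (density (m \<phi>) (indicator T)) A"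
    if "T \<in> sets (borel_of ?\<beta>)" "A \<in> sets (borel_of ?\<beta>)" for T A \<phi>
    using measure_restricted[of T "m \<phi>" A] that by (simp add: restrict_signed_def sets_m Int_commute)
  have rad: "radon_measure ?\<beta> (density (m \<phi>) (indicator T))" if "T \<in> sets (borel_of ?\<beta>)" for T \<phi>
    by (rule radon_measure_restricted[OF X m(1) that])
  have top: "topspace ?\<beta> \<in> sets (borel_of ?\<beta>)" using sets.top[of "borel_of ?\<beta>"] by simp
  have P_free: "P \<phi> \<in> free_space" for \<phi>
  proof (rule radon_functional_in_free_space[OF _ rad[OF S]])
    show "offdiag_in_beta \<in> sets (borel_of ?\<beta>)" using S by (simp add: S_def)
    have "S \<inter> (topspace ?\<beta> - S) = {}" by blast
    then show "measure (density (m \<phi>) (indicator S)) (topspace ?\<beta> - offdiag_in_beta) = 0"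
      using measure_restricted[of S "m \<phi>" S'] S S' by (simp add: sets_m S_def S'_def)
    show "blinfun_apply (P \<phi>) f = integral\<^sup>L (density (m \<phi>) (indicator S)) (de_leeuw f)" for f
      unfolding P_def by (rule de_leeuw_adj_eq_integral[OF restr[OF srm S] rad[OF S] restr_m[OF S]])
  qed
  have P_id: "P \<phi> = \<phi>" if "\<phi> \<in> free_space" for \<phi>
    unfolding P_def using hyp[OF srm, of \<phi>] that by (simp add: adj_m)
  have P_norm: "norm \<phi> = norm (P \<phi>) + norm (\<phi> - P \<phi>)" for \<phi>
  proof (rule antisym)
    show "norm \<phi> \<le> norm (P \<phi>) + norm (\<phi> - P \<phi>)"
      using norm_triangle_ineq[of "P \<phi>" "\<phi> - P \<phi>"] by simp
    interpret finite_measure "m \<phi>" by (rule fin_m)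
    let ?R = "\<lambda>T. restrict_signed (measure (m \<phi>)) T"
    have split: "?R S A + ?R S' A = measure (m \<phi>) A" if A: "A \<in> sets (borel_of ?\<beta>)" for A
    proof -
      have "A = (A \<inter> S) \<union> (A \<inter> S')" using sets.sets_into_space[OF A] by (auto simp: S'_def)
      then have "measure (m \<phi>) A = measure (m \<phi>) ((A \<inter> S) \<union> (A \<inter> S'))" by simp
      also have "\<dots> = measure (m \<phi>) (A \<inter> S) + measure (m \<phi>) (A \<inter> S')"
        using A S S' by (intro finite_measure_Union) (auto simp: sets_m S'_def)
      finally show ?thesis by (simp add: restrict_signed_def)
    qed
    have "de_leeuw_adj (?R S) + de_leeuw_adj (?R S') = de_leeuw_adj (\<lambda>A. ?R S A + ?R S' A)"
      by (rule de_leeuw_adj_add[OF restr[OF srm S] restr[OF srm S'], symmetric])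
    also have "\<dots> = \<phi>"
      by (intro blinfun_eqI)
        (simp add: m(3)[of \<phi>] de_leeuw_adj_eq_integral[OF signed_radon_measure_add[OF X restr[OF srm S] restr[OF srm S']] m(1) split])
    finally have "\<phi> - P \<phi> = de_leeuw_adj (?R S')" by (simp add: P_def algebra_simps)
    then have "norm (P \<phi>) + norm (\<phi> - P \<phi>) \<le>
        measure (density (m \<phi>) (indicator S)) (topspace ?\<beta>) + measure (density (m \<phi>) (indicator S')) (topspace ?\<beta>)"
      unfolding P_def
      using norm_de_leeuw_adj_le[OF restr[OF srm S] rad[OF S] restr_m[OF S]]
        norm_de_leeuw_adj_le[OF restr[OF srm S'] rad[OF S'] restr_m[OF S']] by (simp add: add_mono)
    also have "\<dots> = measure (m \<phi>) (topspace ?\<beta>)"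
      using split[OF top] by (simp add: restr_m[OF S top] restr_m[OF S' top])
    \<comment> \<open>This needs the particular measure \<open>m \<phi>\<close>: an arbitrary
      representing measure may have mass larger than \<open>norm \<phi>\<close>.\<close>
    also have "\<dots> \<le> norm \<phi>" by (rule m(2))
    finally show "norm (P \<phi>) + norm (\<phi> - P \<phi>) \<le> norm \<phi>" .
  qed
  have L: "L_projection P free_space"
    unfolding L_projection_def
  proof (intro conjI allI)
    show "bounded_linear P"
    proof (rule bounded_linear_intro[where K = 1])
      show "norm (P \<phi>) \<le> norm \<phi> * 1" for \<phi>
        using P_norm[of \<phi>] by simp
    qed (rule P_add P_scale)+
    show "range P = free_space"
      using P_free P_id by (auto simp: image_iff) metis
    show "P (P \<phi>) = P \<phi>" for \<phi> by (rule P_id[OF P_free])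
  qed (rule P_norm)
  have L': "L_projection (inv bidual_iso \<circ> P \<circ> bidual_iso) (range (bidual_embed :: 'a lipfree \<Rightarrow> _))"
    by (rule L_projection_conj[OF bounded_linear_bidual_iso bij_bidual_iso norm_bidual_iso])
      (simp only: bidual_iso_range L)
  have rep: "(\<exists>\<mu>. signed_radon_measure ?\<beta> \<mu> \<and> \<phi> = de_leeuw_adj \<mu>) \<and>
      (\<forall>\<mu>. signed_radon_measure ?\<beta> \<mu> \<longrightarrow> \<phi> = de_leeuw_adj \<mu> \<longrightarrow>
         P \<phi> = de_leeuw_adj (restrict_signed \<mu> offdiag_in_beta))" for \<phi>
    using srm[of \<phi>] adj_m[of \<phi>] wd unfolding S_def by metis
  from L L' rep show ?thesis
    unfolding L_embedded_def by blast
qed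

end
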